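(* Let $\mathcal{P}:\mathbb{C}^{\mathrm{op}}\to\mathbf{Pos}$ be an indexed frame and let $E:\mathbb{C}\langle\mathcal{P}\rangle\to\mathbb{C}[\mathcal{P}]$ be the functor which is the identity on objects and sends $f:(A,\rho)\to(B,\sigma)$ to the predicate $E(f)(x,u)\equiv\rho(x)\wedge\sigma(fx,u)$. (i) A morphism $f:(A,\rho)\to(B,\sigma)$ in $\mathbb{C}\langle\mathcal{P}\rangle$ is a weak equivalence if and only if $E(f)$ is an isomorphism in $\mathbb{C}[\mathcal{P}]$. (ii) For any category $\mathbb{D}$ and any functor $F:\mathbb{C}\langle\mathcal{P}\rangle\to\mathbb{D}$ sending weak equivalences to isomorphisms there exists a unique functor $\widetilde F:\mathbb{C}[\mathcal{P}]\to\mathbb{D}$ satisfying $\widetilde F\circ E=F$.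
   Context: **Indexed frames.** An indexed poset on a category $\mathbb{C}$ is a functor $\mathcal{A}:\mathbb{C}^{\mathrm{op}}\to\mathbf{Pos}$ to posets and monotone maps (default size convention: $\mathbb{C}$ and the posets are small); for $f:J\to I$ write $f^*=\mathcal{A}(f)$; elements of $\mathcal{A}(I)$ are called predicates on $I$. It is an indexed meet-semilattice if every $\mathcal{A}(I)$ has finite meets (including a greatest element $\top$) and all $f^*$ preserve them. An indexed frame is an indexed meet-semilattice $\mathcal{P}$ on a category $\mathbb{C}$ with finite limits such that: (Ex) every $f^*$ has a left adjoint $\exists_f$; (Fr) $(\exists_f\varphi)\wedge\psi=\exists_f(\varphi\wedge f^*\psi)$ for $f:J\to I$, $\varphi\in\mathcal{P}(J)$, $\psi\in\mathcal{P}(I)$; (BC) $\exists_h\circ k^*=f^*\circ\exists_g$ for every pullback square in $\mathbb{C}$ with $fh=gk$, $h:D\to A$, $k:D\to B$, $f:A\to C$, $g:B\to C$. **Internal language.** Sorts are objects of $\mathbb{C}$; function symbols of arity $A_1,\dots,A_n\to B$ are morphisms $A_1\times\dots\times A_n\to B$; relation symbols of arity $A_1,\dots,A_n$ are elements of $\mathcal{P}(A_1\times\dots\times A_n)$. Formulas are built from $\varphi(\vec t)$ and $s=t$ using $\wedge,\top,\exists$. For a context $\vec x=x_1,\dots,x_n$ of distinct variables let $\mathfrak{s}(\vec x)$ be the product of the sorts. Terms in context $\vec x$ are interpreted as morphisms $[\![t]\!]_{\vec x}$ out of $\mathfrak{s}(\vec x)$ (variables as projections, application as composition), formulas as predicates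 on $\mathfrak{s}(\vec x)$: $[\![\varphi(t_1,\dots,t_n)]\!]_{\vec x}=\langle[\![t_1]\!]_{\vec x},\dots,[\![t_n]\!]_{\vec x}\rangle^*\varphi$; $[\![t=u]\!]_{\vec x}=\langle[\![t]\!]_{\vec x},[\![u]\!]_{\vec x}\rangle^*(\exists_\delta\top)$ with $\delta$ the diagonal; $\wedge,\top$ are interpreted fiberwise; $[\![\exists y.\,P]\!]_{\vec x}=\exists_\pi[\![P]\!]_{\vec x,y}$ with $\pi$ the projection forgetting $y$. A judgment $P_1,\dots,P_n\vdash_{\vec x}Q$ holds if $[\![P_1]\!]_{\vec x}\wedge\dots\wedge[\![P_n]\!]_{\vec x}\le[\![Q]\!]_{\vec x}$. Writing $\varphi(\vec x)\equiv P$ defines $\varphi:=[\![P]\!]_{\vec x}$. **The category $\mathbb{C}\langle\mathcal{P}\rangle$.** Objects are pairs $(A,\rho)$ with $A\in\mathbb{C}$ and $\rho\in\mathcal{P}(A\times A)$ a partial equivalence relation, i.e. $\rho(x,y)\vdash_{x,y}\rho(y,x)$ and $\rho(x,y),\rho(y,z)\vdash_{x,y,z}\rho(x,z)$ hold. Morphisms $(A,\rho)\to(B,\sigma)$ are maps $f:A\to B$ in $\mathbb{C}$ such that $\rho(x,y)\vdash_{x,y}\sigma(fx,fy)$ holds; composition and identities are those of $\mathbb{C}$. We abbreviate $\rho(x,x)$ by $\rho x$ or $\rho(x)$. A morphism $f:(A,\rho)\to(B,\sigma)$ is a weak equivalence if $\rho x,\sigma(fx,fy),\rho y\vdash_{x,y}\rho(x,y)$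 and $\sigma u\vdash_u\exists x.\,\rho x\wedge\sigma(fx,u)$ hold. **The category $\mathbb{C}[\mathcal{P}]$.** It has the same objects as $\mathbb{C}\langle\mathcal{P}\rangle$; morphisms $(A,\rho)\to(B,\sigma)$ are predicates $\phi\in\mathcal{P}(A\times B)$ satisfying $\phi(x,u)\vdash_{x,u}\rho x\wedge\sigma u$; $\ \rho(y,x),\phi(x,u),\sigma(u,v)\vdash_{x,y,u,v}\phi(y,v)$; $\ \phi(x,u),\phi(x,v)\vdash_{x,u,v}\sigma(u,v)$; $\ \rho x\vdash_x\exists u.\,\phi(x,u)$. Composition of $\phi:(A,\rho)\to(B,\sigma)$ and $\gamma:(B,\sigma)\to(C,\tau)$ is $(\gamma\circ\phi)(x,r)\equiv\exists u.\,\phi(x,u)\wedge\gamma(u,r)$; the identity on $(A,\rho)$ is $\rho$. *)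

theory Defs
  imports "HOL-Algebra.Galois_Connection"
begin

section \<open>Categories and functors\<close>

text \<open>The operations are total HOL functions; they are meaningful only on the carriers
  \<open>Ob\<close> and \<open>Ar\<close>, and composition only on composable pairs. \<open>g \<cdot> f\<close> means ``first \<open>f\<close>, then \<open>g\<close>''.\<close>

record ('o, 'm) cat =
  Ob :: "'o set"
  Ar :: "'m set"
  Dom :: "'m \<Rightarrow> 'o"
  Cod :: "'m \<Rightarrow> 'o"
  Ident :: "'o \<Rightarrow> 'm"
  Cmp :: "'m \<Rightarrow> 'm \<Rightarrow> 'm" (infixl \<open>\<cdot>\<index>\<close> 70)

definition Hom :: "('o, 'm, 'z) cat_scheme \<Rightarrow> 'o \<Rightarrow> 'o \<Rightarrow> 'm set" where
  "Hom C A B = {f \<in> Ar C. Dom C f = A \<and> Cod C f = B}"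

locale category =
  fixes C :: "('o, 'm, 'z) cat_scheme"
  assumes Dom_in: "f \<in> Ar C \<Longrightarrow> Dom C f \<in> Ob C"
    and Cod_in: "f \<in> Ar C \<Longrightarrow> Cod C f \<in> Ob C"
    and Ident_in: "A \<in> Ob C \<Longrightarrow> Ident C A \<in> Hom C A A"
    and Cmp_in: "f \<in> Hom C A B \<Longrightarrow> g \<in> Hom C B D \<Longrightarrow> g \<cdot>\<^bsub>C\<^esub> f \<in> Hom C A D"
    and Ident_left: "f \<in> Hom C A B \<Longrightarrow> Ident C B \<cdot>\<^bsub>C\<^esub> f = f"
    and Ident_right: "f \<in> Hom C A B \<Longrightarrow> f \<cdot>\<^bsub>C\<^esub> Ident C A = f"
    and Cmp_assoc: "f \<in> Hom C A B \<Longrightarrow> g \<in> Hom C B D \<Longrightarrow> h \<in> Hom C D E \<Longrightarrow>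
      h \<cdot>\<^bsub>C\<^esub> (g \<cdot>\<^bsub>C\<^esub> f) = (h \<cdot>\<^bsub>C\<^esub> g) \<cdot>\<^bsub>C\<^esub> f"

definition is_iso :: "('o, 'm, 'z) cat_scheme \<Rightarrow> 'm \<Rightarrow> bool" where
  "is_iso C f \<longleftrightarrow> f \<in> Ar C \<and>
    (\<exists>g \<in> Hom C (Cod C f) (Dom C f).
      g \<cdot>\<^bsub>C\<^esub> f = Ident C (Dom C f) \<and> f \<cdot>\<^bsub>C\<^esub> g = Ident C (Cod C f))"

record ('o, 'm, 'o2, 'm2) ftor =
  FOb :: "'o \<Rightarrow> 'o2"
  FAr :: "'m \<Rightarrow> 'm2"

text \<open>The two components of a functor are extensional functions (\<open>undefined\<close> outside the carriers),
  so that equality of functors is equality in HOL.\<close>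

locale category_functor = source: category C + target: category D
  for C :: "('o, 'm, 'z) cat_scheme" and D :: "('o2, 'm2, 'z2) cat_scheme" +
  fixes F :: "('o, 'm, 'o2, 'm2) ftor"
  assumes FOb_in: "FOb F \<in> Ob C \<rightarrow>\<^sub>E Ob D"
    and FAr_in: "FAr F \<in> Ar C \<rightarrow>\<^sub>E Ar D"
    and FAr_Hom: "f \<in> Hom C A B \<Longrightarrow> FAr F f \<in> Hom D (FOb F A) (FOb F B)"
    and FAr_Ident: "A \<in> Ob C \<Longrightarrow> FAr F (Ident C A) = Ident D (FOb F A)"
    and FAr_Cmp: "f \<in> Hom C A B \<Longrightarrow> g \<in> Hom C B B' \<Longrightarrow>
      FAr F (g \<cdot>\<^bsub>C\<^esub> f) = FAr F g \<cdot>\<^bsub>D\<^esub> FAr F f"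

definition ftor_comp ::
  "('o, 'm, 'z) cat_scheme \<Rightarrow> ('o2, 'm2, 'o3, 'm3) ftor \<Rightarrow> ('o, 'm, 'o2, 'm2) ftor \<Rightarrow>
    ('o, 'm, 'o3, 'm3) ftor" where
  "ftor_comp C G F =
    \<lparr>FOb = compose (Ob C) (FOb G) (FOb F), FAr = compose (Ar C) (FAr G) (FAr F)\<rparr>"


section \<open>Finite limits\<close>

text \<open>A finite diagram has a finite set \<open>V\<close> of vertices, an object \<open>X i\<close> for each vertex \<open>i\<close>, and a
  finite set \<open>E\<close> of edges \<open>(i, j, f)\<close> with \<open>f : X i \<rightarrow> X j\<close>.\<close>

definition is_diagram ::
  "('o, 'm, 'z) cat_scheme \<Rightarrow> nat set \<Rightarrow> (nat \<Rightarrow> 'o) \<Rightarrow> (nat \<times> nat \<times> 'm) set \<Rightarrow> bool" where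
  "is_diagram C V X E \<longleftrightarrow> finite V \<and> finite E \<and> (\<forall>i\<in>V. X i \<in> Ob C) \<and>
    (\<forall>(i, j, f) \<in> E. i \<in> V \<and> j \<in> V \<and> f \<in> Hom C (X i) (X j))"

definition is_cone ::
  "('o, 'm, 'z) cat_scheme \<Rightarrow> nat set \<Rightarrow> (nat \<Rightarrow> 'o) \<Rightarrow> (nat \<times> nat \<times> 'm) set \<Rightarrow>
    'o \<Rightarrow> (nat \<Rightarrow> 'm) \<Rightarrow> bool" where
  "is_cone C V X E L p \<longleftrightarrow> L \<in> Ob C \<and> (\<forall>i\<in>V. p i \<in> Hom C L (X i)) \<and>
    (\<forall>(i, j, f) \<in> E. f \<cdot>\<^bsub>C\<^esub> p i = p j)"

definition is_limit ::
  "('o, 'm, 'z) cat_scheme \<Rightarrow> nat set \<Rightarrow> (nat \<Rightarrow> 'o) \<Rightarrow> (nat \<times> nat \<times> 'm) set \<Rightarrow>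
    'o \<Rightarrow> (nat \<Rightarrow> 'm) \<Rightarrow> bool" where
  "is_limit C V X E L p \<longleftrightarrow> is_cone C V X E L p \<and>
    (\<forall>K q. is_cone C V X E K q \<longrightarrow> (\<exists>!h. h \<in> Hom C K L \<and> (\<forall>i\<in>V. p i \<cdot>\<^bsub>C\<^esub> h = q i)))"

definition is_pullback :: "('o, 'm, 'z) cat_scheme \<Rightarrow> 'm \<Rightarrow> 'm \<Rightarrow> 'm \<Rightarrow> 'm \<Rightarrow> bool" where
  "is_pullback C f g h k \<longleftrightarrow>
    f \<in> Ar C \<and> g \<in> Ar C \<and> h \<in> Ar C \<and> k \<in> Ar C \<and>
    Cod C f = Cod C g \<and> Dom C h = Dom C k \<and> Cod C h = Dom C f \<and> Cod C k = Dom C g \<and>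
    f \<cdot>\<^bsub>C\<^esub> h = g \<cdot>\<^bsub>C\<^esub> k \<and>
    (\<forall>K. \<forall>a \<in> Hom C K (Dom C f). \<forall>b \<in> Hom C K (Dom C g). f \<cdot>\<^bsub>C\<^esub> a = g \<cdot>\<^bsub>C\<^esub> b \<longrightarrow>
      (\<exists>!l. l \<in> Hom C K (Dom C h) \<and> h \<cdot>\<^bsub>C\<^esub> l = a \<and> k \<cdot>\<^bsub>C\<^esub> l = b))"

text \<open>The internal language refers to particular products \<open>A\<^sub>1 \<times> \<dots> \<times> A\<^sub>n\<close>. The record therefore carries an
  arbitrary choice of finite products, subject only to the convention that the product of a
  one-element list \<open>[A]\<close> is \<open>A\<close> itself.\<close>

record ('o, 'm) fl_cat = "('o, 'm) cat" +
  Prod :: "'o list \<Rightarrow> 'o"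
  Proj :: "'o list \<Rightarrow> nat \<Rightarrow> 'm"

locale finite_limit_category = category C
  for C :: "('o, 'm, 'z) fl_cat_scheme" +
  assumes finite_limits: "is_diagram C V X E \<Longrightarrow> \<exists>L p. is_limit C V X E L p"
    and Prod_limit: "set As \<subseteq> Ob C \<Longrightarrow>
      is_limit C {..<length As} (\<lambda>i. As ! i) {} (Prod C As) (Proj C As)"
    and Prod_single: "A \<in> Ob C \<Longrightarrow> Prod C [A] = A"
    and Proj_single: "A \<in> Ob C \<Longrightarrow> Proj C [A] 0 = Ident C A"

text \<open>\<open>tuple C K [f\<^sub>1, \<dots>, f\<^sub>n]\<close> is \<open>\<langle>f\<^sub>1, \<dots>, f\<^sub>n\<rangle> : K \<rightarrow> A\<^sub>1 \<times> \<dots> \<times> A\<^sub>n\<close>, where \<open>f\<^sub>i : K \<rightarrow> A\<^sub>i\<close>.\<close>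

definition tuple :: "('o, 'm, 'z) fl_cat_scheme \<Rightarrow> 'o \<Rightarrow> 'm list \<Rightarrow> 'm" where
  "tuple C K fs = (THE h. h \<in> Hom C K (Prod C (map (Cod C) fs)) \<and>
    (\<forall>i<length fs. Proj C (map (Cod C) fs) i \<cdot>\<^bsub>C\<^esub> h = fs ! i))"


section \<open>Indexed frames\<close>

text \<open>\<open>Fib P I\<close> is the poset of predicates on \<open>I\<close>, and \<open>Sub P f\<close> is reindexing \<open>f\<^sup>*\<close> along \<open>f\<close>.\<close>

record ('o, 'm, 'p) indexed =
  Fib :: "'o \<Rightarrow> 'p gorder"
  Sub :: "'m \<Rightarrow> 'p \<Rightarrow> 'p"

abbreviation Preds :: "('o, 'm, 'p) indexed \<Rightarrow> 'o \<Rightarrow> 'p set" where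
  "Preds P I \<equiv> carrier (Fib P I)"

locale indexed_poset = category C
  for C :: "('o, 'm, 'z) cat_scheme" +
  fixes P :: "('o, 'm, 'p) indexed"
  assumes Fib_poset: "I \<in> Ob C \<Longrightarrow> partial_order (Fib P I)"
    and Sub_in: "f \<in> Hom C J I \<Longrightarrow> Sub P f \<in> Preds P I \<rightarrow> Preds P J"
    and Sub_mono: "f \<in> Hom C J I \<Longrightarrow> isotone (Fib P I) (Fib P J) (Sub P f)"
    and Sub_Ident: "I \<in> Ob C \<Longrightarrow> \<phi> \<in> Preds P I \<Longrightarrow> Sub P (Ident C I) \<phi> = \<phi>"
    and Sub_Cmp: "g \<in> Hom C K J \<Longrightarrow> f \<in> Hom C J I \<Longrightarrow> \<phi> \<in> Preds P I \<Longrightarrow>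
      Sub P (f \<cdot>\<^bsub>C\<^esub> g) \<phi> = Sub P g (Sub P f \<phi>)"

locale indexed_meet_semilattice = indexed_poset C P
  for C :: "('o, 'm, 'z) cat_scheme" and P :: "('o, 'm, 'p) indexed" +
  assumes Fib_meets: "I \<in> Ob C \<Longrightarrow> lower_semilattice (Fib P I)"
    and Fib_top: "I \<in> Ob C \<Longrightarrow> weak_partial_order_top (Fib P I)"
    and Sub_meet: "f \<in> Hom C J I \<Longrightarrow> \<phi> \<in> Preds P I \<Longrightarrow> \<psi> \<in> Preds P I \<Longrightarrow>
      Sub P f (\<phi> \<sqinter>\<^bsub>Fib P I\<^esub> \<psi>) = Sub P f \<phi> \<sqinter>\<^bsub>Fib P J\<^esub> Sub P f \<psi>"
    and Sub_top: "f \<in> Hom C J I \<Longrightarrow> Sub P f \<top>\<^bsub>Fib P I\<^esub> = \<top>\<^bsub>Fib P J\<^esub>"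

definition left_adjoint_to_Sub ::
  "('o, 'm, 'z) cat_scheme \<Rightarrow> ('o, 'm, 'p) indexed \<Rightarrow> 'm \<Rightarrow> ('p \<Rightarrow> 'p) \<Rightarrow> bool" where
  "left_adjoint_to_Sub C P f L \<longleftrightarrow> galois_connection
    \<lparr>orderA = Fib P (Dom C f), orderB = Fib P (Cod C f), lower = L, upper = Sub P f\<rparr>"

text \<open>A left adjoint, if there is one, is determined on \<open>Preds P (Dom C f)\<close>.\<close>

definition Img :: "('o, 'm, 'z) cat_scheme \<Rightarrow> ('o, 'm, 'p) indexed \<Rightarrow> 'm \<Rightarrow> 'p \<Rightarrow> 'p" where
  "Img C P f = (SOME L. left_adjoint_to_Sub C P f L)"

locale indexed_frame =
  finite_limit_category C + indexed_meet_semilattice C P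
  for C :: "('o, 'm, 'z) fl_cat_scheme" and P :: "('o, 'm, 'p) indexed" +
  assumes Ex: "f \<in> Ar C \<Longrightarrow> \<exists>L. left_adjoint_to_Sub C P f L"
    and Fr: "f \<in> Hom C J I \<Longrightarrow> \<phi> \<in> Preds P J \<Longrightarrow> \<psi> \<in> Preds P I \<Longrightarrow>
      Img C P f \<phi> \<sqinter>\<^bsub>Fib P I\<^esub> \<psi> = Img C P f (\<phi> \<sqinter>\<^bsub>Fib P J\<^esub> Sub P f \<psi>)"
    and BC: "is_pullback C f g h k \<Longrightarrow> \<phi> \<in> Preds P (Dom C g) \<Longrightarrow>
      Img C P h (Sub P k \<phi>) = Sub P f (Img C P g \<phi>)"


section \<open>Internal language\<close>

text \<open>A context is the list of the sorts of its variables, and \<open>Var i\<close> is the variable at position \<open>i\<close>,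
  counted from 0. An existential quantifier appends its variable to the context, so in context \<open>\<Gamma>\<close>
  the variable bound by \<open>Exi A Q\<close> (of sort \<open>A\<close>) is \<open>Var (length \<Gamma>)\<close> in \<open>Q\<close>. In \<open>App f ts\<close> the
  function symbol is an arrow \<open>f\<close> out of the product of the sorts of \<open>ts\<close>, and in \<open>Rel \<phi> ts\<close> the
  relation symbol is a predicate \<open>\<phi>\<close> on that product.\<close>

datatype 'm trm = Var nat | App 'm "'m trm list"

datatype ('o, 'm, 'p) fm =
    Rel 'p "'m trm list"
  | Eql "'m trm" "'m trm"
  | Tru
  | Conj "('o, 'm, 'p) fm" "('o, 'm, 'p) fm" (infixr \<open>AND\<close> 35)
  | Exi 'o "('o, 'm, 'p) fm"

fun trm_interp :: "('o, 'm, 'z) fl_cat_scheme \<Rightarrow> 'o list \<Rightarrow> 'm trm \<Rightarrow> 'm" where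
  "trm_interp C \<Gamma> (Var i) = Proj C \<Gamma> i"
| "trm_interp C \<Gamma> (App f ts) = f \<cdot>\<^bsub>C\<^esub> tuple C (Prod C \<Gamma>) (map (trm_interp C \<Gamma>) ts)"

definition diagonal :: "('o, 'm, 'z) fl_cat_scheme \<Rightarrow> 'o \<Rightarrow> 'm" where
  "diagonal C A = tuple C A [Ident C A, Ident C A]"

definition forget_last :: "('o, 'm, 'z) fl_cat_scheme \<Rightarrow> 'o list \<Rightarrow> 'o \<Rightarrow> 'm" where
  "forget_last C \<Gamma> A = tuple C (Prod C (\<Gamma> @ [A])) (map (Proj C (\<Gamma> @ [A])) [0..<length \<Gamma>])"

fun fm_interp ::
  "('o, 'm, 'z) fl_cat_scheme \<Rightarrow> ('o, 'm, 'p) indexed \<Rightarrow> 'o list \<Rightarrow> ('o, 'm, 'p) fm \<Rightarrow> 'p" where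
  "fm_interp C P \<Gamma> (Rel \<phi> ts) = Sub P (tuple C (Prod C \<Gamma>) (map (trm_interp C \<Gamma>) ts)) \<phi>"
| "fm_interp C P \<Gamma> (Eql t u) =
    (let A = Cod C (trm_interp C \<Gamma> t) in
      Sub P (tuple C (Prod C \<Gamma>) [trm_interp C \<Gamma> t, trm_interp C \<Gamma> u])
        (Img C P (diagonal C A) \<top>\<^bsub>Fib P A\<^esub>))"
| "fm_interp C P \<Gamma> Tru = \<top>\<^bsub>Fib P (Prod C \<Gamma>)\<^esub>"
| "fm_interp C P \<Gamma> (Q AND R) = fm_interp C P \<Gamma> Q \<sqinter>\<^bsub>Fib P (Prod C \<Gamma>)\<^esub> fm_interp C P \<Gamma> R"
| "fm_interp C P \<Gamma> (Exi A Q) = Img C P (forget_last C \<Gamma> A) (fm_interp C P (\<Gamma> @ [A]) Q)"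

definition holds ::
  "('o, 'm, 'z) fl_cat_scheme \<Rightarrow> ('o, 'm, 'p) indexed \<Rightarrow> 'o list \<Rightarrow>
    ('o, 'm, 'p) fm list \<Rightarrow> ('o, 'm, 'p) fm \<Rightarrow> bool" where
  "holds C P \<Gamma> Qs R \<longleftrightarrow>
    foldr (\<lambda>Q \<chi>. fm_interp C P \<Gamma> Q \<sqinter>\<^bsub>Fib P (Prod C \<Gamma>)\<^esub> \<chi>) Qs \<top>\<^bsub>Fib P (Prod C \<Gamma>)\<^esub>
      \<sqsubseteq>\<^bsub>Fib P (Prod C \<Gamma>)\<^esub> fm_interp C P \<Gamma> R"

text \<open>The abbreviation \<open>\<rho>(t)\<close> for \<open>\<rho>(t, t)\<close>.\<close>

abbreviation Dia :: "'p \<Rightarrow> 'm trm \<Rightarrow> ('o, 'm, 'p) fm" where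
  "Dia \<rho> t \<equiv> Rel \<rho> [t, t]"


section \<open>The category of partial equivalence relations and tracked maps\<close>

definition is_per ::
  "('o, 'm, 'z) fl_cat_scheme \<Rightarrow> ('o, 'm, 'p) indexed \<Rightarrow> 'o \<times> 'p \<Rightarrow> bool" where
  "is_per C P = (\<lambda>(A, \<rho>). A \<in> Ob C \<and> \<rho> \<in> Preds P (Prod C [A, A]) \<and>
    (let x = Var 0; y = Var 1; z = Var 2 in
      holds C P [A, A] [Rel \<rho> [x, y]] (Rel \<rho> [y, x]) \<and>
      holds C P [A, A, A] [Rel \<rho> [x, y], Rel \<rho> [y, z]] (Rel \<rho> [x, z])))"

definition is_tracked_map ::
  "('o, 'm, 'z) fl_cat_scheme \<Rightarrow> ('o, 'm, 'p) indexed \<Rightarrow> 'o \<times> 'p \<Rightarrow> 'o \<times> 'p \<Rightarrow> 'm \<Rightarrow> bool" where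
  "is_tracked_map C P = (\<lambda>(A, \<rho>) (B, \<sigma>) f. f \<in> Hom C A B \<and>
    (let x = Var 0; y = Var 1 in
      holds C P [A, A] [Rel \<rho> [x, y]] (Rel \<sigma> [App f [x], App f [y]])))"

text \<open>In both categories below an arrow is a triple consisting of its domain, its codomain, and the
  underlying map or predicate.\<close>

type_synonym ('o, 'p, 'a) per_arrow = "('o \<times> 'p) \<times> ('o \<times> 'p) \<times> 'a"

definition per_cat ::
  "('o, 'm, 'z) fl_cat_scheme \<Rightarrow> ('o, 'm, 'p) indexed \<Rightarrow>
    ('o \<times> 'p, ('o, 'p, 'm) per_arrow) cat" (\<open>_\<langle>_\<rangle>\<close> [1000, 0] 1000) where
  "C\<langle>P\<rangle> =
    \<lparr>Ob = {X. is_per C P X},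
     Ar = {(X, Y, f). is_per C P X \<and> is_per C P Y \<and> is_tracked_map C P X Y f},
     Dom = (\<lambda>(X, Y, f). X),
     Cod = (\<lambda>(X, Y, f). Y),
     Ident = (\<lambda>X. (X, X, Ident C (fst X))),
     Cmp = (\<lambda>(Y', Z, g) (X, Y, f). (X, Z, g \<cdot>\<^bsub>C\<^esub> f))\<rparr>"

definition is_weak_equivalence ::
  "('o, 'm, 'z) fl_cat_scheme \<Rightarrow> ('o, 'm, 'p) indexed \<Rightarrow> ('o, 'p, 'm) per_arrow \<Rightarrow> bool" where
  "is_weak_equivalence C P = (\<lambda>((A, \<rho>), (B, \<sigma>), f).
    ((A, \<rho>), (B, \<sigma>), f) \<in> Ar C\<langle>P\<rangle> \<and>
    (let x = Var 0; y = Var 1 in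
      holds C P [A, A] [Dia \<rho> x, Rel \<sigma> [App f [x], App f [y]], Dia \<rho> y] (Rel \<rho> [x, y])) \<and>
    (let u = Var 0; x = Var 1 in
      holds C P [B] [Dia \<sigma> u] (Exi A (Dia \<rho> x AND Rel \<sigma> [App f [x], u]))))"


section \<open>The category of partial equivalence relations and functional relations\<close>

definition is_functional_relation ::
  "('o, 'm, 'z) fl_cat_scheme \<Rightarrow> ('o, 'm, 'p) indexed \<Rightarrow> 'o \<times> 'p \<Rightarrow> 'o \<times> 'p \<Rightarrow> 'p \<Rightarrow> bool" where
  "is_functional_relation C P = (\<lambda>(A, \<rho>) (B, \<sigma>) \<phi>. \<phi> \<in> Preds P (Prod C [A, B]) \<and>
    (let x = Var 0; u = Var 1 in
      holds C P [A, B] [Rel \<phi> [x, u]] (Dia \<rho> x AND Dia \<sigma> u)) \<and>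
    (let x = Var 0; y = Var 1; u = Var 2; v = Var 3 in
      holds C P [A, A, B, B] [Rel \<rho> [y, x], Rel \<phi> [x, u], Rel \<sigma> [u, v]] (Rel \<phi> [y, v])) \<and>
    (let x = Var 0; u = Var 1; v = Var 2 in
      holds C P [A, B, B] [Rel \<phi> [x, u], Rel \<phi> [x, v]] (Rel \<sigma> [u, v])) \<and>
    (let x = Var 0; u = Var 1 in
      holds C P [A] [Dia \<rho> x] (Exi B (Rel \<phi> [x, u]))))"

definition rel_comp ::
  "('o, 'm, 'z) fl_cat_scheme \<Rightarrow> ('o, 'm, 'p) indexed \<Rightarrow> 'o \<Rightarrow> 'o \<Rightarrow> 'o \<Rightarrow> 'p \<Rightarrow> 'p \<Rightarrow> 'p" where
  "rel_comp C P A B D \<gamma> \<phi> =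
    (let x = Var 0; r = Var 1; u = Var 2 in
      fm_interp C P [A, D] (Exi B (Rel \<phi> [x, u] AND Rel \<gamma> [u, r])))"

definition rel_cat ::
  "('o, 'm, 'z) fl_cat_scheme \<Rightarrow> ('o, 'm, 'p) indexed \<Rightarrow>
    ('o \<times> 'p, ('o, 'p, 'p) per_arrow) cat" (\<open>_\<lblot>_\<rblot>\<close> [1000, 0] 1000) where
  "C\<lblot>P\<rblot> =
    \<lparr>Ob = {X. is_per C P X},
     Ar = {(X, Y, \<phi>). is_per C P X \<and> is_per C P Y \<and> is_functional_relation C P X Y \<phi>},
     Dom = (\<lambda>(X, Y, \<phi>). X),
     Cod = (\<lambda>(X, Y, \<phi>). Y),
     Ident = (\<lambda>X. (X, X, snd X)),
     Cmp = (\<lambda>(Y', Z, \<gamma>) (X, Y, \<phi>). (X, Z, rel_comp C P (fst X) (fst Y) (fst Z) \<gamma> \<phi>))\<rparr>"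

definition graph ::
  "('o, 'm, 'z) fl_cat_scheme \<Rightarrow> ('o, 'm, 'p) indexed \<Rightarrow> 'o \<times> 'p \<Rightarrow> 'o \<times> 'p \<Rightarrow> 'm \<Rightarrow> 'p" where
  "graph C P = (\<lambda>(A, \<rho>) (B, \<sigma>) f.
    (let x = Var 0; u = Var 1 in
      fm_interp C P [A, B] (Dia \<rho> x AND Rel \<sigma> [App f [x], u])))"

definition E_functor ::
  "('o, 'm, 'z) fl_cat_scheme \<Rightarrow> ('o, 'm, 'p) indexed \<Rightarrow>
    ('o \<times> 'p, ('o, 'p, 'm) per_arrow, 'o \<times> 'p, ('o, 'p, 'p) per_arrow) ftor" where
  "E_functor C P =
    \<lparr>FOb = (\<lambda>X \<in> Ob C\<langle>P\<rangle>. X),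
     FAr = (\<lambda>(X, Y, f) \<in> Ar C\<langle>P\<rangle>. (X, Y, graph C P X Y f))\<rparr>"

end

theory Submission
  imports Defs
begin

text \<open>
  The judgments of the internal language are verified by forcing. A world is an object \<open>K\<close> together
  with a predicate \<open>\<chi>\<close> on it, and a world forces \<open>\<phi>\<close> at a generalized element \<open>h : K \<rightarrow> I\<close> if
  \<open>\<chi> \<le> h\<^sup>*\<phi>\<close>. Forcing is stable under restriction and local for the covers
  \<open>e : (K', \<chi>') \<rightarrow> (K, \<chi>)\<close>, those with \<open>\<chi>' \<le> e\<^sup>*\<chi>\<close> and \<open>\<chi> \<le> \<exists>\<^sub>e\<chi>'\<close>. By (BC) and (Fr), an existential is forced
  exactly when a witness exists on a cover (\<open>forces_Img\<close>). Testing on the generic element turns a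
  judgment into a statement about all worlds (\<open>holds_iff\<close>). The defining conditions of partial
  equivalence relations, tracked maps, weak equivalences and functional relations thus become
  first-order conditions, and one argues as with sets, except that an existential has to be
  eliminated by passing to a cover and returning by locality.

  Once \<open>C\<langle>P\<rangle>\<close> and \<open>C\<lblot>P\<rblot>\<close> are known to be categories and \<open>E\<close> a functor, part (i) is the usual argument.
  If \<open>f\<close> is a weak equivalence, then the converse of its graph is single-valued because \<open>f\<close> reflects
  the relation, and total because \<open>f\<close> is essentially surjective, so it is an inverse of \<open>E f\<close>.
  Conversely, an inverse of \<open>E f\<close> gives back both properties.

  For part (ii), call a span of tracked maps \<open>p : H \<rightarrow> X\<close>, \<open>q : H \<rightarrow> Y\<close> a span for a functional relation
  \<open>\<phi> : X \<rightarrow> Y\<close> if \<open>\<phi>(p h, q h)\<close> holds for all \<open>h\<close> in the domain of \<open>H\<close>. Then \<open>\<phi> \<circ> E p = E q\<close>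
  (\<open>span_comp_graph\<close>), so an extension of \<open>F\<close> must send \<open>\<phi>\<close> to a morphism \<open>m\<close> with \<open>m \<circ> F p = F q\<close> for
  every such span. There is exactly one \<open>m\<close> with this property (\<open>ex1_extends_spans\<close>): the graph of \<open>\<phi>\<close>,
  as a partial equivalence relation on the product, carries a span through which every other one
  factors strictly, and its left leg is a weak equivalence, hence inverted by \<open>F\<close>
  (\<open>ex_graph_span\<close>). This yields uniqueness at once, and it defines the extension. Functoriality
  follows by exhibiting one span for each equation: \<open>(id, f)\<close> for \<open>E f\<close>, which also covers
  identities, and for a composite \<open>\<gamma> \<circ> \<phi>\<close> the span obtained by taking the graph of \<open>\<gamma> \<circ> E q\<close> over the
  graph of \<open>\<phi>\<close> (\<open>span_comp\<close>).
\<close>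

section \<open>Fibres and finite limits\<close>

lemma HomD:
  assumes "f \<in> Hom C A B"
  shows "f \<in> Ar C" "Dom C f = A" "Cod C f = B"
  using assms by (auto simp: Hom_def)

lemma (in category) Hom_Ob:
  assumes "f \<in> Hom C A B"
  shows "A \<in> Ob C" "B \<in> Ob C"
  using assms Dom_in Cod_in by (auto simp: Hom_def)

context indexed_frame
begin

lemma le_refl: "I \<in> Ob C \<Longrightarrow> \<phi> \<in> Preds P I \<Longrightarrow> \<phi> \<sqsubseteq>\<^bsub>Fib P I\<^esub> \<phi>"
  by (rule weak_partial_order.le_refl[OF partial_order.axioms(1)[OF Fib_poset]])

lemma le_trans:
  assumes "\<phi> \<sqsubseteq>\<^bsub>Fib P I\<^esub> \<psi>" "\<psi> \<sqsubseteq>\<^bsub>Fib P I\<^esub> \<chi>"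
    and "I \<in> Ob C" "\<phi> \<in> Preds P I" "\<psi> \<in> Preds P I" "\<chi> \<in> Preds P I"
  shows "\<phi> \<sqsubseteq>\<^bsub>Fib P I\<^esub> \<chi>"
  by (rule weak_partial_order.le_trans[OF partial_order.axioms(1)[OF Fib_poset] assms(1,2)]) fact+

lemma le_antisym:
  assumes "\<phi> \<sqsubseteq>\<^bsub>Fib P I\<^esub> \<psi>" "\<psi> \<sqsubseteq>\<^bsub>Fib P I\<^esub> \<phi>"
    and "I \<in> Ob C" "\<phi> \<in> Preds P I" "\<psi> \<in> Preds P I"
  shows "\<phi> = \<psi>"
  by (rule partial_order.le_antisym[OF Fib_poset assms(1,2)]) fact+

lemma meet_in:
  assumes "I \<in> Ob C" "\<phi> \<in> Preds P I" "\<psi> \<in> Preds P I"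
  shows "\<phi> \<sqinter>\<^bsub>Fib P I\<^esub> \<psi> \<in> Preds P I"
proof -
  interpret lower_semilattice "Fib P I" using Fib_meets assms(1) .
  show ?thesis using assms(2,3) by simp
qed

lemma le_meet_iff:
  assumes "I \<in> Ob C" "\<phi> \<in> Preds P I" "\<psi> \<in> Preds P I" "\<chi> \<in> Preds P I"
  shows "\<chi> \<sqsubseteq>\<^bsub>Fib P I\<^esub> \<phi> \<sqinter>\<^bsub>Fib P I\<^esub> \<psi> \<longleftrightarrow> \<chi> \<sqsubseteq>\<^bsub>Fib P I\<^esub> \<phi> \<and> \<chi> \<sqsubseteq>\<^bsub>Fib P I\<^esub> \<psi>"
proof -
  interpret L: lower_semilattice "Fib P I" using Fib_meets assms(1) .
  note closed = L.meet_closed[OF assms(2,3)]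
  show ?thesis
    using L.le_trans[OF _ L.meet_left[OF assms(2,3)] assms(4) closed assms(2)]
      L.le_trans[OF _ L.meet_right[OF assms(2,3)] assms(4) closed assms(3)]
      L.meet_le[of \<chi> \<phi> \<psi>] assms(2-4) by blast
qed

lemma top_in: "I \<in> Ob C \<Longrightarrow> \<top>\<^bsub>Fib P I\<^esub> \<in> Preds P I"
  by (rule weak_partial_order_top.top_closed[OF Fib_top])

lemma le_top: "I \<in> Ob C \<Longrightarrow> \<phi> \<in> Preds P I \<Longrightarrow> \<phi> \<sqsubseteq>\<^bsub>Fib P I\<^esub> \<top>\<^bsub>Fib P I\<^esub>"
  by (rule weak_partial_order_top.top_higher[OF Fib_top])

lemma Sub_pred: "f \<in> Hom C J I \<Longrightarrow> \<phi> \<in> Preds P I \<Longrightarrow> Sub P f \<phi> \<in> Preds P J"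
  by (rule funcset_mem[OF Sub_in])

lemma Sub_le:
  assumes "f \<in> Hom C J I" "\<phi> \<in> Preds P I" "\<psi> \<in> Preds P I" "\<phi> \<sqsubseteq>\<^bsub>Fib P I\<^esub> \<psi>"
  shows "Sub P f \<phi> \<sqsubseteq>\<^bsub>Fib P J\<^esub> Sub P f \<psi>"
  by (rule use_iso2[OF Sub_mono[OF assms(1)] assms(2-4)])

lemma Img_adjoint:
  assumes "f \<in> Hom C J I"
  shows "galois_connection \<lparr>orderA = Fib P J, orderB = Fib P I, lower = Img C P f, upper = Sub P f\<rparr>"
proof -
  have "left_adjoint_to_Sub C P f (Img C P f)"
    unfolding Img_def by (rule someI_ex[OF Ex[OF HomD(1)[OF assms]]])
  then show ?thesis
    unfolding left_adjoint_to_Sub_def using HomD[OF assms] by simp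
qed

lemma Img_pred: "f \<in> Hom C J I \<Longrightarrow> \<phi> \<in> Preds P J \<Longrightarrow> Img C P f \<phi> \<in> Preds P I"
  using connection.lower_closed[OF galois_connection.axioms(1)[OF Img_adjoint]] by simp

lemma Img_le_iff:
  assumes "f \<in> Hom C J I" "\<phi> \<in> Preds P J" "\<psi> \<in> Preds P I"
  shows "Img C P f \<phi> \<sqsubseteq>\<^bsub>Fib P I\<^esub> \<psi> \<longleftrightarrow> \<phi> \<sqsubseteq>\<^bsub>Fib P J\<^esub> Sub P f \<psi>"
  using galois_connection.galois_property[OF Img_adjoint[OF assms(1)]] assms(2,3) by simp

text \<open>A pullback is the limit of a cospan, encoded as a diagram with vertices 0, 1, 2; the third leg of a
  cone over it is determined by the other two.\<close>

lemma pullback_exists: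
  assumes f: "f \<in> Hom C A I" and g: "g \<in> Hom C B I"
  obtains h k D where "h \<in> Hom C D A" "k \<in> Hom C D B" "f \<cdot>\<^bsub>C\<^esub> h = g \<cdot>\<^bsub>C\<^esub> k" "is_pullback C f g h k"
proof -
  define V :: "nat set" where "V = {0, 1, 2}"
  define X where "X = (\<lambda>i::nat. if i = 0 then A else if i = 1 then B else I)"
  define E where "E = {(0::nat, 2::nat, f), (1, 2, g)}"
  have cone: "is_cone C V X E K q \<longleftrightarrow>
      K \<in> Ob C \<and> q 0 \<in> Hom C K A \<and> q 1 \<in> Hom C K B \<and> q 2 \<in> Hom C K I \<and>
      f \<cdot>\<^bsub>C\<^esub> q 0 = q 2 \<and> g \<cdot>\<^bsub>C\<^esub> q 1 = q 2" for K q
    by (auto simp: is_cone_def V_def X_def E_def)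
  have "is_diagram C V X E"
    using f g Hom_Ob[OF f] Hom_Ob[OF g] by (auto simp: is_diagram_def V_def X_def E_def)
  then obtain L p where lim: "is_limit C V X E L p"
    using finite_limits by blast
  then have cone_p: "is_cone C V X E L p"
    unfolding is_limit_def by blast
  note p = cone_p[unfolded cone]
  then have p0: "p 0 \<in> Hom C L A" and p1: "p 1 \<in> Hom C L B"
    and comm: "f \<cdot>\<^bsub>C\<^esub> p 0 = g \<cdot>\<^bsub>C\<^esub> p 1" by auto
  have univ: "\<exists>!l. l \<in> Hom C K L \<and> p 0 \<cdot>\<^bsub>C\<^esub> l = a \<and> p 1 \<cdot>\<^bsub>C\<^esub> l = b"
    if a: "a \<in> Hom C K A" and b: "b \<in> Hom C K B" and eq: "f \<cdot>\<^bsub>C\<^esub> a = g \<cdot>\<^bsub>C\<^esub> b" for K a b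
  proof -
    define q where "q = (\<lambda>i::nat. if i = 0 then a else if i = 1 then b else f \<cdot>\<^bsub>C\<^esub> a)"
    have "is_cone C V X E K q"
      unfolding cone using a b eq Hom_Ob[OF a] Cmp_in[OF a f] by (simp add: q_def)
    then have ex: "\<exists>!l. l \<in> Hom C K L \<and> (\<forall>i\<in>V. p i \<cdot>\<^bsub>C\<^esub> l = q i)"
      using lim unfolding is_limit_def by blast
    have "(l \<in> Hom C K L \<and> (\<forall>i\<in>V. p i \<cdot>\<^bsub>C\<^esub> l = q i)) \<longleftrightarrow>
        (l \<in> Hom C K L \<and> p 0 \<cdot>\<^bsub>C\<^esub> l = a \<and> p 1 \<cdot>\<^bsub>C\<^esub> l = b)" for l
    proof -
      have "p 2 \<cdot>\<^bsub>C\<^esub> l = f \<cdot>\<^bsub>C\<^esub> a" if l: "l \<in> Hom C K L" "p 0 \<cdot>\<^bsub>C\<^esub> l = a"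
        using Cmp_assoc[OF l(1), of "p 0" A f I] f p l(2) by simp
      then show ?thesis by (auto simp: V_def q_def)
    qed
    with ex show ?thesis by simp
  qed
  have "is_pullback C f g (p 0) (p 1)"
    unfolding is_pullback_def
    using HomD[OF f] HomD[OF g] HomD[OF p0] HomD[OF p1] comm univ by simp
  with p0 p1 comm show ?thesis by (rule that)
qed

lemma Prod_Ob: "set As \<subseteq> Ob C \<Longrightarrow> Prod C As \<in> Ob C"
  using Prod_limit unfolding is_limit_def is_cone_def by blast

lemma Proj_Hom: "set As \<subseteq> Ob C \<Longrightarrow> i < length As \<Longrightarrow> Proj C As i \<in> Hom C (Prod C As) (As ! i)"
  using Prod_limit unfolding is_limit_def is_cone_def by blast

lemma tuple_universal:
  assumes K: "K \<in> Ob C" and len: "length fs = length As" and As: "set As \<subseteq> Ob C"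
    and fs: "\<And>i. i < length As \<Longrightarrow> fs ! i \<in> Hom C K (As ! i)"
  shows "tuple C K fs \<in> Hom C K (Prod C As)"
    and "i < length As \<Longrightarrow> Proj C As i \<cdot>\<^bsub>C\<^esub> tuple C K fs = fs ! i"
proof -
  have cods: "map (Cod C) fs = As"
    using len HomD(3)[OF fs] by (intro nth_equalityI) auto
  have "is_cone C {..<length As} (\<lambda>i. As ! i) {} K (\<lambda>i. fs ! i)"
    using K fs by (auto simp: is_cone_def)
  then have "\<exists>!h. h \<in> Hom C K (Prod C As) \<and> (\<forall>i\<in>{..<length As}. Proj C As i \<cdot>\<^bsub>C\<^esub> h = fs ! i)"
    using Prod_limit[OF As] unfolding is_limit_def by blast
  then have "\<exists>!h. h \<in> Hom C K (Prod C As) \<and> (\<forall>i<length fs. Proj C As i \<cdot>\<^bsub>C\<^esub> h = fs ! i)"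
    using len by (simp add: Ball_def)
  from theI'[OF this] show "tuple C K fs \<in> Hom C K (Prod C As)"
    and "i < length As \<Longrightarrow> Proj C As i \<cdot>\<^bsub>C\<^esub> tuple C K fs = fs ! i"
    unfolding tuple_def cods using len by auto
qed

lemma Prod_eqI:
  assumes As: "set As \<subseteq> Ob C" and h: "h \<in> Hom C K (Prod C As)" and h': "h' \<in> Hom C K (Prod C As)"
    and eq: "\<And>i. i < length As \<Longrightarrow> Proj C As i \<cdot>\<^bsub>C\<^esub> h = Proj C As i \<cdot>\<^bsub>C\<^esub> h'"
  shows "h = h'"
proof -
  have "is_cone C {..<length As} (\<lambda>i. As ! i) {} K (\<lambda>i. Proj C As i \<cdot>\<^bsub>C\<^esub> h)"
    using Hom_Ob[OF h] Cmp_in[OF h Proj_Hom[OF As]] by (auto simp: is_cone_def)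
  then have "\<exists>!l. l \<in> Hom C K (Prod C As) \<and>
      (\<forall>i\<in>{..<length As}. Proj C As i \<cdot>\<^bsub>C\<^esub> l = Proj C As i \<cdot>\<^bsub>C\<^esub> h)"
    using Prod_limit[OF As] unfolding is_limit_def by blast
  then show ?thesis using h h' eq by (metis lessThan_iff)
qed

lemma tuple_Cmp:
  assumes e: "e \<in> Hom C L K" and len: "length fs = length As" and As: "set As \<subseteq> Ob C"
    and fs: "\<And>i. i < length As \<Longrightarrow> fs ! i \<in> Hom C K (As ! i)"
  shows "tuple C K fs \<cdot>\<^bsub>C\<^esub> e = tuple C L (map (\<lambda>f. f \<cdot>\<^bsub>C\<^esub> e) fs)"
proof (rule Prod_eqI[OF As])
  have K: "K \<in> Ob C" and L: "L \<in> Ob C"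
    using Hom_Ob[OF e] by auto
  have fse: "map (\<lambda>f. f \<cdot>\<^bsub>C\<^esub> e) fs ! i \<in> Hom C L (As ! i)" if "i < length As" for i
    using that len Cmp_in[OF e fs[OF that]] by simp
  note tup = tuple_universal[OF K len As fs]
  show "tuple C K fs \<cdot>\<^bsub>C\<^esub> e \<in> Hom C L (Prod C As)"
    using Cmp_in[OF e tup(1)] .
  show "tuple C L (map (\<lambda>f. f \<cdot>\<^bsub>C\<^esub> e) fs) \<in> Hom C L (Prod C As)"
    using tuple_universal(1)[OF L _ As fse] len by simp
  show "Proj C As i \<cdot>\<^bsub>C\<^esub> (tuple C K fs \<cdot>\<^bsub>C\<^esub> e) =
      Proj C As i \<cdot>\<^bsub>C\<^esub> tuple C L (map (\<lambda>f. f \<cdot>\<^bsub>C\<^esub> e) fs)" if i: "i < length As" for i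
    using Cmp_assoc[OF e tup(1) Proj_Hom[OF As i]] tup(2)[OF _ i] i
      tuple_universal(2)[OF L _ As fse i] len by simp
qed

section \<open>Forcing\<close>

text \<open>Worlds are pairs, but quantified worlds are never taken apart.\<close>

declare split_paired_All [simp del] split_paired_Ex [simp del]

definition forces :: "'o \<times> 'p \<Rightarrow> 'o \<Rightarrow> 'm \<Rightarrow> 'p \<Rightarrow> bool" where
  "forces w I h \<phi> \<longleftrightarrow> h \<in> Hom C (fst w) I \<and> snd w \<in> Preds P (fst w) \<and> \<phi> \<in> Preds P I \<and>
    snd w \<sqsubseteq>\<^bsub>Fib P (fst w)\<^esub> Sub P h \<phi>"

text \<open>The inequality \<open>\<chi> \<le> \<exists>\<^sub>e\<chi>'\<close> says that the elements of \<open>\<chi>'\<close> are mapped onto those of \<open>\<chi>\<close>. Together with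
  the other one it amounts to \<open>\<exists>\<^sub>e\<chi>' = \<chi>\<close>; the two are kept apart because each is used for one of
  restriction and locality.\<close>

definition covers :: "'o \<times> 'p \<Rightarrow> 'm \<Rightarrow> 'o \<times> 'p \<Rightarrow> bool" where
  "covers w e w' \<longleftrightarrow> e \<in> Hom C (fst w') (fst w) \<and>
    snd w \<in> Preds P (fst w) \<and> snd w' \<in> Preds P (fst w') \<and>
    snd w' \<sqsubseteq>\<^bsub>Fib P (fst w')\<^esub> Sub P e (snd w) \<and> snd w \<sqsubseteq>\<^bsub>Fib P (fst w)\<^esub> Img C P e (snd w')"

lemma covers_Hom: "covers w e w' \<Longrightarrow> e \<in> Hom C (fst w') (fst w)"
  unfolding covers_def by blast

lemma forces_mono:
  assumes c: "covers w e w'" and s: "forces w I h \<phi>"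
  shows "forces w' I (h \<cdot>\<^bsub>C\<^esub> e) \<phi>"
proof -
  note c = c[unfolded covers_def]
  note s = s[unfolded forces_def]
  have e: "e \<in> Hom C (fst w') (fst w)" and h: "h \<in> Hom C (fst w) I" using c s by auto
  have "snd w' \<sqsubseteq>\<^bsub>Fib P (fst w')\<^esub> Sub P e (Sub P h \<phi>)"
  proof (rule le_trans[OF _ Sub_le[OF e]])
    show "snd w' \<sqsubseteq>\<^bsub>Fib P (fst w')\<^esub> Sub P e (snd w)" using c by blast
  qed (use c s Hom_Ob[OF e] Sub_pred[OF e] Sub_pred[OF h] in auto)
  then show ?thesis
    unfolding forces_def using c s Cmp_in[OF e h] Sub_Cmp[OF e h] by simp
qed

text \<open>By adjointness, \<open>\<chi>' \<le> e\<^sup>*h\<^sup>*\<phi>\<close> transposes to \<open>\<exists>\<^sub>e\<chi>' \<le> h\<^sup>*\<phi>\<close>, and \<open>\<chi>\<close> lies below the left-hand side.\<close>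

lemma forces_local:
  assumes c: "covers w e w'" and s: "forces w' I (h \<cdot>\<^bsub>C\<^esub> e) \<phi>" and h: "h \<in> Hom C (fst w) I"
  shows "forces w I h \<phi>"
proof -
  note c = c[unfolded covers_def]
  note s = s[unfolded forces_def]
  have e: "e \<in> Hom C (fst w') (fst w)" using c by auto
  have "snd w' \<sqsubseteq>\<^bsub>Fib P (fst w')\<^esub> Sub P e (Sub P h \<phi>)"
    using s Sub_Cmp[OF e h, of \<phi>] by metis
  then have "Img C P e (snd w') \<sqsubseteq>\<^bsub>Fib P (fst w)\<^esub> Sub P h \<phi>"
    using Img_le_iff[OF e] c s Sub_pred[OF h] by blast
  then have "snd w \<sqsubseteq>\<^bsub>Fib P (fst w)\<^esub> Sub P h \<phi>"
    by (rule le_trans[rotated]) (use c s Sub_pred[OF h] Img_pred[OF e] Hom_Ob[OF e] in auto)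
  then show ?thesis unfolding forces_def using c s h by simp
qed

lemma covers_refl:
  assumes "fst w \<in> Ob C" "snd w \<in> Preds P (fst w)"
  shows "covers w (Ident C (fst w)) w"
proof -
  note i = Ident_in[OF assms(1)]
  have "snd w \<sqsubseteq>\<^bsub>Fib P (fst w)\<^esub> Img C P (Ident C (fst w)) (snd w)"
    using Img_le_iff[OF i assms(2) Img_pred[OF i assms(2)]] le_refl[OF assms(1) Img_pred[OF i assms(2)]]
      Sub_Ident[OF assms(1) Img_pred[OF i assms(2)]] by simp
  then show ?thesis
    unfolding covers_def using i assms Sub_Ident le_refl by simp
qed

lemma covers_comp:
  assumes c: "covers w e w'" and c': "covers w' e' w''"
  shows "covers w (e \<cdot>\<^bsub>C\<^esub> e') w''"
proof -
  note cd = c[unfolded covers_def] and cd' = c'[unfolded covers_def]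
  have e: "e \<in> Hom C (fst w') (fst w)" and e': "e' \<in> Hom C (fst w'') (fst w')"
    using cd cd' by auto
  have ee': "e \<cdot>\<^bsub>C\<^esub> e' \<in> Hom C (fst w'') (fst w)" using Cmp_in[OF e' e] .
  have w: "snd w \<in> Preds P (fst w)" and w': "snd w' \<in> Preds P (fst w')"
    and w'': "snd w'' \<in> Preds P (fst w'')" using cd cd' by auto
  have obs: "fst w \<in> Ob C" "fst w' \<in> Ob C" "fst w'' \<in> Ob C"
    using Hom_Ob[OF e] Hom_Ob[OF e'] by auto
  let ?\<theta> = "Img C P (e \<cdot>\<^bsub>C\<^esub> e') (snd w'')"
  have \<theta>: "?\<theta> \<in> Preds P (fst w)" using Img_pred[OF ee' w''] .
  have "snd w'' \<sqsubseteq>\<^bsub>Fib P (fst w'')\<^esub> Sub P (e \<cdot>\<^bsub>C\<^esub> e') ?\<theta>"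
    using Img_le_iff[OF ee' w'' \<theta>] le_refl[OF obs(1) \<theta>] by simp
  then have "Img C P e' (snd w'') \<sqsubseteq>\<^bsub>Fib P (fst w')\<^esub> Sub P e ?\<theta>"
    using Img_le_iff[OF e' w'' Sub_pred[OF e \<theta>]] Sub_Cmp[OF e' e \<theta>] by simp
  then have "snd w' \<sqsubseteq>\<^bsub>Fib P (fst w')\<^esub> Sub P e ?\<theta>"
    using cd' by (intro le_trans[OF _ _ obs(2) w' Img_pred[OF e' w''] Sub_pred[OF e \<theta>]]) auto
  then have "Img C P e (snd w') \<sqsubseteq>\<^bsub>Fib P (fst w)\<^esub> ?\<theta>"
    using Img_le_iff[OF e w' \<theta>] by simp
  then have "snd w \<sqsubseteq>\<^bsub>Fib P (fst w)\<^esub> ?\<theta>"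
    using cd by (intro le_trans[OF _ _ obs(1) w Img_pred[OF e w'] \<theta>]) auto
  moreover have "snd w'' \<sqsubseteq>\<^bsub>Fib P (fst w'')\<^esub> Sub P e' (Sub P e (snd w))"
    using cd cd' Sub_le[OF e' w' Sub_pred[OF e w]]
    by (intro le_trans[OF _ _ obs(3) w'' Sub_pred[OF e' w'] Sub_pred[OF e' Sub_pred[OF e w]]]) auto
  ultimately show ?thesis
    unfolding covers_def using ee' w w'' Sub_Cmp[OF e' e w] by simp
qed

lemma forces_top:
  "forces w I h \<top>\<^bsub>Fib P I\<^esub> \<longleftrightarrow> h \<in> Hom C (fst w) I \<and> snd w \<in> Preds P (fst w)"
proof (cases "h \<in> Hom C (fst w) I")
  case True
  then show ?thesis
    unfolding forces_def
    using Sub_top[OF True] top_in[OF Hom_Ob(2)[OF True]] le_top[OF Hom_Ob(1)[OF True]] by auto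
qed (simp add: forces_def)

lemma forces_meet:
  assumes "\<phi> \<in> Preds P I" "\<psi> \<in> Preds P I"
  shows "forces w I h (\<phi> \<sqinter>\<^bsub>Fib P I\<^esub> \<psi>) \<longleftrightarrow> forces w I h \<phi> \<and> forces w I h \<psi>"
proof (cases "h \<in> Hom C (fst w) I \<and> snd w \<in> Preds P (fst w)")
  case True
  then have h: "h \<in> Hom C (fst w) I" and w: "snd w \<in> Preds P (fst w)" by auto
  show ?thesis
    unfolding forces_def
    using h w assms Sub_meet[OF h assms] meet_in[OF Hom_Ob(2)[OF h] assms]
      le_meet_iff[OF Hom_Ob(1)[OF h] Sub_pred[OF h assms(1)] Sub_pred[OF h assms(2)] w] by simp
qed (auto simp: forces_def)

lemma forces_Sub:
  assumes f: "f \<in> Hom C J I" and h: "h \<in> Hom C (fst w) J" and "\<phi> \<in> Preds P I"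
  shows "forces w J h (Sub P f \<phi>) \<longleftrightarrow> forces w I (f \<cdot>\<^bsub>C\<^esub> h) \<phi>"
  unfolding forces_def using assms Sub_Cmp[OF h f] Cmp_in[OF h f] Sub_pred[OF f] by simp

text \<open>The Kripke-Joyal clause for images along an arbitrary arrow. From left to right, the cover is the
  pullback \<open>p\<close> of \<open>g\<close> along \<open>f\<close>: by (BC), \<open>f\<^sup>*\<exists>\<^sub>g\<phi>\<close> equals \<open>\<exists>\<^sub>pk\<^sup>*\<phi>\<close>, and by (Fr) restricting \<open>k\<^sup>*\<phi>\<close> to \<open>p\<^sup>*\<chi>\<close>
  does not shrink the part of the image that lies in \<open>\<chi>\<close>. From right to left, the unit of the
  adjunction forces the image on the cover, and locality brings it down.\<close>

lemma forces_Img: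
  assumes g: "g \<in> Hom C J I" and Q: "\<phi> \<in> Preds P J"
  shows "forces w I f (Img C P g \<phi>) \<longleftrightarrow> f \<in> Hom C (fst w) I \<and>
    (\<exists>e w' h. covers w e w' \<and> g \<cdot>\<^bsub>C\<^esub> h = f \<cdot>\<^bsub>C\<^esub> e \<and> forces w' J h \<phi>)" (is "?L \<longleftrightarrow> ?R")
proof
  assume L: ?L
  note L = L[unfolded forces_def]
  have f: "f \<in> Hom C (fst w) I" and w: "snd w \<in> Preds P (fst w)" using L by auto
  obtain p k D where p: "p \<in> Hom C D (fst w)" and k: "k \<in> Hom C D J"
    and comm: "f \<cdot>\<^bsub>C\<^esub> p = g \<cdot>\<^bsub>C\<^esub> k" and pb: "is_pullback C f g p k"
    using pullback_exists[OF f g] by blast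
  have D: "D \<in> Ob C" and K: "fst w \<in> Ob C" using Hom_Ob[OF p] by auto
  have pw: "Sub P p (snd w) \<in> Preds P D" and kQ: "Sub P k \<phi> \<in> Preds P D"
    using Sub_pred[OF p w] Sub_pred[OF k Q] by auto
  define \<chi> where "\<chi> = Sub P k \<phi> \<sqinter>\<^bsub>Fib P D\<^esub> Sub P p (snd w)"
  have \<chi>: "\<chi> \<in> Preds P D"
    unfolding \<chi>_def using meet_in[OF D kQ pw] .
  then have below: "\<chi> \<sqsubseteq>\<^bsub>Fib P D\<^esub> Sub P k \<phi>" "\<chi> \<sqsubseteq>\<^bsub>Fib P D\<^esub> Sub P p (snd w)"
    using le_meet_iff[OF D kQ pw \<chi>] le_refl[OF D \<chi>] unfolding \<chi>_def by auto
  have bc: "Img C P p (Sub P k \<phi>) = Sub P f (Img C P g \<phi>)"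
    using BC[OF pb] HomD(2)[OF g] Q by simp
  have "Img C P p \<chi> = Img C P p (Sub P k \<phi>) \<sqinter>\<^bsub>Fib P (fst w)\<^esub> snd w"
    unfolding \<chi>_def using Fr[OF p kQ w] by simp
  then have "snd w \<sqsubseteq>\<^bsub>Fib P (fst w)\<^esub> Img C P p \<chi>"
    using le_meet_iff[OF K Img_pred[OF p kQ] w w] L bc le_refl[OF K w] by simp
  then have "covers w p (D, \<chi>)"
    unfolding covers_def using p w \<chi> below by simp
  moreover have "forces (D, \<chi>) J k \<phi>"
    unfolding forces_def using k \<chi> Q below by simp
  ultimately show ?R using f comm by metis
next
  assume R: ?R
  then obtain e w' h where f: "f \<in> Hom C (fst w) I" and c: "covers w e w'"
    and comm: "g \<cdot>\<^bsub>C\<^esub> h = f \<cdot>\<^bsub>C\<^esub> e" and s: "forces w' J h \<phi>" by blast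
  have h: "h \<in> Hom C (fst w') J" using s unfolding forces_def by blast
  have gQ: "Img C P g \<phi> \<in> Preds P I" using Img_pred[OF g Q] .
  have J: "J \<in> Ob C" and I: "I \<in> Ob C" using Hom_Ob[OF g] by auto
  have "\<phi> \<sqsubseteq>\<^bsub>Fib P J\<^esub> Sub P g (Img C P g \<phi>)"
    using Img_le_iff[OF g Q gQ] le_refl[OF I gQ] by simp
  then have "Sub P h \<phi> \<sqsubseteq>\<^bsub>Fib P (fst w')\<^esub> Sub P h (Sub P g (Img C P g \<phi>))"
    using Sub_le[OF h Q Sub_pred[OF g gQ]] by blast
  then have "forces w' J h (Sub P g (Img C P g \<phi>))"
    using s le_trans[OF _ _ Hom_Ob(1)[OF h] _ Sub_pred[OF h Q] Sub_pred[OF h Sub_pred[OF g gQ]],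
        of "snd w'"] Sub_pred[OF g gQ] unfolding forces_def by simp
  then have "forces w' I (f \<cdot>\<^bsub>C\<^esub> e) (Img C P g \<phi>)"
    using forces_Sub[OF g h gQ] comm by simp
  then show ?L using forces_local[OF c _ f] by blast
qed

text \<open>The generic element, the identity of \<open>I\<close> at the world \<open>(I, \<phi>)\<close>, forces \<open>\<phi>\<close>; that it forces \<open>\<psi>\<close> is the
  inequality itself.\<close>

lemma le_iff_forces:
  assumes I: "I \<in> Ob C" and "\<phi> \<in> Preds P I" "\<psi> \<in> Preds P I"
  shows "\<phi> \<sqsubseteq>\<^bsub>Fib P I\<^esub> \<psi> \<longleftrightarrow> (\<forall>w h. forces w I h \<phi> \<longrightarrow> forces w I h \<psi>)"
proof
  assume le: "\<phi> \<sqsubseteq>\<^bsub>Fib P I\<^esub> \<psi>"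
  show "\<forall>w h. forces w I h \<phi> \<longrightarrow> forces w I h \<psi>"
  proof (intro allI impI)
    fix w h assume s: "forces w I h \<phi>"
    note s = s[unfolded forces_def]
    then have h: "h \<in> Hom C (fst w) I" by blast
    show "forces w I h \<psi>"
      unfolding forces_def
      using s assms le_trans[OF _ Sub_le[OF h assms(2,3) le] Hom_Ob(1)[OF h]] Sub_pred[OF h] by simp
  qed
next
  assume *: "\<forall>w h. forces w I h \<phi> \<longrightarrow> forces w I h \<psi>"
  have "forces (I, \<phi>) I (Ident C I) \<phi>"
    unfolding forces_def using assms Ident_in[OF I] Sub_Ident[OF I] le_refl by simp
  with * have "forces (I, \<phi>) I (Ident C I) \<psi>" by blast
  then show "\<phi> \<sqsubseteq>\<^bsub>Fib P I\<^esub> \<psi>"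
    unfolding forces_def using assms Sub_Ident[OF I] by simp
qed

lemma pred_eqI:
  assumes "I \<in> Ob C" "\<phi> \<in> Preds P I" "\<psi> \<in> Preds P I"
    and "\<And>w h. forces w I h \<phi> \<longleftrightarrow> forces w I h \<psi>"
  shows "\<phi> = \<psi>"
  by (rule le_antisym[OF _ _ assms(1-3)])
    (simp_all add: le_iff_forces[OF assms(1)] assms(2-4))

section \<open>Kripke-Joyal semantics of the internal language\<close>

text \<open>Generalized elements of the product of a context are handled as lists of components, so that the
  variables of the language become list positions.\<close>

definition elements :: "'o \<times> 'p \<Rightarrow> 'o list \<Rightarrow> 'm list \<Rightarrow> bool" where
  "elements w \<Gamma> as \<longleftrightarrow> snd w \<in> Preds P (fst w) \<and> fst w \<in> Ob C \<and> set \<Gamma> \<subseteq> Ob C \<and>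
    list_all2 (\<lambda>a A. a \<in> Hom C (fst w) A) as \<Gamma>"

lemma elements_tuple:
  assumes "elements w \<Gamma> as"
  shows "tuple C (fst w) as \<in> Hom C (fst w) (Prod C \<Gamma>)"
    and "i < length \<Gamma> \<Longrightarrow> Proj C \<Gamma> i \<cdot>\<^bsub>C\<^esub> tuple C (fst w) as = as ! i"
    and "i < length \<Gamma> \<Longrightarrow> as ! i \<in> Hom C (fst w) (\<Gamma> ! i)"
    and "e \<in> Hom C L (fst w) \<Longrightarrow>
      tuple C (fst w) as \<cdot>\<^bsub>C\<^esub> e = tuple C L (map (\<lambda>a. a \<cdot>\<^bsub>C\<^esub> e) as)"
proof -
  have K: "fst w \<in> Ob C" and len: "length as = length \<Gamma>" and \<Gamma>: "set \<Gamma> \<subseteq> Ob C"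
    and as: "\<And>i. i < length \<Gamma> \<Longrightarrow> as ! i \<in> Hom C (fst w) (\<Gamma> ! i)"
    using assms by (auto simp: elements_def list_all2_conv_all_nth)
  show "tuple C (fst w) as \<in> Hom C (fst w) (Prod C \<Gamma>)"
    and "i < length \<Gamma> \<Longrightarrow> Proj C \<Gamma> i \<cdot>\<^bsub>C\<^esub> tuple C (fst w) as = as ! i"
    and "i < length \<Gamma> \<Longrightarrow> as ! i \<in> Hom C (fst w) (\<Gamma> ! i)"
    and "e \<in> Hom C L (fst w) \<Longrightarrow>
      tuple C (fst w) as \<cdot>\<^bsub>C\<^esub> e = tuple C L (map (\<lambda>a. a \<cdot>\<^bsub>C\<^esub> e) as)"
    by (rule tuple_universal[OF K len \<Gamma> as] tuple_Cmp[OF _ len \<Gamma> as] as; assumption)+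
qed

lemma elements_of_arrow:
  assumes \<Gamma>: "set \<Gamma> \<subseteq> Ob C" and h: "h \<in> Hom C (fst w) (Prod C \<Gamma>)" and w: "snd w \<in> Preds P (fst w)"
  obtains as where "elements w \<Gamma> as" "h = tuple C (fst w) as"
proof
  let ?as = "map (\<lambda>i. Proj C \<Gamma> i \<cdot>\<^bsub>C\<^esub> h) [0..<length \<Gamma>]"
  show el: "elements w \<Gamma> ?as"
    unfolding elements_def list_all2_conv_all_nth
    using w \<Gamma> Hom_Ob[OF h] Cmp_in[OF h Proj_Hom[OF \<Gamma>]] by simp
  show "h = tuple C (fst w) ?as"
    by (rule Prod_eqI[OF \<Gamma> h elements_tuple(1)[OF el]]) (simp add: elements_tuple(2)[OF el])
qed

lemma elements_restrict:
  assumes "elements w \<Gamma> as" "covers w e w'"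
  shows "elements w' \<Gamma> (map (\<lambda>a. a \<cdot>\<^bsub>C\<^esub> e) as)"
  using assms Hom_Ob[OF covers_Hom[OF assms(2)]] Cmp_in[OF covers_Hom[OF assms(2)]]
  unfolding elements_def covers_def list_all2_conv_all_nth by auto

lemma elements_snoc:
  "elements w (\<Gamma> @ [A]) (as @ [a]) \<longleftrightarrow> elements w \<Gamma> as \<and> a \<in> Hom C (fst w) A"
proof -
  have "list_all2 R (as @ [a]) (\<Gamma> @ [A]) \<longleftrightarrow> list_all2 R as \<Gamma> \<and> R a A" for R
    by (cases "length as = length \<Gamma>") (auto simp: list_all2_append dest: list_all2_lengthD)
  then show ?thesis using Hom_Ob(2)[of a "fst w" A] by (auto simp: elements_def)
qed

lemma elements_snocE:
  assumes "elements w (\<Gamma> @ [A]) bs"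
  obtains as a where "bs = as @ [a]" "elements w \<Gamma> as" "a \<in> Hom C (fst w) A"
proof -
  have "bs \<noteq> []" using assms by (auto simp: elements_def)
  then obtain as a where "bs = as @ [a]" by (metis rev_exhaust)
  with assms that show ?thesis by (simp add: elements_snoc)
qed

lemma forget_last_Hom:
  assumes \<Gamma>: "set \<Gamma> \<subseteq> Ob C" and A: "A \<in> Ob C"
  shows "forget_last C \<Gamma> A \<in> Hom C (Prod C (\<Gamma> @ [A])) (Prod C \<Gamma>)"
    and "i < length \<Gamma> \<Longrightarrow> Proj C \<Gamma> i \<cdot>\<^bsub>C\<^esub> forget_last C \<Gamma> A = Proj C (\<Gamma> @ [A]) i"
proof -
  have \<Gamma>A: "set (\<Gamma> @ [A]) \<subseteq> Ob C" using assms by simp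
  have "map (Proj C (\<Gamma> @ [A])) [0..<length \<Gamma>] ! i \<in> Hom C (Prod C (\<Gamma> @ [A])) (\<Gamma> ! i)"
    if "i < length \<Gamma>" for i
    using Proj_Hom[OF \<Gamma>A, of i] that by (simp add: nth_append)
  note tup = tuple_universal[OF Prod_Ob[OF \<Gamma>A] _ \<Gamma> this]
  show "forget_last C \<Gamma> A \<in> Hom C (Prod C (\<Gamma> @ [A])) (Prod C \<Gamma>)"
    unfolding forget_last_def by (rule tup(1)) simp_all
  show "i < length \<Gamma> \<Longrightarrow> Proj C \<Gamma> i \<cdot>\<^bsub>C\<^esub> forget_last C \<Gamma> A = Proj C (\<Gamma> @ [A]) i"
    unfolding forget_last_def by (subst tup(2)) simp_all
qed

lemma forget_last_tuple:
  assumes as: "elements w \<Gamma> as" and a: "a \<in> Hom C (fst w) A"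
  shows "forget_last C \<Gamma> A \<cdot>\<^bsub>C\<^esub> tuple C (fst w) (as @ [a]) = tuple C (fst w) as"
proof -
  have \<Gamma>: "set \<Gamma> \<subseteq> Ob C" using as by (simp add: elements_def)
  have A: "A \<in> Ob C" using Hom_Ob[OF a] by simp
  have asa: "elements w (\<Gamma> @ [A]) (as @ [a])" using as a by (simp add: elements_snoc)
  have len: "length as = length \<Gamma>" using as by (simp add: elements_def list_all2_conv_all_nth)
  note fl = forget_last_Hom[OF \<Gamma> A]
  note h = elements_tuple(1)[OF asa]
  show ?thesis
  proof (rule Prod_eqI[OF \<Gamma> Cmp_in[OF h fl(1)] elements_tuple(1)[OF as]])
    fix i assume i: "i < length \<Gamma>"
    have "Proj C \<Gamma> i \<cdot>\<^bsub>C\<^esub> (forget_last C \<Gamma> A \<cdot>\<^bsub>C\<^esub> tuple C (fst w) (as @ [a])) =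
        Proj C (\<Gamma> @ [A]) i \<cdot>\<^bsub>C\<^esub> tuple C (fst w) (as @ [a])"
      using Cmp_assoc[OF h fl(1) Proj_Hom[OF \<Gamma> i]] fl(2)[OF i] by simp
    also have "\<dots> = as ! i"
      using elements_tuple(2)[OF asa, of i] i len by (simp add: nth_append)
    also have "\<dots> = Proj C \<Gamma> i \<cdot>\<^bsub>C\<^esub> tuple C (fst w) as"
      using elements_tuple(2)[OF as i] by simp
    finally show "Proj C \<Gamma> i \<cdot>\<^bsub>C\<^esub> (forget_last C \<Gamma> A \<cdot>\<^bsub>C\<^esub> tuple C (fst w) (as @ [a])) =
        Proj C \<Gamma> i \<cdot>\<^bsub>C\<^esub> tuple C (fst w) as" .
  qed
qed

definition sat :: "'o \<times> 'p \<Rightarrow> 'o \<Rightarrow> 'o \<Rightarrow> 'p \<Rightarrow> 'm \<Rightarrow> 'm \<Rightarrow> bool" where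
  "sat w A B \<phi> a b \<longleftrightarrow> elements w [A, B] [a, b] \<and> forces w (Prod C [A, B]) (tuple C (fst w) [a, b]) \<phi>"

fun sort_of :: "'o list \<Rightarrow> 'm trm \<Rightarrow> 'o" where
  "sort_of \<Gamma> (Var i) = \<Gamma> ! i"
| "sort_of \<Gamma> (App f ts) = Cod C f"

text \<open>The fragment of the language that occurs in the definitions of the two categories: unary function
  symbols, binary relation symbols, and no equations. On ill-formed terms and formulas the evaluation
  functions below may be undefined.\<close>

fun wf_trm :: "'o list \<Rightarrow> 'm trm \<Rightarrow> bool" where
  "wf_trm \<Gamma> (Var i) \<longleftrightarrow> i < length \<Gamma>"
| "wf_trm \<Gamma> (App f [t]) \<longleftrightarrow> wf_trm \<Gamma> t \<and> f \<in> Hom C (sort_of \<Gamma> t) (Cod C f)"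
| "wf_trm \<Gamma> _ \<longleftrightarrow> False"

fun trm_at :: "'m list \<Rightarrow> 'm trm \<Rightarrow> 'm" where
  "trm_at as (Var i) = as ! i"
| "trm_at as (App f [t]) = f \<cdot>\<^bsub>C\<^esub> trm_at as t"

fun wf_fm :: "'o list \<Rightarrow> ('o, 'm, 'p) fm \<Rightarrow> bool" where
  "wf_fm \<Gamma> (Rel \<phi> ts) \<longleftrightarrow> length ts = 2 \<and> wf_trm \<Gamma> (ts ! 0) \<and> wf_trm \<Gamma> (ts ! 1) \<and>
    \<phi> \<in> Preds P (Prod C [sort_of \<Gamma> (ts ! 0), sort_of \<Gamma> (ts ! 1)])"
| "wf_fm \<Gamma> (Eql t u) \<longleftrightarrow> False"
| "wf_fm \<Gamma> Tru \<longleftrightarrow> True"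
| "wf_fm \<Gamma> (Q AND R) \<longleftrightarrow> wf_fm \<Gamma> Q \<and> wf_fm \<Gamma> R"
| "wf_fm \<Gamma> (Exi A Q) \<longleftrightarrow> A \<in> Ob C \<and> wf_fm (\<Gamma> @ [A]) Q"

fun fm_at :: "'o \<times> 'p \<Rightarrow> 'o list \<Rightarrow> 'm list \<Rightarrow> ('o, 'm, 'p) fm \<Rightarrow> bool" where
  "fm_at w \<Gamma> as (Rel \<phi> ts) \<longleftrightarrow>
    sat w (sort_of \<Gamma> (ts ! 0)) (sort_of \<Gamma> (ts ! 1)) \<phi> (trm_at as (ts ! 0)) (trm_at as (ts ! 1))"
| "fm_at w \<Gamma> as Tru \<longleftrightarrow> True"
| "fm_at w \<Gamma> as (Q AND R) \<longleftrightarrow> fm_at w \<Gamma> as Q \<and> fm_at w \<Gamma> as R"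
| "fm_at w \<Gamma> as (Exi A Q) \<longleftrightarrow> (\<exists>e w' a. covers w e w' \<and> a \<in> Hom C (fst w') A \<and>
    fm_at w' (\<Gamma> @ [A]) (map (\<lambda>a. a \<cdot>\<^bsub>C\<^esub> e) as @ [a]) Q)"

lemma Prod_singleton_tuple:
  assumes f: "f \<in> Hom C K A"
  shows "tuple C K [f] = f"
proof -
  have A: "A \<in> Ob C" and K: "K \<in> Ob C" using Hom_Ob[OF f] by auto
  have tup: "tuple C K [f] \<in> Hom C K (Prod C [A])" "Proj C [A] 0 \<cdot>\<^bsub>C\<^esub> tuple C K [f] = f"
    using tuple_universal[of K "[f]" "[A]"] f A K by auto
  then show ?thesis
    using Ident_left[of "tuple C K [f]" K A] Prod_single[OF A] Proj_single[OF A] by simp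
qed

lemma trm_interp_Hom:
  assumes \<Gamma>: "set \<Gamma> \<subseteq> Ob C"
  shows "wf_trm \<Gamma> t \<Longrightarrow> trm_interp C \<Gamma> t \<in> Hom C (Prod C \<Gamma>) (sort_of \<Gamma> t)"
proof (induction t rule: trm_at.induct)
  case (1 as i)
  then show ?case using Proj_Hom[OF \<Gamma>] by simp
next
  case (2 as f t)
  then have t: "trm_interp C \<Gamma> t \<in> Hom C (Prod C \<Gamma>) (sort_of \<Gamma> t)"
    and f: "f \<in> Hom C (sort_of \<Gamma> t) (Cod C f)" by simp_all
  show ?case using Cmp_in[OF t f] Prod_singleton_tuple[OF t] by simp
qed simp_all

text \<open>Substituting elements for the variables of a term is composition with their tuple.\<close>

lemma trm_interp_at:
  "elements w \<Gamma> as \<Longrightarrow> wf_trm \<Gamma> t \<Longrightarrow> trm_interp C \<Gamma> t \<cdot>\<^bsub>C\<^esub> tuple C (fst w) as = trm_at as t"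
proof (induction as t rule: trm_at.induct)
  case (1 as i)
  then show ?case using elements_tuple(2) by simp
next
  case (2 as f t)
  note as = 2(2)
  have \<Gamma>: "set \<Gamma> \<subseteq> Ob C" using as by (simp add: elements_def)
  have t: "trm_interp C \<Gamma> t \<in> Hom C (Prod C \<Gamma>) (sort_of \<Gamma> t)"
    and f: "f \<in> Hom C (sort_of \<Gamma> t) (Cod C f)" using 2 trm_interp_Hom[OF \<Gamma>] by simp_all
  show ?case
    using 2 Cmp_assoc[OF elements_tuple(1)[OF as] t f] Prod_singleton_tuple[OF t] by simp
qed simp_all
lemma wf_fm_pred: "set \<Gamma> \<subseteq> Ob C \<Longrightarrow> wf_fm \<Gamma> Q \<Longrightarrow> fm_interp C P \<Gamma> Q \<in> Preds P (Prod C \<Gamma>)"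
proof (induction \<Gamma> Q rule: wf_fm.induct)
  case (1 \<Gamma> \<phi> ts)
  define t u where "t = ts ! 0" and "u = ts ! 1"
  have ts: "ts = [t, u]" 
    using 1 unfolding t_def u_def by (auto simp: length_Suc_conv numeral_2_eq_2)
  have t: "trm_interp C \<Gamma> t \<in> Hom C (Prod C \<Gamma>) (sort_of \<Gamma> t)"
    and u: "trm_interp C \<Gamma> u \<in> Hom C (Prod C \<Gamma>) (sort_of \<Gamma> u)"
    using 1 trm_interp_Hom unfolding ts by auto
  have "tuple C (Prod C \<Gamma>) [trm_interp C \<Gamma> t, trm_interp C \<Gamma> u] \<in>
      Hom C (Prod C \<Gamma>) (Prod C [sort_of \<Gamma> t, sort_of \<Gamma> u])"
    by (rule tuple_universal(1))
      (use t u Hom_Ob[OF t] Hom_Ob[OF u] in \<open>auto simp: less_Suc_eq\<close>)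
  then show ?case using 1 Sub_pred by (simp add: ts)
next
  case (4 \<Gamma> Q R)
  then show ?case using meet_in[OF Prod_Ob] by simp
next
  case (5 \<Gamma> A Q)
  then show ?case using Img_pred[OF forget_last_Hom(1)] by simp
qed (simp_all add: top_in Prod_Ob)

text \<open>Soundness of the clauses of \<open>fm_at\<close>. The existential clause rests on \<open>forces_Img\<close> for the projection
  that forgets the last variable: an arrow above \<open>\<langle>as\<rangle> \<circ> e\<close> is the tuple of the restricted elements
  followed by one new element, the witness.\<close>

lemma forces_fm_iff:
  "elements w \<Gamma> as \<Longrightarrow> wf_fm \<Gamma> Q \<Longrightarrow>
    forces w (Prod C \<Gamma>) (tuple C (fst w) as) (fm_interp C P \<Gamma> Q) \<longleftrightarrow> fm_at w \<Gamma> as Q"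
proof (induction w \<Gamma> as Q rule: fm_at.induct)
  case (1 w \<Gamma> as \<phi> ts)
  define t u where "t = ts ! 0" and "u = ts ! 1"
  have ts: "ts = [t, u]" 
    using 1(2) unfolding t_def u_def by (auto simp: length_Suc_conv numeral_2_eq_2)
  have \<Gamma>: "set \<Gamma> \<subseteq> Ob C" using 1 by (simp add: elements_def)
  have wf: "wf_trm \<Gamma> t" "wf_trm \<Gamma> u" and \<phi>: "\<phi> \<in> Preds P (Prod C [sort_of \<Gamma> t, sort_of \<Gamma> u])"
    using 1 by (simp_all add: ts)
  \<comment> \<open>The interpretations of \<open>t\<close> and \<open>u\<close> are themselves elements at the world \<open>(Prod C \<Gamma>, \<top>)\<close>, so their
    tuple is governed by the same facts as a tuple of elements of \<open>w\<close>.\<close>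
  define w0 where "w0 = (Prod C \<Gamma>, \<top>\<^bsub>Fib P (Prod C \<Gamma>)\<^esub>)"
  have t: "trm_interp C \<Gamma> t \<in> Hom C (Prod C \<Gamma>) (sort_of \<Gamma> t)"
    and u: "trm_interp C \<Gamma> u \<in> Hom C (Prod C \<Gamma>) (sort_of \<Gamma> u)"
    using wf trm_interp_Hom[OF \<Gamma>] by auto
  have el: "elements w0 [sort_of \<Gamma> t, sort_of \<Gamma> u] [trm_interp C \<Gamma> t, trm_interp C \<Gamma> u]"
    unfolding elements_def w0_def
    using t u Hom_Ob[OF t] Hom_Ob[OF u] top_in by simp
  have h: "tuple C (fst w) as \<in> Hom C (fst w) (Prod C \<Gamma>)" using elements_tuple(1)[OF 1(1)] .
  note tup = elements_tuple(1)[OF el, unfolded w0_def fst_conv]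
    elements_tuple(4)[OF el, unfolded w0_def fst_conv, OF h]
  have "forces w (Prod C \<Gamma>) (tuple C (fst w) as) (fm_interp C P \<Gamma> (Rel \<phi> ts)) \<longleftrightarrow>
      forces w (Prod C [sort_of \<Gamma> t, sort_of \<Gamma> u]) (tuple C (fst w) [trm_at as t, trm_at as u]) \<phi>"
    using forces_Sub[OF tup(1) h \<phi>] tup(2) trm_interp_at[OF 1(1)] wf by (simp add: ts)
  moreover have "elements w [sort_of \<Gamma> t, sort_of \<Gamma> u] [trm_at as t, trm_at as u]"
    using 1(1) Cmp_in[OF h t] Cmp_in[OF h u] trm_interp_at[OF 1(1)] wf
      Hom_Ob[OF t] Hom_Ob[OF u] by (simp add: elements_def)
  ultimately show ?case by (simp add: ts sat_def)
next
  case (2 w \<Gamma> as)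
  then show ?case using elements_tuple(1)[OF 2(1)] by (simp add: forces_top elements_def)
next
  case (3 w \<Gamma> as Q R)
  have \<Gamma>: "set \<Gamma> \<subseteq> Ob C" using 3 by (simp add: elements_def)
  show ?case using 3 forces_meet[OF wf_fm_pred[OF \<Gamma>] wf_fm_pred[OF \<Gamma>]] by simp
next
  case (4 w \<Gamma> as A Q)
  note as = \<open>elements w \<Gamma> as\<close>
  have \<Gamma>: "set \<Gamma> \<subseteq> Ob C" using as by (simp add: elements_def)
  have A: "A \<in> Ob C" and Q: "wf_fm (\<Gamma> @ [A]) Q" using 4(3) by auto
  have \<Gamma>A: "set (\<Gamma> @ [A]) \<subseteq> Ob C" using \<Gamma> A by simp
  let ?h = "tuple C (fst w) as" and ?\<pi> = "forget_last C \<Gamma> A" and ?Q = "fm_interp C P (\<Gamma> @ [A]) Q"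
  have h: "?h \<in> Hom C (fst w) (Prod C \<Gamma>)" using elements_tuple(1)[OF as] .
  have step: "(\<exists>k. ?\<pi> \<cdot>\<^bsub>C\<^esub> k = ?h \<cdot>\<^bsub>C\<^esub> e \<and> forces w' (Prod C (\<Gamma> @ [A])) k ?Q) \<longleftrightarrow>
      (\<exists>a. a \<in> Hom C (fst w') A \<and> fm_at w' (\<Gamma> @ [A]) (map (\<lambda>a. a \<cdot>\<^bsub>C\<^esub> e) as @ [a]) Q)"
    (is "?L \<longleftrightarrow> ?R") if c: "covers w e w'" for e w'
  proof -
    let ?as = "map (\<lambda>a. a \<cdot>\<^bsub>C\<^esub> e) as"
    have as': "elements w' \<Gamma> ?as" using elements_restrict[OF as c] .
    have he: "?h \<cdot>\<^bsub>C\<^esub> e = tuple C (fst w') ?as" using elements_tuple(4)[OF as covers_Hom[OF c]] .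
    have IH: "forces w' (Prod C (\<Gamma> @ [A])) (tuple C (fst w') (?as @ [a])) ?Q \<longleftrightarrow>
        fm_at w' (\<Gamma> @ [A]) (?as @ [a]) Q" if "a \<in> Hom C (fst w') A" for a
      using 4(1) elements_snoc as' that Q by simp
    show ?thesis
    proof
      assume ?L
      then obtain k where k: "?\<pi> \<cdot>\<^bsub>C\<^esub> k = ?h \<cdot>\<^bsub>C\<^esub> e" "forces w' (Prod C (\<Gamma> @ [A])) k ?Q" by blast
      then have "k \<in> Hom C (fst w') (Prod C (\<Gamma> @ [A]))" "snd w' \<in> Preds P (fst w')"
        unfolding forces_def by auto
      then obtain cs where cs: "elements w' (\<Gamma> @ [A]) cs" "k = tuple C (fst w') cs"
        using elements_of_arrow[OF \<Gamma>A] by blast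
      obtain bs a where bs: "cs = bs @ [a]" "elements w' \<Gamma> bs" "a \<in> Hom C (fst w') A"
        using elements_snocE[OF cs(1)] by blast
      have eq: "tuple C (fst w') bs = tuple C (fst w') ?as"
        using forget_last_tuple[OF bs(2,3)] k(1) cs(2) bs(1) he by simp
      have "bs = ?as"
      proof (rule nth_equalityI)
        show "length bs = length ?as"
          using bs(2) as' by (simp add: elements_def list_all2_conv_all_nth)
        show "bs ! i = ?as ! i" if "i < length bs" for i
          using elements_tuple(2)[OF bs(2), of i] elements_tuple(2)[OF as', of i] eq that bs(2)
          by (simp add: elements_def list_all2_conv_all_nth)
      qed
      then show ?R using IH[OF bs(3)] bs cs k by auto
    next
      assume ?R
      then obtain a where a: "a \<in> Hom C (fst w') A" "fm_at w' (\<Gamma> @ [A]) (?as @ [a]) Q" by blast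
      then show ?L using IH[OF a(1)] forget_last_tuple[OF as' a(1)] he by auto
    qed
  qed
  show ?case
    unfolding fm_interp.simps fm_at.simps
    using forces_Img[OF forget_last_Hom(1)[OF \<Gamma> A] wf_fm_pred[OF \<Gamma>A Q], of w ?h] h step
    by meson
qed simp

lemma forces_foldr_meet:
  assumes I: "I \<in> Ob C" and "\<And>Q. Q \<in> set Qs \<Longrightarrow> i Q \<in> Preds P I"
  shows "foldr (\<lambda>Q \<chi>. i Q \<sqinter>\<^bsub>Fib P I\<^esub> \<chi>) Qs \<top>\<^bsub>Fib P I\<^esub> \<in> Preds P I \<and>
    (forces w I h (foldr (\<lambda>Q \<chi>. i Q \<sqinter>\<^bsub>Fib P I\<^esub> \<chi>) Qs \<top>\<^bsub>Fib P I\<^esub>) \<longleftrightarrow>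
      h \<in> Hom C (fst w) I \<and> snd w \<in> Preds P (fst w) \<and> (\<forall>Q\<in>set Qs. forces w I h (i Q)))"
  using assms(2)
proof (induction Qs)
  case Nil
  then show ?case using top_in[OF I] by (simp add: forces_top)
next
  case (Cons Q Qs)
  then show ?case using meet_in[OF I] forces_meet by auto
qed

text \<open>Every judgment becomes a statement about all worlds and all lists of elements; this is the only way
  in which judgments are used from here on.\<close>

lemma holds_iff:
  assumes \<Gamma>: "set \<Gamma> \<subseteq> Ob C" and "list_all (wf_fm \<Gamma>) Qs" and R: "wf_fm \<Gamma> R"
  shows "holds C P \<Gamma> Qs R \<longleftrightarrow>
    (\<forall>w as. elements w \<Gamma> as \<longrightarrow> (\<forall>Q\<in>set Qs. fm_at w \<Gamma> as Q) \<longrightarrow> fm_at w \<Gamma> as R)"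
proof -
  let ?I = "Prod C \<Gamma>"
  have Qs: "\<And>Q. Q \<in> set Qs \<Longrightarrow> wf_fm \<Gamma> Q" using assms(2) by (simp add: list_all_iff)
  have I: "?I \<in> Ob C" using Prod_Ob[OF \<Gamma>] .
  note fold = forces_foldr_meet[OF I wf_fm_pred[OF \<Gamma> Qs]]
  have "holds C P \<Gamma> Qs R \<longleftrightarrow> (\<forall>w h. h \<in> Hom C (fst w) ?I \<and> snd w \<in> Preds P (fst w) \<and>
      (\<forall>Q\<in>set Qs. forces w ?I h (fm_interp C P \<Gamma> Q)) \<longrightarrow> forces w ?I h (fm_interp C P \<Gamma> R))"
    unfolding holds_def
    by (subst le_iff_forces[OF I conjunct1[OF fold] wf_fm_pred[OF \<Gamma> R]], assumption)
      (simp add: conjunct2[OF fold, of Qs "\<lambda>Q. Q"])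
  also have "\<dots> \<longleftrightarrow>
      (\<forall>w as. elements w \<Gamma> as \<longrightarrow> (\<forall>Q\<in>set Qs. fm_at w \<Gamma> as Q) \<longrightarrow> fm_at w \<Gamma> as R)" (is "?L \<longleftrightarrow> ?R")
  proof
    assume L: ?L
    show ?R
    proof (intro allI impI)
      fix w as assume as: "elements w \<Gamma> as" and "\<forall>Q\<in>set Qs. fm_at w \<Gamma> as Q"
      then have "\<forall>Q\<in>set Qs. forces w ?I (tuple C (fst w) as) (fm_interp C P \<Gamma> Q)"
        using forces_fm_iff[OF as Qs] by blast
      moreover have "snd w \<in> Preds P (fst w)" using as by (simp add: elements_def)
      ultimately have "forces w ?I (tuple C (fst w) as) (fm_interp C P \<Gamma> R)"
        using L elements_tuple(1)[OF as] by blast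
      then show "fm_at w \<Gamma> as R" using forces_fm_iff[OF as R] by blast
    qed
  next
    assume R': ?R
    show ?L
    proof (intro allI impI, elim conjE)
      fix w h assume h: "h \<in> Hom C (fst w) ?I" and w: "snd w \<in> Preds P (fst w)"
        and hQs: "\<forall>Q\<in>set Qs. forces w ?I h (fm_interp C P \<Gamma> Q)"
      obtain as where as: "elements w \<Gamma> as" "h = tuple C (fst w) as"
        using elements_of_arrow[OF \<Gamma> h w] by blast
      have "\<forall>Q\<in>set Qs. fm_at w \<Gamma> as Q"
        using hQs forces_fm_iff[OF as(1) Qs] as(2) by blast
      then have "fm_at w \<Gamma> as R" using R' as(1) by blast
      then show "forces w ?I h (fm_interp C P \<Gamma> R)" using forces_fm_iff[OF as(1) R] as(2) by blast
    qed
  qed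
  finally show ?thesis .
qed

section \<open>Binary predicates\<close>

lemma elements_Nil: "elements w [] as \<longleftrightarrow> as = [] \<and> fst w \<in> Ob C \<and> snd w \<in> Preds P (fst w)"
  by (auto simp: elements_def)

lemma elements_Cons:
  "elements w (A # \<Gamma>) as \<longleftrightarrow> (\<exists>a as'. as = a # as' \<and> a \<in> Hom C (fst w) A \<and> elements w \<Gamma> as')"
  using Hom_Ob(2)[of _ "fst w" A] by (fastforce simp: elements_def list_all2_Cons2)

text \<open>Oriented so that the simplifier replaces a quantifier over lists of elements by one quantifier for
  each variable of a concrete context.\<close>

lemma all_elements_Cons:
  "(\<forall>as. elements w (A # \<Gamma>) as \<longrightarrow> Q as) \<longleftrightarrow>
    (\<forall>a \<in> Hom C (fst w) A. \<forall>as. elements w \<Gamma> as \<longrightarrow> Q (a # as))"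
  by (auto simp: elements_Cons)

lemma ex_elements_Nil: "Ex (elements w []) \<longleftrightarrow> fst w \<in> Ob C \<and> snd w \<in> Preds P (fst w)"
  by (auto simp: elements_Nil)

lemma satD:
  assumes "sat w A B \<phi> a b"
  shows "a \<in> Hom C (fst w) A" "b \<in> Hom C (fst w) B" "\<phi> \<in> Preds P (Prod C [A, B])"
    "fst w \<in> Ob C" "snd w \<in> Preds P (fst w)"
  using assms by (auto simp: sat_def forces_def elements_Cons elements_Nil)

lemma sat_mono:
  assumes c: "covers w e w'" and s: "sat w A B \<phi> a b"
  shows "sat w' A B \<phi> (a \<cdot>\<^bsub>C\<^esub> e) (b \<cdot>\<^bsub>C\<^esub> e)"
proof -
  have el: "elements w [A, B] [a, b]" using s by (simp add: sat_def)
  show ?thesis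
    using forces_mono[OF c, of _ "tuple C (fst w) [a, b]" \<phi>] s elements_restrict[OF el c]
      elements_tuple(4)[OF el covers_Hom[OF c]]
    unfolding sat_def by simp
qed

lemma sat_local:
  assumes c: "covers w e w'" and s: "sat w' A B \<phi> (a \<cdot>\<^bsub>C\<^esub> e) (b \<cdot>\<^bsub>C\<^esub> e)"
    and a: "a \<in> Hom C (fst w) A" and b: "b \<in> Hom C (fst w) B"
  shows "sat w A B \<phi> a b"
proof -
  have el: "elements w [A, B] [a, b]"
    using a b c Hom_Ob[OF a] by (auto simp: elements_Cons elements_Nil covers_def)
  show ?thesis
    using forces_local[OF c _ elements_tuple(1)[OF el]] s el
      elements_tuple(4)[OF el covers_Hom[OF c]]
    by (auto simp: sat_def)
qed

text \<open>Extensionality, which turns equations between composites of functional relations into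
  equivalences of forcing.\<close>

lemma pred2_eqI:
  assumes A: "A \<in> Ob C" and B: "B \<in> Ob C"
    and \<phi>: "\<phi> \<in> Preds P (Prod C [A, B])" and \<psi>: "\<psi> \<in> Preds P (Prod C [A, B])"
    and eq: "\<And>w a b. sat w A B \<phi> a b \<longleftrightarrow> sat w A B \<psi> a b"
  shows "\<phi> = \<psi>"
proof (rule pred_eqI[OF _ \<phi> \<psi>])
  have AB: "set [A, B] \<subseteq> Ob C" using A B by simp
  show "Prod C [A, B] \<in> Ob C" using Prod_Ob[OF AB] .
  show "forces w (Prod C [A, B]) h \<phi> \<longleftrightarrow> forces w (Prod C [A, B]) h \<psi>" for w h
  proof (cases "h \<in> Hom C (fst w) (Prod C [A, B]) \<and> snd w \<in> Preds P (fst w)")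
    case True
    then obtain as where as: "elements w [A, B] as" "h = tuple C (fst w) as"
      using elements_of_arrow[OF AB] by blast
    then obtain a b where "as = [a, b]" by (auto simp: elements_Cons elements_Nil)
    then show ?thesis using eq[of w a b] as by (simp add: sat_def)
  qed (auto simp: forces_def)
qed

lemma sat_fm_interp:
  assumes "A \<in> Ob C" "B \<in> Ob C" "wf_fm [A, B] Q"
  shows "sat w A B (fm_interp C P [A, B] Q) a b \<longleftrightarrow>
    a \<in> Hom C (fst w) A \<and> b \<in> Hom C (fst w) B \<and> snd w \<in> Preds P (fst w) \<and>
    fm_at w [A, B] [a, b] Q"
  using forces_fm_iff[OF _ assms(3), of w "[a, b]"] Hom_Ob(1)[of a "fst w" A]
  by (auto simp: sat_def elements_Cons elements_Nil)

section \<open>The defining judgments in terms of forcing\<close>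

lemmas kripke_simps = all_elements_Cons ex_elements_Nil elements_Nil less_Suc_eq numeral_2_eq_2 numeral_3_eq_3

lemma is_per_iff:
  "is_per C P (A, \<rho>) \<longleftrightarrow> A \<in> Ob C \<and> \<rho> \<in> Preds P (Prod C [A, A]) \<and>
    (\<forall>w x y. sat w A A \<rho> x y \<longrightarrow> sat w A A \<rho> y x) \<and>
    (\<forall>w x y z. sat w A A \<rho> x y \<longrightarrow> sat w A A \<rho> y z \<longrightarrow> sat w A A \<rho> x z)"
proof (cases "A \<in> Ob C \<and> \<rho> \<in> Preds P (Prod C [A, A])")
  case True
  have sym: "holds C P [A, A] [Rel \<rho> [Var 0, Var 1]] (Rel \<rho> [Var 1, Var 0]) \<longleftrightarrow>
      (\<forall>w x y. sat w A A \<rho> x y \<longrightarrow> sat w A A \<rho> y x)"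
    using True by (subst holds_iff) (simp_all add: kripke_simps, meson satD)
  have trans: "holds C P [A, A, A] [Rel \<rho> [Var 0, Var 1], Rel \<rho> [Var 1, Var 2]] (Rel \<rho> [Var 0, Var 2]) \<longleftrightarrow>
      (\<forall>w x y z. sat w A A \<rho> x y \<longrightarrow> sat w A A \<rho> y z \<longrightarrow> sat w A A \<rho> x z)"
    using True by (subst holds_iff) (simp_all add: kripke_simps, meson satD)
  show ?thesis
    unfolding is_per_def Let_def prod.case sym trans by simp
qed (auto simp: is_per_def)

lemma is_tracked_map_iff:
  assumes "A \<in> Ob C" "\<rho> \<in> Preds P (Prod C [A, A])" "B \<in> Ob C" "\<sigma> \<in> Preds P (Prod C [B, B])"
  shows "is_tracked_map C P (A, \<rho>) (B, \<sigma>) f \<longleftrightarrow> f \<in> Hom C A B \<and>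
    (\<forall>w x y. sat w A A \<rho> x y \<longrightarrow> sat w B B \<sigma> (f \<cdot>\<^bsub>C\<^esub> x) (f \<cdot>\<^bsub>C\<^esub> y))"
proof (cases "f \<in> Hom C A B")
  case True
  have "holds C P [A, A] [Rel \<rho> [Var 0, Var 1]] (Rel \<sigma> [App f [Var 0], App f [Var 1]]) \<longleftrightarrow>
      (\<forall>w x y. sat w A A \<rho> x y \<longrightarrow> sat w B B \<sigma> (f \<cdot>\<^bsub>C\<^esub> x) (f \<cdot>\<^bsub>C\<^esub> y))"
    using True assms HomD(3)[OF True]
    by (subst holds_iff) (simp_all add: kripke_simps, meson satD)
  then show ?thesis unfolding is_tracked_map_def Let_def prod.case by simp
qed (auto simp: is_tracked_map_def)

lemma is_weak_equivalence_iff: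
  assumes "A \<in> Ob C" "\<rho> \<in> Preds P (Prod C [A, A])" "B \<in> Ob C" "\<sigma> \<in> Preds P (Prod C [B, B])"
    and f: "f \<in> Hom C A B"
  shows "is_weak_equivalence C P ((A, \<rho>), (B, \<sigma>), f) \<longleftrightarrow> ((A, \<rho>), (B, \<sigma>), f) \<in> Ar C\<langle>P\<rangle> \<and>
    (\<forall>w x y. sat w A A \<rho> x x \<longrightarrow> sat w B B \<sigma> (f \<cdot>\<^bsub>C\<^esub> x) (f \<cdot>\<^bsub>C\<^esub> y) \<longrightarrow> sat w A A \<rho> y y \<longrightarrow>
      sat w A A \<rho> x y) \<and>
    (\<forall>w u. sat w B B \<sigma> u u \<longrightarrow>
      (\<exists>e w' x. covers w e w' \<and> sat w' A A \<rho> x x \<and> sat w' B B \<sigma> (f \<cdot>\<^bsub>C\<^esub> x) (u \<cdot>\<^bsub>C\<^esub> e)))"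
proof -
  have inj: "holds C P [A, A] [Dia \<rho> (Var 0), Rel \<sigma> [App f [Var 0], App f [Var 1]], Dia \<rho> (Var 1)]
        (Rel \<rho> [Var 0, Var 1]) \<longleftrightarrow>
      (\<forall>w x y. sat w A A \<rho> x x \<longrightarrow> sat w B B \<sigma> (f \<cdot>\<^bsub>C\<^esub> x) (f \<cdot>\<^bsub>C\<^esub> y) \<longrightarrow> sat w A A \<rho> y y \<longrightarrow>
        sat w A A \<rho> x y)"
    using assms HomD(3)[OF f] by (subst holds_iff) (simp_all add: kripke_simps, meson satD)
  have surj: "holds C P [B] [Dia \<sigma> (Var 0)] (Exi A (Dia \<rho> (Var 1) AND Rel \<sigma> [App f [Var 1], Var 0])) \<longleftrightarrow>
      (\<forall>w u. sat w B B \<sigma> u u \<longrightarrow>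
        (\<exists>e w' x. covers w e w' \<and> sat w' A A \<rho> x x \<and> sat w' B B \<sigma> (f \<cdot>\<^bsub>C\<^esub> x) (u \<cdot>\<^bsub>C\<^esub> e)))"
    using assms HomD(3)[OF f]
    by (subst holds_iff) (simp_all add: kripke_simps, meson satD)
  show ?thesis unfolding is_weak_equivalence_def Let_def prod.case inj surj by simp
qed

lemma is_functional_relation_iff:
  assumes "A \<in> Ob C" "\<rho> \<in> Preds P (Prod C [A, A])" "B \<in> Ob C" "\<sigma> \<in> Preds P (Prod C [B, B])"
  shows "is_functional_relation C P (A, \<rho>) (B, \<sigma>) \<phi> \<longleftrightarrow> \<phi> \<in> Preds P (Prod C [A, B]) \<and>
    (\<forall>w x u. sat w A B \<phi> x u \<longrightarrow> sat w A A \<rho> x x \<and> sat w B B \<sigma> u u) \<and>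
    (\<forall>w x y u v. sat w A A \<rho> y x \<longrightarrow> sat w A B \<phi> x u \<longrightarrow> sat w B B \<sigma> u v \<longrightarrow> sat w A B \<phi> y v) \<and>
    (\<forall>w x u v. sat w A B \<phi> x u \<longrightarrow> sat w A B \<phi> x v \<longrightarrow> sat w B B \<sigma> u v) \<and>
    (\<forall>w x. sat w A A \<rho> x x \<longrightarrow> (\<exists>e w' u. covers w e w' \<and> sat w' A B \<phi> (x \<cdot>\<^bsub>C\<^esub> e) u))"
proof (cases "\<phi> \<in> Preds P (Prod C [A, B])")
  case True
  have strict: "holds C P [A, B] [Rel \<phi> [Var 0, Var 1]] (Dia \<rho> (Var 0) AND Dia \<sigma> (Var 1)) \<longleftrightarrow>
      (\<forall>w x u. sat w A B \<phi> x u \<longrightarrow> sat w A A \<rho> x x \<and> sat w B B \<sigma> u u)"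
    using True assms
    by (subst holds_iff) (simp_all add: kripke_simps, meson satD)
  have ext: "holds C P [A, A, B, B] [Rel \<rho> [Var 1, Var 0], Rel \<phi> [Var 0, Var 2], Rel \<sigma> [Var 2, Var 3]]
        (Rel \<phi> [Var 1, Var 3]) \<longleftrightarrow>
      (\<forall>w x y u v. sat w A A \<rho> y x \<longrightarrow> sat w A B \<phi> x u \<longrightarrow> sat w B B \<sigma> u v \<longrightarrow> sat w A B \<phi> y v)"
    using True assms by (subst holds_iff) (simp_all add: kripke_simps, meson satD)
  have single: "holds C P [A, B, B] [Rel \<phi> [Var 0, Var 1], Rel \<phi> [Var 0, Var 2]] (Rel \<sigma> [Var 1, Var 2]) \<longleftrightarrow>
      (\<forall>w x u v. sat w A B \<phi> x u \<longrightarrow> sat w A B \<phi> x v \<longrightarrow> sat w B B \<sigma> u v)"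
    using True assms by (subst holds_iff) (simp_all add: kripke_simps, meson satD)
  have total: "holds C P [A] [Dia \<rho> (Var 0)] (Exi B (Rel \<phi> [Var 0, Var 1])) \<longleftrightarrow>
      (\<forall>w x. sat w A A \<rho> x x \<longrightarrow> (\<exists>e w' u. covers w e w' \<and> sat w' A B \<phi> (x \<cdot>\<^bsub>C\<^esub> e) u))"
    using True assms by (subst holds_iff) (simp_all add: kripke_simps, meson satD)
  show ?thesis
    unfolding is_functional_relation_def Let_def prod.case strict ext single total by simp
qed (auto simp: is_functional_relation_def)

lemma graph_pred_sat:
  assumes "A \<in> Ob C" "\<rho> \<in> Preds P (Prod C [A, A])" "B \<in> Ob C" "\<sigma> \<in> Preds P (Prod C [B, B])"
    and f: "f \<in> Hom C A B"
  shows "graph C P (A, \<rho>) (B, \<sigma>) f \<in> Preds P (Prod C [A, B])"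
    and "sat w A B (graph C P (A, \<rho>) (B, \<sigma>) f) x u \<longleftrightarrow>
      sat w A A \<rho> x x \<and> sat w B B \<sigma> (f \<cdot>\<^bsub>C\<^esub> x) u"
proof -
  let ?Q = "Dia \<rho> (Var 0) AND Rel \<sigma> [App f [Var 0], Var 1]"
  have wf: "wf_fm [A, B] ?Q" using assms HomD(3)[OF f] by simp
  have graph: "graph C P (A, \<rho>) (B, \<sigma>) f = fm_interp C P [A, B] ?Q"
    by (simp add: graph_def Let_def)
  show "graph C P (A, \<rho>) (B, \<sigma>) f \<in> Preds P (Prod C [A, B])"
    unfolding graph by (rule wf_fm_pred[OF _ wf]) (use assms in simp)
  show "sat w A B (graph C P (A, \<rho>) (B, \<sigma>) f) x u \<longleftrightarrow>
      sat w A A \<rho> x x \<and> sat w B B \<sigma> (f \<cdot>\<^bsub>C\<^esub> x) u"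
    unfolding graph sat_fm_interp[OF assms(1,3) wf]
    using HomD(3)[OF f] by (auto dest: satD)
qed

lemma rel_comp_pred_sat:
  assumes "A \<in> Ob C" "B \<in> Ob C" "D \<in> Ob C"
    and "\<phi> \<in> Preds P (Prod C [A, B])" "\<gamma> \<in> Preds P (Prod C [B, D])"
  shows "rel_comp C P A B D \<gamma> \<phi> \<in> Preds P (Prod C [A, D])"
    and "sat w A D (rel_comp C P A B D \<gamma> \<phi>) x r \<longleftrightarrow> x \<in> Hom C (fst w) A \<and> r \<in> Hom C (fst w) D \<and>
      (\<exists>e w' u. covers w e w' \<and> sat w' A B \<phi> (x \<cdot>\<^bsub>C\<^esub> e) u \<and> sat w' B D \<gamma> u (r \<cdot>\<^bsub>C\<^esub> e))"
proof -
  let ?Q = "Exi B (Rel \<phi> [Var 0, Var 2] AND Rel \<gamma> [Var 2, Var 1])"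
  have wf: "wf_fm [A, D] ?Q" using assms by simp
  have comp: "rel_comp C P A B D \<gamma> \<phi> = fm_interp C P [A, D] ?Q"
    by (simp add: rel_comp_def Let_def)
  show "rel_comp C P A B D \<gamma> \<phi> \<in> Preds P (Prod C [A, D])"
    unfolding comp by (rule wf_fm_pred[OF _ wf]) (use assms in simp)
  show "sat w A D (rel_comp C P A B D \<gamma> \<phi>) x r \<longleftrightarrow> x \<in> Hom C (fst w) A \<and> r \<in> Hom C (fst w) D \<and>
      (\<exists>e w' u. covers w e w' \<and> sat w' A B \<phi> (x \<cdot>\<^bsub>C\<^esub> e) u \<and> sat w' B D \<gamma> u (r \<cdot>\<^bsub>C\<^esub> e))"
    unfolding comp sat_fm_interp[OF assms(1,3) wf]
    by (simp add: numeral_2_eq_2) (meson satD(2) covers_def)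
qed

section \<open>Functional relations and their composition\<close>

abbreviation eqv :: "'o \<times> 'p \<Rightarrow> 'o \<times> 'p \<Rightarrow> 'm \<Rightarrow> 'm \<Rightarrow> bool" where
  "eqv w X \<equiv> sat w (fst X) (fst X) (snd X)"

abbreviation related :: "'o \<times> 'p \<Rightarrow> 'o \<times> 'p \<Rightarrow> 'o \<times> 'p \<Rightarrow> 'p \<Rightarrow> 'm \<Rightarrow> 'm \<Rightarrow> bool" where
  "related w X Y \<equiv> sat w (fst X) (fst Y)"

lemma perD:
  assumes "is_per C P X"
  shows "fst X \<in> Ob C" "snd X \<in> Preds P (Prod C [fst X, fst X])"
    and per_sym: "eqv w X x y \<Longrightarrow> eqv w X y x"
    and per_trans: "eqv w X x y \<Longrightarrow> eqv w X y z \<Longrightarrow> eqv w X x z"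
    and per_refl: "eqv w X x y \<Longrightarrow> eqv w X x x"
    and per_refl': "eqv w X x y \<Longrightarrow> eqv w X y y"
proof -
  have per: "is_per C P (fst X, snd X)" using assms by simp
  note * = per[unfolded is_per_iff]
  show "fst X \<in> Ob C" "snd X \<in> Preds P (Prod C [fst X, fst X])"
    by (rule *[THEN conjunct1] *[THEN conjunct2, THEN conjunct1])+
  note sym = *[THEN conjunct2, THEN conjunct2, THEN conjunct1, rule_format]
    and trans = *[THEN conjunct2, THEN conjunct2, THEN conjunct2, rule_format]
  show "eqv w X x y \<Longrightarrow> eqv w X y x" by (rule sym)
  show "eqv w X x y \<Longrightarrow> eqv w X y z \<Longrightarrow> eqv w X x z" by (rule trans)
  show "eqv w X x y \<Longrightarrow> eqv w X x x" using trans[OF _ sym] .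
  show "eqv w X x y \<Longrightarrow> eqv w X y y" using trans[OF sym] .
qed

lemma trackedD:
  assumes "is_per C P X" "is_per C P Y" "is_tracked_map C P X Y f"
  shows "f \<in> Hom C (fst X) (fst Y)"
    and "eqv w X x y \<Longrightarrow> eqv w Y (f \<cdot>\<^bsub>C\<^esub> x) (f \<cdot>\<^bsub>C\<^esub> y)"
  using assms(3) is_tracked_map_iff[OF perD(1,2)[OF assms(1)] perD(1,2)[OF assms(2)], of f] by simp_all

lemma trackedI:
  assumes "is_per C P X" "is_per C P Y" "f \<in> Hom C (fst X) (fst Y)"
    and "\<And>w x y. eqv w X x y \<Longrightarrow> eqv w Y (f \<cdot>\<^bsub>C\<^esub> x) (f \<cdot>\<^bsub>C\<^esub> y)"
  shows "is_tracked_map C P X Y f"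
  using assms(3,4) is_tracked_map_iff[OF perD(1,2)[OF assms(1)] perD(1,2)[OF assms(2)], of f] by simp

text \<open>Unlike \<open>is_functional_relation\<close>, this includes that both ends are partial equivalence relations.\<close>

definition funrel :: "'o \<times> 'p \<Rightarrow> 'o \<times> 'p \<Rightarrow> 'p \<Rightarrow> bool" where
  "funrel X Y \<phi> \<longleftrightarrow> is_per C P X \<and> is_per C P Y \<and> is_functional_relation C P X Y \<phi>"

lemma funrelD:
  assumes "funrel X Y \<phi>"
  shows "is_per C P X" "is_per C P Y" "\<phi> \<in> Preds P (Prod C [fst X, fst Y])"
    and funrel_dom: "related w X Y \<phi> x u \<Longrightarrow> eqv w X x x"
    and funrel_cod: "related w X Y \<phi> x u \<Longrightarrow> eqv w Y u u"
    and funrel_ext: "eqv w X y x \<Longrightarrow> related w X Y \<phi> x u \<Longrightarrow> eqv w Y u v \<Longrightarrow> related w X Y \<phi> y v"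
    and funrel_fun: "related w X Y \<phi> x u \<Longrightarrow> related w X Y \<phi> x v \<Longrightarrow> eqv w Y u v"
    and funrel_total: "eqv w X x x \<Longrightarrow> \<exists>e w' u. covers w e w' \<and> related w' X Y \<phi> (x \<cdot>\<^bsub>C\<^esub> e) u"
proof -
  show X: "is_per C P X" and Y: "is_per C P Y" using assms by (auto simp: funrel_def)
  note * = is_functional_relation_iff[OF perD(1,2)[OF X] perD(1,2)[OF Y], of \<phi>]
  have "is_functional_relation C P (fst X, snd X) (fst Y, snd Y) \<phi>"
    using assms by (simp add: funrel_def)
  note ** = this[unfolded *]
  show "\<phi> \<in> Preds P (Prod C [fst X, fst Y])" using ** by (rule conjunct1)
  note dom = **[THEN conjunct2, THEN conjunct1, rule_format]
    and ext = **[THEN conjunct2, THEN conjunct2, THEN conjunct1, rule_format]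
    and single = **[THEN conjunct2, THEN conjunct2, THEN conjunct2, THEN conjunct1, rule_format]
    and total = **[THEN conjunct2, THEN conjunct2, THEN conjunct2, THEN conjunct2, rule_format]
  show "related w X Y \<phi> x u \<Longrightarrow> eqv w X x x" "related w X Y \<phi> x u \<Longrightarrow> eqv w Y u u"
    by (erule dom[THEN conjunct1] dom[THEN conjunct2])+
  show "eqv w X y x \<Longrightarrow> related w X Y \<phi> x u \<Longrightarrow> eqv w Y u v \<Longrightarrow> related w X Y \<phi> y v"
    by (rule ext)
  show "related w X Y \<phi> x u \<Longrightarrow> related w X Y \<phi> x v \<Longrightarrow> eqv w Y u v"
    by (rule single)
  show "eqv w X x x \<Longrightarrow> \<exists>e w' u. covers w e w' \<and> related w' X Y \<phi> (x \<cdot>\<^bsub>C\<^esub> e) u"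
    by (rule total)
qed

lemma funrelI:
  assumes X: "is_per C P X" and Y: "is_per C P Y" and "\<phi> \<in> Preds P (Prod C [fst X, fst Y])"
    and "\<And>w x u. related w X Y \<phi> x u \<Longrightarrow> eqv w X x x \<and> eqv w Y u u"
    and "\<And>w x y u v. eqv w X y x \<Longrightarrow> related w X Y \<phi> x u \<Longrightarrow> eqv w Y u v \<Longrightarrow> related w X Y \<phi> y v"
    and "\<And>w x u v. related w X Y \<phi> x u \<Longrightarrow> related w X Y \<phi> x v \<Longrightarrow> eqv w Y u v"
    and "\<And>w x. eqv w X x x \<Longrightarrow> \<exists>e w' u. covers w e w' \<and> related w' X Y \<phi> (x \<cdot>\<^bsub>C\<^esub> e) u"
  shows "funrel X Y \<phi>"
proof -
  have "is_functional_relation C P (fst X, snd X) (fst Y, snd Y) \<phi>"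
    unfolding is_functional_relation_iff[OF perD(1,2)[OF X] perD(1,2)[OF Y]]
    by (intro conjI allI impI assms(3))
      (erule assms(4)[THEN conjunct1] assms(4)[THEN conjunct2] assms(5) assms(6) assms(7); assumption)+
  then show ?thesis using X Y by (simp add: funrel_def)
qed

lemma per_pred_eqI:
  assumes "is_per C P X" "is_per C P Y"
    and "\<phi> \<in> Preds P (Prod C [fst X, fst Y])" "\<psi> \<in> Preds P (Prod C [fst X, fst Y])"
    and "\<And>w x u. related w X Y \<phi> x u \<Longrightarrow> related w X Y \<psi> x u"
    and "\<And>w x u. related w X Y \<psi> x u \<Longrightarrow> related w X Y \<phi> x u"
  shows "\<phi> = \<psi>"
  using assms(5,6) by (intro pred2_eqI[OF perD(1)[OF assms(1)] perD(1)[OF assms(2)] assms(3,4)]) blast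

lemma graphD:
  assumes "is_per C P X" "is_per C P Y" "is_tracked_map C P X Y f"
  shows "graph C P X Y f \<in> Preds P (Prod C [fst X, fst Y])"
    and "related w X Y (graph C P X Y f) x u \<longleftrightarrow> eqv w X x x \<and> eqv w Y (f \<cdot>\<^bsub>C\<^esub> x) u"
  using graph_pred_sat[OF perD(1,2)[OF assms(1)] perD(1,2)[OF assms(2)] trackedD(1)[OF assms]]
  by simp_all

text \<open>An element present at the world itself is a witness on the trivial cover.\<close>

lemma covers_witness:
  assumes "sat w A A \<rho> x x" "sat w A B \<phi> x u"
  shows "\<exists>e w' u. covers w e w' \<and> sat w' A B \<phi> (x \<cdot>\<^bsub>C\<^esub> e) u"
  using assms covers_refl[OF satD(4,5)[OF assms(1)]] Ident_right[OF satD(1)[OF assms(1)]] by metis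

abbreviation comp_rel :: "'o \<times> 'p \<Rightarrow> 'o \<times> 'p \<Rightarrow> 'o \<times> 'p \<Rightarrow> 'p \<Rightarrow> 'p \<Rightarrow> 'p" where
  "comp_rel X Y Z \<gamma> \<phi> \<equiv> rel_comp C P (fst X) (fst Y) (fst Z) \<gamma> \<phi>"

lemma comp_rel_pred:
  assumes "funrel X Y \<phi>" "funrel Y Z \<gamma>"
  shows "comp_rel X Y Z \<gamma> \<phi> \<in> Preds P (Prod C [fst X, fst Z])"
  using rel_comp_pred_sat(1) perD(1) funrelD(1-3)[OF assms(1)] funrelD(1-3)[OF assms(2)] by simp

lemma comp_relD:
  assumes "funrel X Y \<phi>" "funrel Y Z \<gamma>" "related w X Z (comp_rel X Y Z \<gamma> \<phi>) x r"
  obtains e w' u where "covers w e w'" "related w' X Y \<phi> (x \<cdot>\<^bsub>C\<^esub> e) u" "related w' Y Z \<gamma> u (r \<cdot>\<^bsub>C\<^esub> e)"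
  using assms(3) rel_comp_pred_sat(2)[OF perD(1)[OF funrelD(1)[OF assms(1)]]
      perD(1)[OF funrelD(2)[OF assms(1)]] perD(1)[OF funrelD(2)[OF assms(2)]]
      funrelD(3)[OF assms(1)] funrelD(3)[OF assms(2)], of w x r] by blast

text \<open>Elimination of the existential in a composite. Since the goal is itself a forcing statement, it may
  be proved on the cover that carries the middle element.\<close>

lemma comp_relE:
  assumes "funrel X Y \<phi>" "funrel Y Z \<gamma>" "related w X Z (comp_rel X Y Z \<gamma> \<phi>) x r"
    and "a \<in> Hom C (fst w) A" "b \<in> Hom C (fst w) B"
    and "\<And>e w' u. covers w e w' \<Longrightarrow> related w' X Y \<phi> (x \<cdot>\<^bsub>C\<^esub> e) u \<Longrightarrow>
      related w' Y Z \<gamma> u (r \<cdot>\<^bsub>C\<^esub> e) \<Longrightarrow> sat w' A B \<theta> (a \<cdot>\<^bsub>C\<^esub> e) (b \<cdot>\<^bsub>C\<^esub> e)"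
  shows "sat w A B \<theta> a b"
proof -
  obtain e w' u where c: "covers w e w'" and "related w' X Y \<phi> (x \<cdot>\<^bsub>C\<^esub> e) u"
    and "related w' Y Z \<gamma> u (r \<cdot>\<^bsub>C\<^esub> e)"
    using comp_relD[OF assms(1-3)] .
  then show ?thesis using sat_local[OF c assms(6) assms(4,5)] by blast
qed

lemma comp_relI:
  assumes \<phi>: "funrel X Y \<phi>" and \<gamma>: "funrel Y Z \<gamma>"
    and xu: "related w X Y \<phi> x u" and ur: "related w Y Z \<gamma> u r"
  shows "related w X Z (comp_rel X Y Z \<gamma> \<phi>) x r"
proof -
  have "covers w (Ident C (fst w)) w" using covers_refl[OF satD(4,5)[OF xu]] .
  moreover have "x \<cdot>\<^bsub>C\<^esub> Ident C (fst w) = x" "r \<cdot>\<^bsub>C\<^esub> Ident C (fst w) = r"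
    using Ident_right satD(1)[OF xu] satD(2)[OF ur] by auto
  ultimately show ?thesis
    using xu ur satD(1)[OF xu] satD(2)[OF ur]
      rel_comp_pred_sat(2)[OF perD(1)[OF funrelD(1)[OF \<phi>]]
        perD(1)[OF funrelD(2)[OF \<phi>]] perD(1)[OF funrelD(2)[OF \<gamma>]]
        funrelD(3)[OF \<phi>] funrelD(3)[OF \<gamma>], of w x r] by metis
qed

text \<open>The composite is total by composing two covers, one for each existential. The other conditions conclude
  with a forcing statement, which may be checked on the covers where the middle elements live.\<close>

lemma funrel_comp:
  assumes \<phi>: "funrel X Y \<phi>" and \<gamma>: "funrel Y Z \<gamma>"
  shows "funrel X Z (comp_rel X Y Z \<gamma> \<phi>)" (is "funrel X Z ?\<theta>")
proof (rule funrelI)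
  show X: "is_per C P X" and Z: "is_per C P Z" using funrelD(1,2) \<phi> \<gamma> by auto
  show "?\<theta> \<in> Preds P (Prod C [fst X, fst Z])" using comp_rel_pred[OF \<phi> \<gamma>] .
next
  fix w x r assume xr: "related w X Z ?\<theta> x r"
  note elim = comp_relE[OF \<phi> \<gamma> xr]
  have "eqv w X x x"
    by (rule elim[OF satD(1)[OF xr] satD(1)[OF xr]]) (rule funrel_dom[OF \<phi>])
  moreover have "eqv w Z r r"
    by (rule elim[OF satD(2)[OF xr] satD(2)[OF xr]]) (rule funrel_cod[OF \<gamma>])
  ultimately show "eqv w X x x \<and> eqv w Z r r" ..
next
  fix w x y r s assume yx: "eqv w X y x" and xr: "related w X Z ?\<theta> x r" and rs: "eqv w Z r s"
  show "related w X Z ?\<theta> y s"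
  proof (rule comp_relE[OF \<phi> \<gamma> xr satD(1)[OF yx] satD(2)[OF rs]])
    fix e w' u assume c: "covers w e w'" and xu: "related w' X Y \<phi> (x \<cdot>\<^bsub>C\<^esub> e) u"
      and ur: "related w' Y Z \<gamma> u (r \<cdot>\<^bsub>C\<^esub> e)"
    show "related w' X Z ?\<theta> (y \<cdot>\<^bsub>C\<^esub> e) (s \<cdot>\<^bsub>C\<^esub> e)"
      using comp_relI[OF \<phi> \<gamma> funrel_ext[OF \<phi> sat_mono[OF c yx] xu funrel_cod[OF \<phi> xu]]
          funrel_ext[OF \<gamma> funrel_dom[OF \<gamma> ur] ur sat_mono[OF c rs]]] .
  qed
next
  fix w x r s assume xr: "related w X Z ?\<theta> x r" and xs: "related w X Z ?\<theta> x s"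
  show "eqv w Z r s"
  proof (rule comp_relE[OF \<phi> \<gamma> xr satD(2)[OF xr] satD(2)[OF xs]])
    fix e w' u assume c: "covers w e w'" and xu: "related w' X Y \<phi> (x \<cdot>\<^bsub>C\<^esub> e) u"
      and ur: "related w' Y Z \<gamma> u (r \<cdot>\<^bsub>C\<^esub> e)"
    note xs' = sat_mono[OF c xs]
    show "eqv w' Z (r \<cdot>\<^bsub>C\<^esub> e) (s \<cdot>\<^bsub>C\<^esub> e)"
    proof (rule comp_relE[OF \<phi> \<gamma> xs' satD(2)[OF ur] satD(2)[OF xs']])
      fix e' w'' v assume c': "covers w' e' w''" and xv: "related w'' X Y \<phi> (x \<cdot>\<^bsub>C\<^esub> e \<cdot>\<^bsub>C\<^esub> e') v"
        and vs: "related w'' Y Z \<gamma> v (s \<cdot>\<^bsub>C\<^esub> e \<cdot>\<^bsub>C\<^esub> e')"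
      note xu' = sat_mono[OF c' xu] and ur' = sat_mono[OF c' ur]
      have "related w'' Y Z \<gamma> v (r \<cdot>\<^bsub>C\<^esub> e \<cdot>\<^bsub>C\<^esub> e')"
        using funrel_ext[OF \<gamma> funrel_fun[OF \<phi> xv xu'] ur' funrel_cod[OF \<gamma> ur']] .
      then show "eqv w'' Z (r \<cdot>\<^bsub>C\<^esub> e \<cdot>\<^bsub>C\<^esub> e') (s \<cdot>\<^bsub>C\<^esub> e \<cdot>\<^bsub>C\<^esub> e')"
        using funrel_fun[OF \<gamma> _ vs] by blast
    qed
  qed
next
  fix w x assume x: "eqv w X x x"
  obtain e w' u where c: "covers w e w'" and xu: "related w' X Y \<phi> (x \<cdot>\<^bsub>C\<^esub> e) u"
    using funrel_total[OF \<phi> x] by blast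
  obtain e' w'' r where c': "covers w' e' w''" and ur: "related w'' Y Z \<gamma> (u \<cdot>\<^bsub>C\<^esub> e') r"
    using funrel_total[OF \<gamma> funrel_cod[OF \<phi> xu]] by blast
  have "related w'' X Z ?\<theta> (x \<cdot>\<^bsub>C\<^esub> (e \<cdot>\<^bsub>C\<^esub> e')) r"
    using comp_relI[OF \<phi> \<gamma> sat_mono[OF c' xu] ur]
      Cmp_assoc[OF covers_Hom[OF c'] covers_Hom[OF c] satD(1)[OF x]] by simp
  then show "\<exists>e w' r. covers w e w' \<and> related w' X Z ?\<theta> (x \<cdot>\<^bsub>C\<^esub> e) r"
    using covers_comp[OF c c'] by blast
qed

lemma funrel_Ident:
  assumes X: "is_per C P X"
  shows "funrel X X (snd X)"
proof (rule funrelI[OF X X perD(2)[OF X]])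
  show "eqv w X x x \<and> eqv w X u u" if "eqv w X x u" for w x u
    using per_refl[OF X that] per_refl'[OF X that] ..
  show "eqv w X y v" if "eqv w X y x" "eqv w X x u" "eqv w X u v" for w x y u v
    using per_trans[OF X per_trans[OF X that(1,2)] that(3)] .
  show "eqv w X u v" if "eqv w X x u" "eqv w X x v" for w x u v
    using per_trans[OF X per_sym[OF X that(1)] that(2)] .
  show "\<exists>e w' u. covers w e w' \<and> eqv w' X (x \<cdot>\<^bsub>C\<^esub> e) u" if "eqv w X x x" for w x
    using covers_witness[OF that that] .
qed

lemma comp_rel_Ident:
  assumes \<phi>: "funrel X Y \<phi>"
  shows "comp_rel X X Y \<phi> (snd X) = \<phi>" and "comp_rel X Y Y (snd Y) \<phi> = \<phi>"
proof -
  note X = funrelD(1)[OF \<phi>] and Y = funrelD(2)[OF \<phi>] and p = funrelD(3)[OF \<phi>]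
  note iX = funrel_Ident[OF X] and iY = funrel_Ident[OF Y]
  show "comp_rel X X Y \<phi> (snd X) = \<phi>"
  proof (rule per_pred_eqI[OF X Y comp_rel_pred[OF iX \<phi>] p])
    fix w x u assume xu: "related w X Y (comp_rel X X Y \<phi> (snd X)) x u"
    show "related w X Y \<phi> x u"
      by (rule comp_relE[OF iX \<phi> xu satD(1,2)[OF xu]]) (rule funrel_ext[OF \<phi> _ _ funrel_cod[OF \<phi>]])
  next
    fix w x u assume xu: "related w X Y \<phi> x u"
    show "related w X Y (comp_rel X X Y \<phi> (snd X)) x u"
      using comp_relI[OF iX \<phi> funrel_dom[OF \<phi> xu] xu] .
  qed
  show "comp_rel X Y Y (snd Y) \<phi> = \<phi>"
  proof (rule per_pred_eqI[OF X Y comp_rel_pred[OF \<phi> iY] p])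
    fix w x u assume xu: "related w X Y (comp_rel X Y Y (snd Y) \<phi>) x u"
    show "related w X Y \<phi> x u"
      by (rule comp_relE[OF \<phi> iY xu satD(1,2)[OF xu]]) (rule funrel_ext[OF \<phi> funrel_dom[OF \<phi>]])
  next
    fix w x u assume xu: "related w X Y \<phi> x u"
    show "related w X Y (comp_rel X Y Y (snd Y) \<phi>) x u"
      using comp_relI[OF \<phi> iY xu funrel_cod[OF \<phi> xu]] .
  qed
qed

lemma comp_rel_assoc:
  assumes \<phi>: "funrel X Y \<phi>" and \<gamma>: "funrel Y Z \<gamma>" and \<delta>: "funrel Z W \<delta>"
  shows "comp_rel X Y W (comp_rel Y Z W \<delta> \<gamma>) \<phi> = comp_rel X Z W \<delta> (comp_rel X Y Z \<gamma> \<phi>)"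
proof -
  note \<gamma>\<phi> = funrel_comp[OF \<phi> \<gamma>] and \<delta>\<gamma> = funrel_comp[OF \<gamma> \<delta>]
  show ?thesis
  proof (rule per_pred_eqI[OF funrelD(1)[OF \<phi>] funrelD(2)[OF \<delta>]
        comp_rel_pred[OF \<phi> \<delta>\<gamma>] comp_rel_pred[OF \<gamma>\<phi> \<delta>]])
    fix w x s assume xs: "related w X W (comp_rel X Y W (comp_rel Y Z W \<delta> \<gamma>) \<phi>) x s"
    show "related w X W (comp_rel X Z W \<delta> (comp_rel X Y Z \<gamma> \<phi>)) x s"
    proof (rule comp_relE[OF \<phi> \<delta>\<gamma> xs satD(1,2)[OF xs]])
      fix e w' u assume xu: "related w' X Y \<phi> (x \<cdot>\<^bsub>C\<^esub> e) u"
        and us: "related w' Y W (comp_rel Y Z W \<delta> \<gamma>) u (s \<cdot>\<^bsub>C\<^esub> e)"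
      show "related w' X W (comp_rel X Z W \<delta> (comp_rel X Y Z \<gamma> \<phi>)) (x \<cdot>\<^bsub>C\<^esub> e) (s \<cdot>\<^bsub>C\<^esub> e)"
        by (rule comp_relE[OF \<gamma> \<delta> us satD(1)[OF xu] satD(2)[OF us]])
          (rule comp_relI[OF \<gamma>\<phi> \<delta> comp_relI[OF \<phi> \<gamma> sat_mono[OF _ xu]]])
    qed
  next
    fix w x s assume xs: "related w X W (comp_rel X Z W \<delta> (comp_rel X Y Z \<gamma> \<phi>)) x s"
    show "related w X W (comp_rel X Y W (comp_rel Y Z W \<delta> \<gamma>) \<phi>) x s"
    proof (rule comp_relE[OF \<gamma>\<phi> \<delta> xs satD(1,2)[OF xs]])
      fix e w' r assume xr: "related w' X Z (comp_rel X Y Z \<gamma> \<phi>) (x \<cdot>\<^bsub>C\<^esub> e) r"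
        and rs: "related w' Z W \<delta> r (s \<cdot>\<^bsub>C\<^esub> e)"
      show "related w' X W (comp_rel X Y W (comp_rel Y Z W \<delta> \<gamma>) \<phi>) (x \<cdot>\<^bsub>C\<^esub> e) (s \<cdot>\<^bsub>C\<^esub> e)"
        by (rule comp_relE[OF \<phi> \<gamma> xr satD(1)[OF xr] satD(2)[OF rs]])
          (rule comp_relI[OF \<phi> \<delta>\<gamma> _ comp_relI[OF \<gamma> \<delta> _ sat_mono[OF _ rs]]])
    qed
  qed
qed

section \<open>The two categories\<close>

lemma per_cat_Hom:
  "m \<in> Hom C\<langle>P\<rangle> X Y \<longleftrightarrow>
    (\<exists>f. m = (X, Y, f) \<and> is_per C P X \<and> is_per C P Y \<and> is_tracked_map C P X Y f)"
  by (auto simp: Hom_def per_cat_def)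

lemma rel_cat_Hom: "m \<in> Hom C\<lblot>P\<rblot> X Y \<longleftrightarrow> (\<exists>\<phi>. m = (X, Y, \<phi>) \<and> funrel X Y \<phi>)"
  by (auto simp: Hom_def rel_cat_def funrel_def)

lemma cat_simps:
  "Ob C\<langle>P\<rangle> = {X. is_per C P X}" "Ob C\<lblot>P\<rblot> = {X. is_per C P X}"
  "Ident C\<langle>P\<rangle> X = (X, X, Ident C (fst X))" "Ident C\<lblot>P\<rblot> X = (X, X, snd X)"
  "(Y', Z, g) \<cdot>\<^bsub>C\<langle>P\<rangle>\<^esub> (X, Y, f) = (X, Z, g \<cdot>\<^bsub>C\<^esub> f)"
  "(Y', Z, \<gamma>) \<cdot>\<^bsub>C\<lblot>P\<rblot>\<^esub> (X, Y, \<phi>) = (X, Z, comp_rel X Y Z \<gamma> \<phi>)"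
  "Dom C\<langle>P\<rangle> (X, Y, f) = X" "Cod C\<langle>P\<rangle> (X, Y, f) = Y"
  "Dom C\<lblot>P\<rblot> (X, Y, \<phi>) = X" "Cod C\<lblot>P\<rblot> (X, Y, \<phi>) = Y"
  "(X, Y, f) \<in> Ar C\<langle>P\<rangle> \<longleftrightarrow> is_per C P X \<and> is_per C P Y \<and> is_tracked_map C P X Y f"
  "(X, Y, \<phi>) \<in> Ar C\<lblot>P\<rblot> \<longleftrightarrow> funrel X Y \<phi>"
  by (auto simp: per_cat_def rel_cat_def funrel_def)

lemma tracked_Ident:
  assumes X: "is_per C P X"
  shows "is_tracked_map C P X X (Ident C (fst X))"
proof (rule trackedI[OF X X Ident_in[OF perD(1)[OF X]]])
  show "eqv w X (Ident C (fst X) \<cdot>\<^bsub>C\<^esub> x) (Ident C (fst X) \<cdot>\<^bsub>C\<^esub> y)" if "eqv w X x y" for w x y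
    using Ident_left[OF satD(1)[OF that]] Ident_left[OF satD(2)[OF that]] that by simp
qed

lemma tracked_Cmp:
  assumes X: "is_per C P X" and Y: "is_per C P Y" and Z: "is_per C P Z"
    and f: "is_tracked_map C P X Y f" and g: "is_tracked_map C P Y Z g"
  shows "is_tracked_map C P X Z (g \<cdot>\<^bsub>C\<^esub> f)"
proof (rule trackedI[OF X Z])
  note fH = trackedD(1)[OF X Y f] and gH = trackedD(1)[OF Y Z g]
  show "g \<cdot>\<^bsub>C\<^esub> f \<in> Hom C (fst X) (fst Z)" using Cmp_in[OF fH gH] .
  show "eqv w Z (g \<cdot>\<^bsub>C\<^esub> f \<cdot>\<^bsub>C\<^esub> x) (g \<cdot>\<^bsub>C\<^esub> f \<cdot>\<^bsub>C\<^esub> y)" if "eqv w X x y" for w x y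
    using trackedD(2)[OF Y Z g trackedD(2)[OF X Y f that]]
      Cmp_assoc[OF satD(1)[OF that] fH gH] Cmp_assoc[OF satD(2)[OF that] fH gH] by simp
qed

lemma category_per_cat: "category C\<langle>P\<rangle>"
proof
  show "Dom C\<langle>P\<rangle> f \<in> Ob C\<langle>P\<rangle>" "Cod C\<langle>P\<rangle> f \<in> Ob C\<langle>P\<rangle>" if "f \<in> Ar C\<langle>P\<rangle>" for f
    using that by (auto simp: per_cat_def)
  show "Ident C\<langle>P\<rangle> X \<in> Hom C\<langle>P\<rangle> X X" if "X \<in> Ob C\<langle>P\<rangle>" for X
    using that tracked_Ident by (simp add: per_cat_Hom cat_simps)
  fix m X Y n Z assume m: "m \<in> Hom C\<langle>P\<rangle> X Y"
  then obtain f where f: "m = (X, Y, f)" "is_per C P X" "is_per C P Y" "is_tracked_map C P X Y f"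
    by (auto simp: per_cat_Hom)
  note fH = trackedD(1)[OF f(2-4)]
  show "Ident C\<langle>P\<rangle> Y \<cdot>\<^bsub>C\<langle>P\<rangle>\<^esub> m = m" "m \<cdot>\<^bsub>C\<langle>P\<rangle>\<^esub> Ident C\<langle>P\<rangle> X = m"
    using Ident_left[OF fH] Ident_right[OF fH] by (simp_all add: f(1) cat_simps)
  assume n: "n \<in> Hom C\<langle>P\<rangle> Y Z"
  then obtain g where g: "n = (Y, Z, g)" "is_per C P Z" "is_tracked_map C P Y Z g"
    by (auto simp: per_cat_Hom)
  show "n \<cdot>\<^bsub>C\<langle>P\<rangle>\<^esub> m \<in> Hom C\<langle>P\<rangle> X Z"
    using tracked_Cmp[OF f(2,3) g(2) f(4) g(3)] f(2) g(2) by (simp add: f(1) g(1) per_cat_Hom cat_simps)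
  fix k W assume k: "k \<in> Hom C\<langle>P\<rangle> Z W"
  then obtain h where h: "k = (Z, W, h)" "is_per C P W" "is_tracked_map C P Z W h"
    by (auto simp: per_cat_Hom)
  show "k \<cdot>\<^bsub>C\<langle>P\<rangle>\<^esub> (n \<cdot>\<^bsub>C\<langle>P\<rangle>\<^esub> m) = k \<cdot>\<^bsub>C\<langle>P\<rangle>\<^esub> n \<cdot>\<^bsub>C\<langle>P\<rangle>\<^esub> m"
    using Cmp_assoc[OF fH trackedD(1)[OF f(3) g(2,3)] trackedD(1)[OF g(2) h(2,3)]]
    by (simp add: f(1) g(1) h(1) cat_simps)
qed

lemma category_rel_cat: "category C\<lblot>P\<rblot>"
proof
  show "Dom C\<lblot>P\<rblot> f \<in> Ob C\<lblot>P\<rblot>" "Cod C\<lblot>P\<rblot> f \<in> Ob C\<lblot>P\<rblot>" if "f \<in> Ar C\<lblot>P\<rblot>" for f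
    using that by (auto simp: rel_cat_def)
  show "Ident C\<lblot>P\<rblot> X \<in> Hom C\<lblot>P\<rblot> X X" if "X \<in> Ob C\<lblot>P\<rblot>" for X
    using that funrel_Ident by (simp add: rel_cat_Hom cat_simps)
  show "Ident C\<lblot>P\<rblot> Y \<cdot>\<^bsub>C\<lblot>P\<rblot>\<^esub> m = m" "m \<cdot>\<^bsub>C\<lblot>P\<rblot>\<^esub> Ident C\<lblot>P\<rblot> X = m"
    if "m \<in> Hom C\<lblot>P\<rblot> X Y" for m X Y
    using that comp_rel_Ident[of X Y] by (auto simp: rel_cat_Hom cat_simps)
  show "n \<cdot>\<^bsub>C\<lblot>P\<rblot>\<^esub> m \<in> Hom C\<lblot>P\<rblot> X Z"
    if "m \<in> Hom C\<lblot>P\<rblot> X Y" "n \<in> Hom C\<lblot>P\<rblot> Y Z" for m n X Y Z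
    using that funrel_comp[of X Y _ Z] by (auto simp: rel_cat_Hom cat_simps)
  show "k \<cdot>\<^bsub>C\<lblot>P\<rblot>\<^esub> (n \<cdot>\<^bsub>C\<lblot>P\<rblot>\<^esub> m) = k \<cdot>\<^bsub>C\<lblot>P\<rblot>\<^esub> n \<cdot>\<^bsub>C\<lblot>P\<rblot>\<^esub> m"
    if "m \<in> Hom C\<lblot>P\<rblot> X Y" "n \<in> Hom C\<lblot>P\<rblot> Y Z" "k \<in> Hom C\<lblot>P\<rblot> Z W" for m n k X Y Z W
    using that comp_rel_assoc[of X Y _ Z _ W] by (auto simp: rel_cat_Hom cat_simps)
qed

section \<open>The functor E\<close>

lemma funrel_graph:
  assumes X: "is_per C P X" and Y: "is_per C P Y" and f: "is_tracked_map C P X Y f"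
  shows "funrel X Y (graph C P X Y f)"
proof (rule funrelI[OF X Y graphD(1)[OF X Y f]], unfold graphD(2)[OF X Y f])
  show "eqv w X x x \<and> eqv w Y u u" if "eqv w X x x \<and> eqv w Y (f \<cdot>\<^bsub>C\<^esub> x) u" for w x u
    using that per_refl'[OF Y] by blast
  show "eqv w X y y \<and> eqv w Y (f \<cdot>\<^bsub>C\<^esub> y) v"
    if yx: "eqv w X y x" and xu: "eqv w X x x \<and> eqv w Y (f \<cdot>\<^bsub>C\<^esub> x) u" and uv: "eqv w Y u v"
    for w x y u v
    using per_refl[OF X yx]
      per_trans[OF Y per_trans[OF Y trackedD(2)[OF X Y f yx] conjunct2[OF xu]] uv] ..
  show "eqv w Y u v"
    if "eqv w X x x \<and> eqv w Y (f \<cdot>\<^bsub>C\<^esub> x) u" "eqv w X x x \<and> eqv w Y (f \<cdot>\<^bsub>C\<^esub> x) v" for w x u v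
    using per_trans[OF Y per_sym[OF Y conjunct2[OF that(1)]] conjunct2[OF that(2)]] .
  show "\<exists>e w' u. covers w e w' \<and> eqv w' X (x \<cdot>\<^bsub>C\<^esub> e) (x \<cdot>\<^bsub>C\<^esub> e) \<and>
      eqv w' Y (f \<cdot>\<^bsub>C\<^esub> (x \<cdot>\<^bsub>C\<^esub> e)) u" if x: "eqv w X x x" for w x
  proof -
    have "related w X Y (graph C P X Y f) x (f \<cdot>\<^bsub>C\<^esub> x)"
      unfolding graphD(2)[OF X Y f] using x trackedD(2)[OF X Y f x] ..
    from covers_witness[OF x this] show ?thesis unfolding graphD(2)[OF X Y f] .
  qed
qed

lemma graph_Ident:
  assumes X: "is_per C P X"
  shows "graph C P X X (Ident C (fst X)) = snd X"
proof (rule per_pred_eqI[OF X X graphD(1)[OF X X tracked_Ident[OF X]] perD(2)[OF X]],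
    unfold graphD(2)[OF X X tracked_Ident[OF X]])
  show "eqv w X x u" if "eqv w X x x \<and> eqv w X (Ident C (fst X) \<cdot>\<^bsub>C\<^esub> x) u" for w x u
    using that Ident_left[OF satD(1)[OF conjunct1[OF that]]] by simp
  show "eqv w X x x \<and> eqv w X (Ident C (fst X) \<cdot>\<^bsub>C\<^esub> x) u" if "eqv w X x u" for w x u
    using that per_refl[OF X that] Ident_left[OF satD(1)[OF that]] by simp
qed

text \<open>The middle element of a composite with a graph may be taken to be \<open>f x\<close>: any other choice is
  equivalent to it. This removes the existential.\<close>

lemma comp_graph:
  assumes X: "is_per C P X" and Y: "is_per C P Y" and f: "is_tracked_map C P X Y f"
    and \<gamma>: "funrel Y Z \<gamma>"
  shows "related w X Z (comp_rel X Y Z \<gamma> (graph C P X Y f)) x r \<longleftrightarrow>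
    eqv w X x x \<and> related w Y Z \<gamma> (f \<cdot>\<^bsub>C\<^esub> x) r" (is "?L \<longleftrightarrow> ?R")
proof
  note F = funrel_graph[OF X Y f] and graph = graphD(2)[OF X Y f]
  note fH = trackedD(1)[OF X Y f]
  show ?L if ?R
  proof (rule comp_relI[OF F \<gamma> _ conjunct2[OF that]])
    show "related w X Y (graph C P X Y f) x (f \<cdot>\<^bsub>C\<^esub> x)"
      unfolding graph using that trackedD(2)[OF X Y f, of w x x] by blast
  qed
  assume L: ?L
  have x: "eqv w X x x" using funrel_dom[OF funrel_comp[OF F \<gamma>] L] .
  have "related w Y Z \<gamma> (f \<cdot>\<^bsub>C\<^esub> x) r"
  proof (rule comp_relE[OF F \<gamma> L Cmp_in[OF satD(1)[OF L] fH] satD(2)[OF L]])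
    fix e w' u assume c: "covers w e w'"
      and xu: "related w' X Y (graph C P X Y f) (x \<cdot>\<^bsub>C\<^esub> e) u" and ur: "related w' Y Z \<gamma> u (r \<cdot>\<^bsub>C\<^esub> e)"
    have "related w' Y Z \<gamma> (f \<cdot>\<^bsub>C\<^esub> (x \<cdot>\<^bsub>C\<^esub> e)) (r \<cdot>\<^bsub>C\<^esub> e)"
      using funrel_ext[OF \<gamma> conjunct2[OF xu[unfolded graph]] ur funrel_cod[OF \<gamma> ur]] .
    then show "related w' Y Z \<gamma> (f \<cdot>\<^bsub>C\<^esub> x \<cdot>\<^bsub>C\<^esub> e) (r \<cdot>\<^bsub>C\<^esub> e)"
      using Cmp_assoc[OF covers_Hom[OF c] satD(1)[OF L] fH] by simp
  qed
  with x show ?R ..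
qed

lemma graph_Cmp:
  assumes X: "is_per C P X" and Y: "is_per C P Y" and Z: "is_per C P Z"
    and f: "is_tracked_map C P X Y f" and g: "is_tracked_map C P Y Z g"
  shows "graph C P X Z (g \<cdot>\<^bsub>C\<^esub> f) = comp_rel X Y Z (graph C P Y Z g) (graph C P X Y f)"
proof (rule pred2_eqI[OF perD(1)[OF X] perD(1)[OF Z]])
  note gf = tracked_Cmp[OF X Y Z f g] and F = funrel_graph[OF X Y f] and G = funrel_graph[OF Y Z g]
  show "graph C P X Z (g \<cdot>\<^bsub>C\<^esub> f) \<in> Preds P (Prod C [fst X, fst Z])" using graphD(1)[OF X Z gf] .
  show "comp_rel X Y Z (graph C P Y Z g) (graph C P X Y f) \<in> Preds P (Prod C [fst X, fst Z])"
    using comp_rel_pred[OF F G] .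
  fix w x r
  have "g \<cdot>\<^bsub>C\<^esub> f \<cdot>\<^bsub>C\<^esub> x = g \<cdot>\<^bsub>C\<^esub> (f \<cdot>\<^bsub>C\<^esub> x)" if "eqv w X x x"
    using Cmp_assoc[OF satD(1)[OF that] trackedD(1)[OF X Y f] trackedD(1)[OF Y Z g]] by simp
  then show "related w X Z (graph C P X Z (g \<cdot>\<^bsub>C\<^esub> f)) x r \<longleftrightarrow>
      related w X Z (comp_rel X Y Z (graph C P Y Z g) (graph C P X Y f)) x r"
    unfolding graphD(2)[OF X Z gf] comp_graph[OF X Y f G] graphD(2)[OF Y Z g]
    using trackedD(2)[OF X Y f, of w x x] by auto
qed

lemma E_functor_simps:
  "is_per C P X \<Longrightarrow> FOb (E_functor C P) X = X"
  "is_per C P X \<Longrightarrow> is_per C P Y \<Longrightarrow> is_tracked_map C P X Y f \<Longrightarrow>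
    FAr (E_functor C P) (X, Y, f) = (X, Y, graph C P X Y f)"
  by (simp_all add: E_functor_def cat_simps)

lemma category_functor_E: "category_functor C\<langle>P\<rangle> C\<lblot>P\<rblot> (E_functor C P)"
proof (intro category_functor.intro category_per_cat category_rel_cat category_functor_axioms.intro)
  show "FOb (E_functor C P) \<in> Ob C\<langle>P\<rangle> \<rightarrow>\<^sub>E Ob C\<lblot>P\<rblot>"
    by (simp add: E_functor_def cat_simps)
  show "FAr (E_functor C P) \<in> Ar C\<langle>P\<rangle> \<rightarrow>\<^sub>E Ar C\<lblot>P\<rblot>"
  proof (rule PiE_I)
    fix m assume "m \<in> Ar C\<langle>P\<rangle>"
    then obtain X Y f where "m = (X, Y, f)" "is_per C P X" "is_per C P Y" "is_tracked_map C P X Y f"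
      by (auto simp: per_cat_def)
    then show "FAr (E_functor C P) m \<in> Ar C\<lblot>P\<rblot>"
      using funrel_graph by (simp add: E_functor_simps cat_simps)
  qed (simp add: E_functor_def)
  show "FAr (E_functor C P) (Ident C\<langle>P\<rangle> X) = Ident C\<lblot>P\<rblot> (FOb (E_functor C P) X)"
    if "X \<in> Ob C\<langle>P\<rangle>" for X
    using that graph_Ident tracked_Ident by (simp add: cat_simps E_functor_simps)
  fix m X Y assume "m \<in> Hom C\<langle>P\<rangle> X Y"
  then obtain f where f: "m = (X, Y, f)" "is_per C P X" "is_per C P Y" "is_tracked_map C P X Y f"
    by (auto simp: per_cat_Hom)
  show "FAr (E_functor C P) m \<in> Hom C\<lblot>P\<rblot> (FOb (E_functor C P) X) (FOb (E_functor C P) Y)"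
    using f funrel_graph by (simp add: E_functor_simps rel_cat_Hom)
  fix n Z assume "n \<in> Hom C\<langle>P\<rangle> Y Z"
  then obtain g where g: "n = (Y, Z, g)" "is_per C P Z" "is_tracked_map C P Y Z g"
    by (auto simp: per_cat_Hom)
  show "FAr (E_functor C P) (n \<cdot>\<^bsub>C\<langle>P\<rangle>\<^esub> m) = FAr (E_functor C P) n \<cdot>\<^bsub>C\<lblot>P\<rblot>\<^esub> FAr (E_functor C P) m"
    using f g tracked_Cmp[OF f(2,3) g(2) f(4) g(3)] graph_Cmp[OF f(2,3) g(2) f(4) g(3)]
    by (simp add: cat_simps E_functor_simps)
qed

section \<open>Weak equivalences and isomorphisms\<close>

lemma weak_equivalence_iff:
  assumes X: "is_per C P X" and Y: "is_per C P Y" and f: "is_tracked_map C P X Y f"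
  shows "is_weak_equivalence C P (X, Y, f) \<longleftrightarrow>
    (\<forall>w x y. eqv w X x x \<longrightarrow> eqv w Y (f \<cdot>\<^bsub>C\<^esub> x) (f \<cdot>\<^bsub>C\<^esub> y) \<longrightarrow> eqv w X y y \<longrightarrow> eqv w X x y) \<and>
    (\<forall>w u. eqv w Y u u \<longrightarrow>
      (\<exists>e w' x. covers w e w' \<and> eqv w' X x x \<and> eqv w' Y (f \<cdot>\<^bsub>C\<^esub> x) (u \<cdot>\<^bsub>C\<^esub> e)))"
  using is_weak_equivalence_iff[OF perD(1,2)[OF X] perD(1,2)[OF Y] trackedD(1)[OF X Y f]] X Y f
  by (simp add: cat_simps)

text \<open>The converse is definable by interchanging the two variables.\<close>

lemma ex_converse:
  assumes "is_per C P X" "is_per C P Y" and \<phi>: "\<phi> \<in> Preds P (Prod C [fst X, fst Y])"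
  obtains \<psi> where "\<psi> \<in> Preds P (Prod C [fst Y, fst X])"
    "\<And>w x u. related w Y X \<psi> u x \<longleftrightarrow> related w X Y \<phi> x u"
proof
  note A = perD(1)[OF assms(1)] and B = perD(1)[OF assms(2)]
  let ?Q = "Rel \<phi> [Var 1, Var 0]"
  have wf: "wf_fm [fst Y, fst X] ?Q" using \<phi> by simp
  show "fm_interp C P [fst Y, fst X] ?Q \<in> Preds P (Prod C [fst Y, fst X])"
    by (rule wf_fm_pred[OF _ wf]) (simp add: A B)
  show "related w Y X (fm_interp C P [fst Y, fst X] ?Q) u x \<longleftrightarrow> related w X Y \<phi> x u" for w x u
    unfolding sat_fm_interp[OF B A wf] by (auto dest: satD)
qed

lemma weak_equivalence_imp_iso:
  assumes X: "is_per C P X" and Y: "is_per C P Y" and f: "is_tracked_map C P X Y f"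
    and weq: "is_weak_equivalence C P (X, Y, f)"
  shows "\<exists>\<psi>. funrel Y X \<psi> \<and> comp_rel X Y X \<psi> (graph C P X Y f) = snd X \<and>
    comp_rel Y X Y (graph C P X Y f) \<psi> = snd Y"
proof -
  note * = weq[unfolded weak_equivalence_iff[OF X Y f]]
  note inj = *[THEN conjunct1, rule_format] and surj = *[THEN conjunct2, rule_format]
  note F = funrel_graph[OF X Y f] and graph = graphD(2)[OF X Y f]
  note fH = trackedD(1)[OF X Y f]
  obtain \<psi> where \<psi>: "\<psi> \<in> Preds P (Prod C [fst Y, fst X])"
    and conv': "\<And>w x u. related w Y X \<psi> u x \<longleftrightarrow> related w X Y (graph C P X Y f) x u"
    using ex_converse[OF X Y graphD(1)[OF X Y f]] by blast
  have conv: "related w Y X \<psi> u x \<longleftrightarrow> eqv w X x x \<and> eqv w Y (f \<cdot>\<^bsub>C\<^esub> x) u" for w x u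
    using conv' unfolding graph .
  have G: "funrel Y X \<psi>"
  proof (rule funrelI[OF Y X \<psi>], unfold conv)
    show "eqv w Y u u \<and> eqv w X x x" if "eqv w X x x \<and> eqv w Y (f \<cdot>\<^bsub>C\<^esub> x) u" for w u x
      using that per_refl'[OF Y] by blast
    show "eqv w X y y \<and> eqv w Y (f \<cdot>\<^bsub>C\<^esub> y) v"
      if vu: "eqv w Y v u" and ux: "eqv w X x x \<and> eqv w Y (f \<cdot>\<^bsub>C\<^esub> x) u" and xy: "eqv w X x y"
      for w u v x y
      using per_refl'[OF X xy] per_trans[OF Y per_trans[OF Y trackedD(2)[OF X Y f per_sym[OF X xy]]
          conjunct2[OF ux]] per_sym[OF Y vu]] ..
    show "eqv w X x y"
      if ux: "eqv w X x x \<and> eqv w Y (f \<cdot>\<^bsub>C\<^esub> x) u" and uy: "eqv w X y y \<and> eqv w Y (f \<cdot>\<^bsub>C\<^esub> y) u" for w u x y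
      using inj[OF conjunct1[OF ux] per_trans[OF Y conjunct2[OF ux] per_sym[OF Y conjunct2[OF uy]]]
          conjunct1[OF uy]] .
    show "\<exists>e w' x. covers w e w' \<and> eqv w' X x x \<and> eqv w' Y (f \<cdot>\<^bsub>C\<^esub> x) (u \<cdot>\<^bsub>C\<^esub> e)"
      if "eqv w Y u u" for w u
      using surj[OF that] .
  qed
  have "comp_rel X Y X \<psi> (graph C P X Y f) = snd X"
  proof (rule per_pred_eqI[OF X X comp_rel_pred[OF F G] perD(2)[OF X]], unfold comp_graph[OF X Y f G] conv)
    show "eqv w X x y" if "eqv w X x x \<and> eqv w X y y \<and> eqv w Y (f \<cdot>\<^bsub>C\<^esub> y) (f \<cdot>\<^bsub>C\<^esub> x)" for w x y
    proof -
      from that have x: "eqv w X x x" and y: "eqv w X y y"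
        and yx: "eqv w Y (f \<cdot>\<^bsub>C\<^esub> y) (f \<cdot>\<^bsub>C\<^esub> x)" by auto
      show ?thesis using inj[OF x per_sym[OF Y yx] y] .
    qed
    show "eqv w X x x \<and> eqv w X y y \<and> eqv w Y (f \<cdot>\<^bsub>C\<^esub> y) (f \<cdot>\<^bsub>C\<^esub> x)" if "eqv w X x y" for w x y
      using per_refl[OF X that] per_refl'[OF X that] trackedD(2)[OF X Y f per_sym[OF X that]] by blast
  qed
  moreover have "comp_rel Y X Y (graph C P X Y f) \<psi> = snd Y"
  proof (rule per_pred_eqI[OF Y Y comp_rel_pred[OF G F] perD(2)[OF Y]])
    fix w u v assume uv: "related w Y Y (comp_rel Y X Y (graph C P X Y f) \<psi>) u v"
    show "eqv w Y u v"
      by (rule comp_relE[OF G F uv satD(1,2)[OF uv]], unfold conv graph)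
        (rule per_trans[OF Y per_sym[OF Y]], blast+)
  next
    fix w u v assume uv: "eqv w Y u v"
    show "related w Y Y (comp_rel Y X Y (graph C P X Y f) \<psi>) u v"
    proof -
      obtain e w' x where c: "covers w e w'" and x: "eqv w' X x x"
        and xu: "eqv w' Y (f \<cdot>\<^bsub>C\<^esub> x) (u \<cdot>\<^bsub>C\<^esub> e)"
        using surj[OF per_refl[OF Y uv]] by blast
      have "related w' Y X \<psi> (u \<cdot>\<^bsub>C\<^esub> e) x" unfolding conv using x xu ..
      moreover have "related w' X Y (graph C P X Y f) x (v \<cdot>\<^bsub>C\<^esub> e)"
        unfolding graph using x per_trans[OF Y xu sat_mono[OF c uv]] ..
      ultimately show ?thesis
        using sat_local[OF c comp_relI[OF G F] satD(1,2)[OF uv]] by blast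
    qed
  qed
  ultimately show ?thesis using G by blast
qed

text \<open>Since \<open>\<psi> \<circ> E f\<close> is the identity, \<open>\<psi>(f x, y)\<close> means that \<open>x\<close> and \<open>y\<close> are equivalent; extensionality of
  \<open>\<psi>\<close> in its first argument then reflects equivalence along \<open>f\<close>. The preimage of \<open>u\<close> is the middle
  element that witnesses \<open>u\<close> being related to itself by \<open>E f \<circ> \<psi>\<close>.\<close>

lemma iso_imp_weak_equivalence:
  assumes X: "is_per C P X" and Y: "is_per C P Y" and f: "is_tracked_map C P X Y f"
    and G: "funrel Y X \<psi>" and GF: "comp_rel X Y X \<psi> (graph C P X Y f) = snd X"
    and FG: "comp_rel Y X Y (graph C P X Y f) \<psi> = snd Y"
  shows "is_weak_equivalence C P (X, Y, f)"
  unfolding weak_equivalence_iff[OF X Y f]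
proof (intro conjI allI impI)
  note F = funrel_graph[OF X Y f] and graph = graphD(2)[OF X Y f]
  have eqv_X: "eqv w X x y \<longleftrightarrow> eqv w X x x \<and> related w Y X \<psi> (f \<cdot>\<^bsub>C\<^esub> x) y" for w x y
    using comp_graph[OF X Y f G] unfolding GF .
  show "eqv w X x y"
    if x: "eqv w X x x" and xy: "eqv w Y (f \<cdot>\<^bsub>C\<^esub> x) (f \<cdot>\<^bsub>C\<^esub> y)" and y: "eqv w X y y" for w x y
  proof -
    have "related w Y X \<psi> (f \<cdot>\<^bsub>C\<^esub> y) y" using eqv_X[of w y y] y by blast
    then have "related w Y X \<psi> (f \<cdot>\<^bsub>C\<^esub> x) y" using funrel_ext[OF G xy _ y] by blast
    then show ?thesis using eqv_X[of w x y] x by blast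
  qed
  show "\<exists>e w' x. covers w e w' \<and> eqv w' X x x \<and> eqv w' Y (f \<cdot>\<^bsub>C\<^esub> x) (u \<cdot>\<^bsub>C\<^esub> e)"
    if u: "eqv w Y u u" for w u
  proof -
    have "related w Y Y (comp_rel Y X Y (graph C P X Y f) \<psi>) u u" unfolding FG using u .
    from comp_relD[OF G F this] obtain e w' x where "covers w e w'"
      and "related w' X Y (graph C P X Y f) x (u \<cdot>\<^bsub>C\<^esub> e)" .
    then show ?thesis unfolding graph by blast
  qed
qed

lemma weak_equivalence_iff_iso:
  assumes m: "m \<in> Ar C\<langle>P\<rangle>"
  shows "is_weak_equivalence C P m \<longleftrightarrow> is_iso C\<lblot>P\<rblot> (FAr (E_functor C P) m)"
proof -
  obtain X Y f where f: "m = (X, Y, f)" "is_per C P X" "is_per C P Y" "is_tracked_map C P X Y f"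
    using m by (auto simp: per_cat_def)
  have Bex_Hom: "(\<exists>g \<in> Hom C\<lblot>P\<rblot> Y X. Q g) \<longleftrightarrow> (\<exists>\<psi>. funrel Y X \<psi> \<and> Q (Y, X, \<psi>))" for Q
    by (auto simp: rel_cat_Hom)
  have "is_iso C\<lblot>P\<rblot> (FAr (E_functor C P) m) \<longleftrightarrow>
      (\<exists>\<psi>. funrel Y X \<psi> \<and> comp_rel X Y X \<psi> (graph C P X Y f) = snd X \<and>
        comp_rel Y X Y (graph C P X Y f) \<psi> = snd Y)"
    using f funrel_graph[OF f(2-4)]
    by (simp add: is_iso_def E_functor_simps cat_simps Bex_Hom)
  then show ?thesis
    using weak_equivalence_imp_iso[OF f(2-4)] iso_imp_weak_equivalence[OF f(2-4)] f(1) by blast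
qed

section \<open>Spans representing a functional relation\<close>

text \<open>Only elements in the domain of \<open>H\<close>, those equivalent to themselves, have to be sent into \<open>\<phi>\<close>. For a
  functional relation \<open>\<phi>\<close> this already says that the graphs of \<open>p\<close> and \<open>q\<close> satisfy \<open>\<phi> \<circ> E p = E q\<close>.\<close>

definition is_span :: "'o \<times> 'p \<Rightarrow> 'o \<times> 'p \<Rightarrow> 'p \<Rightarrow> 'o \<times> 'p \<Rightarrow> 'm \<Rightarrow> 'm \<Rightarrow> bool" where
  "is_span X Y \<phi> H p q \<longleftrightarrow> is_per C P H \<and> is_tracked_map C P H X p \<and> is_tracked_map C P H Y q \<and>
    (\<forall>w h. eqv w H h h \<longrightarrow> related w X Y \<phi> (p \<cdot>\<^bsub>C\<^esub> h) (q \<cdot>\<^bsub>C\<^esub> h))"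

lemma span_comp_graph:
  assumes \<phi>: "funrel X Y \<phi>" and span: "is_span X Y \<phi> H p q"
  shows "comp_rel H X Y \<phi> (graph C P H X p) = graph C P H Y q"
proof -
  note X = funrelD(1)[OF \<phi>] and Y = funrelD(2)[OF \<phi>]
  have H: "is_per C P H" and p: "is_tracked_map C P H X p" and q: "is_tracked_map C P H Y q"
    and pq: "\<And>w h. eqv w H h h \<Longrightarrow> related w X Y \<phi> (p \<cdot>\<^bsub>C\<^esub> h) (q \<cdot>\<^bsub>C\<^esub> h)"
    using span unfolding is_span_def by auto
  show ?thesis
  proof (rule per_pred_eqI[OF H Y comp_rel_pred[OF funrel_graph[OF H X p] \<phi>] graphD(1)[OF H Y q]],
      unfold comp_graph[OF H X p \<phi>] graphD(2)[OF H Y q])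
    show "eqv w H h h \<and> eqv w Y (q \<cdot>\<^bsub>C\<^esub> h) u"
      if "eqv w H h h \<and> related w X Y \<phi> (p \<cdot>\<^bsub>C\<^esub> h) u" for w h u
      using that funrel_fun[OF \<phi> pq[OF conjunct1[OF that]] conjunct2[OF that]] by blast
    show "eqv w H h h \<and> related w X Y \<phi> (p \<cdot>\<^bsub>C\<^esub> h) u"
      if "eqv w H h h \<and> eqv w Y (q \<cdot>\<^bsub>C\<^esub> h) u" for w h u
    proof -
      note pqh = pq[OF conjunct1[OF that]]
      show ?thesis
        using conjunct1[OF that] funrel_ext[OF \<phi> funrel_dom[OF \<phi> pqh] pqh conjunct2[OF that]] ..
    qed
  qed
qed

text \<open>The witness is the graph of \<open>\<phi>\<close>, carried by the product: two pairs are equivalent if both lie in \<open>\<phi>\<close>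
  and their first components are equivalent. The second components are then equivalent because \<open>\<phi>\<close> is
  single-valued. The first projection reflects equivalence by construction, and it is essentially
  surjective because \<open>\<phi>\<close> is total. The factorization of another span is its pairing \<open>\<langle>p', q'\<rangle>\<close>, and the
  triangles commute in the base category, not just up to equivalence, so every functor on \<open>C\<langle>P\<rangle>\<close>
  preserves them.\<close>

lemma ex_graph_span:
  assumes \<phi>: "funrel X Y \<phi>"
  obtains G p q where "is_span X Y \<phi> G p q" "is_weak_equivalence C P (G, X, p)"
    "\<And>H p' q'. is_span X Y \<phi> H p' q' \<Longrightarrow>
      \<exists>t. is_tracked_map C P H G t \<and> p \<cdot>\<^bsub>C\<^esub> t = p' \<and> q \<cdot>\<^bsub>C\<^esub> t = q'"
proof -
  note X = funrelD(1)[OF \<phi>] and Y = funrelD(2)[OF \<phi>]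
  note A = perD(1)[OF X] and B = perD(1)[OF Y]
  let ?AB = "Prod C [fst X, fst Y]"
  define p q where "p = Proj C [fst X, fst Y] 0" and "q = Proj C [fst X, fst Y] 1"
  have AB: "set [fst X, fst Y] \<subseteq> Ob C" using A B by simp
  have AB_Ob: "?AB \<in> Ob C" using Prod_Ob[OF AB] .
  have p: "p \<in> Hom C ?AB (fst X)" and q: "q \<in> Hom C ?AB (fst Y)"
    unfolding p_def q_def using Proj_Hom[OF AB, of 0] Proj_Hom[OF AB, of 1] by simp_all
  \<comment> \<open>Asking both pairs to lie in \<open>\<phi>\<close> makes the relation visibly symmetric.\<close>
  define Q :: "('o, 'm, 'p) fm" where "Q = (Rel \<phi> [App p [Var 0], App q [Var 0]] AND
    (Rel \<phi> [App p [Var 1], App q [Var 1]] AND Rel (snd X) [App p [Var 0], App p [Var 1]]))"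
  have wf: "wf_fm [?AB, ?AB] Q"
    unfolding Q_def using p q HomD(3)[OF p] HomD(3)[OF q] funrelD(3)[OF \<phi>] perD(2)[OF X] by simp
  define G where "G = (?AB, fm_interp C P [?AB, ?AB] Q)"
  have G_pred: "fm_interp C P [?AB, ?AB] Q \<in> Preds P (Prod C [?AB, ?AB])"
    by (rule wf_fm_pred[OF _ wf]) (simp add: AB_Ob)
  have G: "eqv w G g h \<longleftrightarrow> g \<in> Hom C (fst w) ?AB \<and> h \<in> Hom C (fst w) ?AB \<and>
      related w X Y \<phi> (p \<cdot>\<^bsub>C\<^esub> g) (q \<cdot>\<^bsub>C\<^esub> g) \<and> related w X Y \<phi> (p \<cdot>\<^bsub>C\<^esub> h) (q \<cdot>\<^bsub>C\<^esub> h) \<and>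
      eqv w X (p \<cdot>\<^bsub>C\<^esub> g) (p \<cdot>\<^bsub>C\<^esub> h)" for w g h
    unfolding G_def fst_conv snd_conv sat_fm_interp[OF AB_Ob AB_Ob wf]
    using HomD(3)[OF p] HomD(3)[OF q] by (auto simp: Q_def dest: satD)
  have G_per: "is_per C P G"
  proof -
    have sym: "eqv w G h g" if "eqv w G g h" for w g h
      using that per_sym[OF X, of w "p \<cdot>\<^bsub>C\<^esub> g" "p \<cdot>\<^bsub>C\<^esub> h"] unfolding G by blast
    have trans: "eqv w G g k" if "eqv w G g h" "eqv w G h k" for w g h k
      using that per_trans[OF X, of w "p \<cdot>\<^bsub>C\<^esub> g" "p \<cdot>\<^bsub>C\<^esub> h" "p \<cdot>\<^bsub>C\<^esub> k"] unfolding G by blast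
    have "is_per C P (fst G, snd G)"
      unfolding is_per_iff
    proof (intro conjI allI impI)
      show "fst G \<in> Ob C" "snd G \<in> Preds P (Prod C [fst G, fst G])"
        by (simp_all add: G_def AB_Ob G_pred)
    qed (fact sym, fact trans)
    then show ?thesis by simp
  qed
  have p_tr: "is_tracked_map C P G X p"
    by (rule trackedI[OF G_per X]) (use p G in \<open>simp_all add: G_def\<close>)
  have q_tr: "is_tracked_map C P G Y q"
  proof (rule trackedI[OF G_per Y])
    show "q \<in> Hom C (fst G) (fst Y)" using q by (simp add: G_def)
    show "eqv w Y (q \<cdot>\<^bsub>C\<^esub> g) (q \<cdot>\<^bsub>C\<^esub> h)" if "eqv w G g h" for w g h
    proof -
      have g: "related w X Y \<phi> (p \<cdot>\<^bsub>C\<^esub> g) (q \<cdot>\<^bsub>C\<^esub> g)" and h: "related w X Y \<phi> (p \<cdot>\<^bsub>C\<^esub> h) (q \<cdot>\<^bsub>C\<^esub> h)"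
        and gh: "eqv w X (p \<cdot>\<^bsub>C\<^esub> g) (p \<cdot>\<^bsub>C\<^esub> h)" using that unfolding G by auto
      show ?thesis using funrel_fun[OF \<phi> g funrel_ext[OF \<phi> gh h funrel_cod[OF \<phi> h]]] .
    qed
  qed
  have span: "is_span X Y \<phi> G p q"
    unfolding is_span_def using G_per p_tr q_tr G by blast
  have weq: "is_weak_equivalence C P (G, X, p)"
    unfolding weak_equivalence_iff[OF G_per X p_tr]
  proof (intro conjI allI impI)
    show "eqv w G g h" if "eqv w G g g" "eqv w X (p \<cdot>\<^bsub>C\<^esub> g) (p \<cdot>\<^bsub>C\<^esub> h)" "eqv w G h h" for w g h
      using that unfolding G by blast
    fix w x assume x: "eqv w X x x"
    obtain e w' u where c: "covers w e w'" and xu: "related w' X Y \<phi> (x \<cdot>\<^bsub>C\<^esub> e) u"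
      using funrel_total[OF \<phi> x] by blast
    have el: "elements w' [fst X, fst Y] [x \<cdot>\<^bsub>C\<^esub> e, u]" using xu by (simp add: sat_def)
    define g where "g = tuple C (fst w') [x \<cdot>\<^bsub>C\<^esub> e, u]"
    have g: "g \<in> Hom C (fst w') ?AB" "p \<cdot>\<^bsub>C\<^esub> g = x \<cdot>\<^bsub>C\<^esub> e" "q \<cdot>\<^bsub>C\<^esub> g = u"
      unfolding g_def p_def q_def
      using elements_tuple(1)[OF el] elements_tuple(2)[OF el, of 0] elements_tuple(2)[OF el, of 1]
      by simp_all
    have "eqv w' G g g" unfolding G using g xu sat_mono[OF c x] by simp
    moreover have "eqv w' X (p \<cdot>\<^bsub>C\<^esub> g) (x \<cdot>\<^bsub>C\<^esub> e)" using g sat_mono[OF c x] by simp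
    ultimately show "\<exists>e w' g. covers w e w' \<and> eqv w' G g g \<and> eqv w' X (p \<cdot>\<^bsub>C\<^esub> g) (x \<cdot>\<^bsub>C\<^esub> e)"
      using c by blast
  qed
  have univ: "\<exists>t. is_tracked_map C P H G t \<and> p \<cdot>\<^bsub>C\<^esub> t = p' \<and> q \<cdot>\<^bsub>C\<^esub> t = q'"
    if H_span: "is_span X Y \<phi> H p' q'" for H p' q'
  proof -
    have H: "is_per C P H" and p': "is_tracked_map C P H X p'" and q': "is_tracked_map C P H Y q'"
      and pq': "\<And>w h. eqv w H h h \<Longrightarrow> related w X Y \<phi> (p' \<cdot>\<^bsub>C\<^esub> h) (q' \<cdot>\<^bsub>C\<^esub> h)"
      using H_span unfolding is_span_def by auto
    note p'H = trackedD(1)[OF H X p'] and q'H = trackedD(1)[OF H Y q']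
    define t where "t = tuple C (fst H) [p', q']"
    have "elements (fst H, \<top>\<^bsub>Fib P (fst H)\<^esub>) [fst X, fst Y] [p', q']"
      using p'H q'H perD(1)[OF H] top_in by (auto simp: elements_Cons elements_Nil)
    from elements_tuple(1)[OF this] elements_tuple(2)[OF this, of 0] elements_tuple(2)[OF this, of 1]
    have t: "t \<in> Hom C (fst H) ?AB" and pt: "p \<cdot>\<^bsub>C\<^esub> t = p'" and qt: "q \<cdot>\<^bsub>C\<^esub> t = q'"
      unfolding t_def p_def q_def by simp_all
    have "is_tracked_map C P H G t"
    proof (rule trackedI[OF H G_per])
      show "t \<in> Hom C (fst H) (fst G)" using t by (simp add: G_def)
      fix w h k assume hk: "eqv w H h k"
      have "p \<cdot>\<^bsub>C\<^esub> (t \<cdot>\<^bsub>C\<^esub> h) = p' \<cdot>\<^bsub>C\<^esub> h" "q \<cdot>\<^bsub>C\<^esub> (t \<cdot>\<^bsub>C\<^esub> h) = q' \<cdot>\<^bsub>C\<^esub> h"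
        "p \<cdot>\<^bsub>C\<^esub> (t \<cdot>\<^bsub>C\<^esub> k) = p' \<cdot>\<^bsub>C\<^esub> k" "q \<cdot>\<^bsub>C\<^esub> (t \<cdot>\<^bsub>C\<^esub> k) = q' \<cdot>\<^bsub>C\<^esub> k"
        using Cmp_assoc[OF satD(1)[OF hk] t p] Cmp_assoc[OF satD(1)[OF hk] t q]
          Cmp_assoc[OF satD(2)[OF hk] t p] Cmp_assoc[OF satD(2)[OF hk] t q] pt qt by simp_all
      then show "eqv w G (t \<cdot>\<^bsub>C\<^esub> h) (t \<cdot>\<^bsub>C\<^esub> k)"
        unfolding G
        using Cmp_in[OF satD(1)[OF hk] t] Cmp_in[OF satD(2)[OF hk] t] pq'[OF per_refl[OF H hk]]
          pq'[OF per_refl'[OF H hk]] trackedD(2)[OF H X p' hk] by simp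
    qed
    then show ?thesis using pt qt by blast
  qed
  show ?thesis using that[OF span weq univ] .
qed

text \<open>Applied to this span, the condition \<open>m \<circ> F p = F q\<close> reads \<open>m = F f\<close>.\<close>

lemma span_graph:
  assumes X: "is_per C P X" and Y: "is_per C P Y" and f: "is_tracked_map C P X Y f"
  shows "is_span X Y (graph C P X Y f) X (Ident C (fst X)) f"
  unfolding is_span_def graphD(2)[OF X Y f]
proof (intro conjI allI impI X f tracked_Ident[OF X])
  fix w h assume h: "eqv w X h h"
  show "eqv w X (Ident C (fst X) \<cdot>\<^bsub>C\<^esub> h) (Ident C (fst X) \<cdot>\<^bsub>C\<^esub> h)"
    and "eqv w Y (f \<cdot>\<^bsub>C\<^esub> (Ident C (fst X) \<cdot>\<^bsub>C\<^esub> h)) (f \<cdot>\<^bsub>C\<^esub> h)"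
    using h trackedD(2)[OF X Y f h] Ident_left[OF satD(1)[OF h]] by simp_all
qed

text \<open>One object \<open>H\<close> over \<open>G\<close> carries spans for \<open>\<gamma>\<close> and for \<open>\<gamma> \<circ> \<phi>\<close> with the same right leg. This is what compares
  the extensions of \<open>\<gamma>\<close>, \<open>\<phi>\<close> and \<open>\<gamma> \<circ> \<phi>\<close> without forming a pullback of graphs.\<close>

lemma span_comp:
  assumes \<phi>: "funrel X Y \<phi>" and \<gamma>: "funrel Y Z \<gamma>" and G: "is_span X Y \<phi> G p q"
    and H: "is_span G Z (comp_rel G Y Z \<gamma> (graph C P G Y q)) H p' q'"
  shows "is_span Y Z \<gamma> H (q \<cdot>\<^bsub>C\<^esub> p') q'" 
    and "is_span X Z (comp_rel X Y Z \<gamma> \<phi>) H (p \<cdot>\<^bsub>C\<^esub> p') q'"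
proof -
  note X = funrelD(1)[OF \<phi>] and Y = funrelD(1)[OF \<gamma>] and Z = funrelD(2)[OF \<gamma>]
  have per: "is_per C P G" "is_per C P H"
    and p: "is_tracked_map C P G X p" and q: "is_tracked_map C P G Y q"
    and p': "is_tracked_map C P H G p'" and q': "is_tracked_map C P H Z q'"
    and pq: "\<And>w g. eqv w G g g \<Longrightarrow> related w X Y \<phi> (p \<cdot>\<^bsub>C\<^esub> g) (q \<cdot>\<^bsub>C\<^esub> g)"
    and pq': "\<And>w h. eqv w H h h \<Longrightarrow>
      related w G Z (comp_rel G Y Z \<gamma> (graph C P G Y q)) (p' \<cdot>\<^bsub>C\<^esub> h) (q' \<cdot>\<^bsub>C\<^esub> h)"
    using G H unfolding is_span_def by auto
  note pp' = tracked_Cmp[OF per(2,1) X p' p] and qp' = tracked_Cmp[OF per(2,1) Y p' q]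
  note p'H = trackedD(1)[OF per(2,1) p']
  have \<gamma>h: "related w Y Z \<gamma> (q \<cdot>\<^bsub>C\<^esub> p' \<cdot>\<^bsub>C\<^esub> h) (q' \<cdot>\<^bsub>C\<^esub> h)"
    and \<phi>h: "related w X Y \<phi> (p \<cdot>\<^bsub>C\<^esub> p' \<cdot>\<^bsub>C\<^esub> h) (q \<cdot>\<^bsub>C\<^esub> p' \<cdot>\<^bsub>C\<^esub> h)" if h: "eqv w H h h" for w h
    using pq'[OF h] pq[OF trackedD(2)[OF per(2,1) p' h]]
      Cmp_assoc[OF satD(1)[OF h] p'H trackedD(1)[OF per(1) X p]]
      Cmp_assoc[OF satD(1)[OF h] p'H trackedD(1)[OF per(1) Y q]]
    unfolding comp_graph[OF per(1) Y q \<gamma>] by simp_all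
  show "is_span Y Z \<gamma> H (q \<cdot>\<^bsub>C\<^esub> p') q'"
    unfolding is_span_def using per(2) qp' q' \<gamma>h by blast
  show "is_span X Z (comp_rel X Y Z \<gamma> \<phi>) H (p \<cdot>\<^bsub>C\<^esub> p') q'"
    unfolding is_span_def using per(2) pp' q' comp_relI[OF \<phi> \<gamma> \<phi>h \<gamma>h] by blast
qed

end

section \<open>Factoring through an isomorphism\<close>

lemma (in category) iso_factor:
  assumes i: "is_iso C i" "i \<in> Hom C A B" and k: "k \<in> Hom C A D"
  shows "\<exists>!m. m \<in> Hom C B D \<and> m \<cdot>\<^bsub>C\<^esub> i = k"
proof -
  obtain j where j: "j \<in> Hom C B A" "j \<cdot>\<^bsub>C\<^esub> i = Ident C A" "i \<cdot>\<^bsub>C\<^esub> j = Ident C B"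
    using i HomD[OF i(2)] unfolding is_iso_def by auto
  show ?thesis
  proof (rule ex1I[of _ "k \<cdot>\<^bsub>C\<^esub> j"])
    show "k \<cdot>\<^bsub>C\<^esub> j \<in> Hom C B D \<and> k \<cdot>\<^bsub>C\<^esub> j \<cdot>\<^bsub>C\<^esub> i = k"
      using Cmp_in[OF j(1) k] Cmp_assoc[OF i(2) j(1) k] j(2) Ident_right[OF k] by simp
    show "m = k \<cdot>\<^bsub>C\<^esub> j" if "m \<in> Hom C B D \<and> m \<cdot>\<^bsub>C\<^esub> i = k" for m
      using that Cmp_assoc[OF j(1) i(2), of m D] j(3) Ident_right[of m B D] by auto
  qed
qed

lemma (in category) iso_cancel:
  assumes i: "is_iso C i" "i \<in> Hom C A B" and m: "m \<in> Hom C B D" "m' \<in> Hom C B D"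
    and eq: "m \<cdot>\<^bsub>C\<^esub> i = m' \<cdot>\<^bsub>C\<^esub> i"
  shows "m = m'"
proof -
  have "\<exists>!k. k \<in> Hom C B D \<and> k \<cdot>\<^bsub>C\<^esub> i = m' \<cdot>\<^bsub>C\<^esub> i"
    using iso_factor[OF i Cmp_in[OF i(2) m(2)]] .
  then show ?thesis using m eq by blast
qed

section \<open>The universal property\<close>

locale inverting_functor = indexed_frame C P + F: category_functor "C\<langle>P\<rangle>" D F
  for C :: "('o, 'm, 'z) fl_cat_scheme" and P :: "('o, 'm, 'p) indexed"
    and D :: "('d, 'e, 'y) cat_scheme"
    and F :: "('o \<times> 'p, ('o, 'p, 'm) per_arrow, 'd, 'e) ftor" +
  assumes inverts: "f \<in> Ar C\<langle>P\<rangle> \<Longrightarrow> is_weak_equivalence C P f \<Longrightarrow> is_iso D (FAr F f)"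
begin

abbreviation F_map :: "'o \<times> 'p \<Rightarrow> 'o \<times> 'p \<Rightarrow> 'm \<Rightarrow> 'e" where
  "F_map X Y f \<equiv> FAr F (X, Y, f)"

text \<open>The condition that \<open>\<phi> \<circ> E p = E q\<close> imposes on the image of \<open>\<phi>\<close> under an extension of \<open>F\<close>.\<close>

definition extends_spans :: "'o \<times> 'p \<Rightarrow> 'o \<times> 'p \<Rightarrow> 'p \<Rightarrow> 'e \<Rightarrow> bool" where
  "extends_spans X Y \<phi> m \<longleftrightarrow> m \<in> Hom D (FOb F X) (FOb F Y) \<and>
    (\<forall>H p q. is_span X Y \<phi> H p q \<longrightarrow> m \<cdot>\<^bsub>D\<^esub> F_map H X p = F_map H Y q)"

definition lift_rel :: "'o \<times> 'p \<Rightarrow> 'o \<times> 'p \<Rightarrow> 'p \<Rightarrow> 'e" where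
  "lift_rel X Y \<phi> = (THE m. extends_spans X Y \<phi> m)"

definition lift_functor :: "('o \<times> 'p, ('o, 'p, 'p) per_arrow, 'd, 'e) ftor" where
  "lift_functor = \<lparr>FOb = FOb F, FAr = (\<lambda>(X, Y, \<phi>) \<in> Ar C\<lblot>P\<rblot>. lift_rel X Y \<phi>)\<rparr>"

lemma F_map_Hom:
  "is_per C P X \<Longrightarrow> is_per C P Y \<Longrightarrow> is_tracked_map C P X Y f \<Longrightarrow>
    F_map X Y f \<in> Hom D (FOb F X) (FOb F Y)"
  by (rule F.FAr_Hom) (simp add: per_cat_Hom)

lemma F_map_Cmp:
  assumes "is_per C P X" "is_per C P Y" "is_per C P Z"
    "is_tracked_map C P X Y f" "is_tracked_map C P Y Z g"
  shows "F_map X Z (g \<cdot>\<^bsub>C\<^esub> f) = F_map Y Z g \<cdot>\<^bsub>D\<^esub> F_map X Y f"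
  using F.FAr_Cmp[of "(X, Y, f)" X Y "(Y, Z, g)" Z] assms by (simp add: per_cat_Hom cat_simps)

lemma F_map_Ident:
  "is_per C P X \<Longrightarrow> F_map X X (Ident C (fst X)) = Ident D (FOb F X)"
  using F.FAr_Ident[of X] by (simp add: cat_simps)

text \<open>The graph span alone determines \<open>m\<close>, since its left leg is inverted by \<open>F\<close>, and every other span
  factors through it.\<close>

lemma ex1_extends_spans:
  assumes \<phi>: "funrel X Y \<phi>"
  shows "\<exists>!m. extends_spans X Y \<phi> m"
proof -
  note X = funrelD(1)[OF \<phi>] and Y = funrelD(2)[OF \<phi>]
  obtain G p q where G: "is_span X Y \<phi> G p q" and weq: "is_weak_equivalence C P (G, X, p)"
    and univ: "\<And>H p' q'. is_span X Y \<phi> H p' q' \<Longrightarrow>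
      \<exists>t. is_tracked_map C P H G t \<and> p \<cdot>\<^bsub>C\<^esub> t = p' \<and> q \<cdot>\<^bsub>C\<^esub> t = q'"
    using ex_graph_span[OF \<phi>] by blast
  have per: "is_per C P G" and p: "is_tracked_map C P G X p" and q: "is_tracked_map C P G Y q"
    using G unfolding is_span_def by auto
  note Fp = F_map_Hom[OF per X p] and Fq = F_map_Hom[OF per Y q]
  have "is_iso D (F_map G X p)"
    by (rule inverts[OF _ weq]) (simp add: cat_simps per X p)
  from F.target.iso_factor[OF this Fp Fq]
  have ex1: "\<exists>!m. m \<in> Hom D (FOb F X) (FOb F Y) \<and> m \<cdot>\<^bsub>D\<^esub> F_map G X p = F_map G Y q" .
  have "extends_spans X Y \<phi> m \<longleftrightarrow>
      m \<in> Hom D (FOb F X) (FOb F Y) \<and> m \<cdot>\<^bsub>D\<^esub> F_map G X p = F_map G Y q" for m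
  proof
    assume "extends_spans X Y \<phi> m"
    then show "m \<in> Hom D (FOb F X) (FOb F Y) \<and> m \<cdot>\<^bsub>D\<^esub> F_map G X p = F_map G Y q"
      unfolding extends_spans_def using G by blast
  next
    assume m: "m \<in> Hom D (FOb F X) (FOb F Y) \<and> m \<cdot>\<^bsub>D\<^esub> F_map G X p = F_map G Y q"
    have "m \<cdot>\<^bsub>D\<^esub> F_map H X p' = F_map H Y q'" if H: "is_span X Y \<phi> H p' q'" for H p' q'
    proof -
      have perH: "is_per C P H" using H unfolding is_span_def by blast
      obtain t where t: "is_tracked_map C P H G t" "p \<cdot>\<^bsub>C\<^esub> t = p'" "q \<cdot>\<^bsub>C\<^esub> t = q'"
        using univ[OF H] by blast
      have "m \<cdot>\<^bsub>D\<^esub> F_map H X p' = m \<cdot>\<^bsub>D\<^esub> (F_map G X p \<cdot>\<^bsub>D\<^esub> F_map H G t)"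
        using F_map_Cmp[OF perH per X t(1) p] t(2) by simp
      also have "\<dots> = F_map G Y q \<cdot>\<^bsub>D\<^esub> F_map H G t"
        using F.target.Cmp_assoc[OF F_map_Hom[OF perH per t(1)] Fp conjunct1[OF m]] m by simp
      also have "\<dots> = F_map H Y q'"
        using F_map_Cmp[OF perH per Y t(1) q] t(3) by simp
      finally show ?thesis .
    qed
    with m show "extends_spans X Y \<phi> m" unfolding extends_spans_def by blast
  qed
  with ex1 show ?thesis by simp
qed

lemma lift_rel_extends: "funrel X Y \<phi> \<Longrightarrow> extends_spans X Y \<phi> (lift_rel X Y \<phi>)"
  unfolding lift_rel_def by (rule theI'[OF ex1_extends_spans])

lemma lift_rel_Hom: "funrel X Y \<phi> \<Longrightarrow> lift_rel X Y \<phi> \<in> Hom D (FOb F X) (FOb F Y)"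
  using lift_rel_extends unfolding extends_spans_def by blast

lemma lift_rel_span:
  "funrel X Y \<phi> \<Longrightarrow> is_span X Y \<phi> H p q \<Longrightarrow> lift_rel X Y \<phi> \<cdot>\<^bsub>D\<^esub> F_map H X p = F_map H Y q"
  using lift_rel_extends unfolding extends_spans_def by blast

lemma lift_rel_unique: "funrel X Y \<phi> \<Longrightarrow> extends_spans X Y \<phi> m \<Longrightarrow> m = lift_rel X Y \<phi>"
  using ex1_extends_spans lift_rel_extends by blast

lemma lift_rel_graph:
  assumes X: "is_per C P X" and Y: "is_per C P Y" and f: "is_tracked_map C P X Y f"
  shows "lift_rel X Y (graph C P X Y f) = F_map X Y f"
proof -
  note F = funrel_graph[OF X Y f]
  have "lift_rel X Y (graph C P X Y f) \<cdot>\<^bsub>D\<^esub> Ident D (FOb F X) = F_map X Y f"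
    using lift_rel_span[OF F span_graph[OF X Y f]] unfolding F_map_Ident[OF X] .
  then show ?thesis unfolding F.target.Ident_right[OF lift_rel_Hom[OF F]] .
qed

text \<open>Both sides agree after composition with \<open>F p\<close> and \<open>F p'\<close>, where \<open>p\<close> and \<open>p'\<close> are the left legs of the graph
  spans of \<open>\<phi>\<close> and of \<open>\<gamma> \<circ> E q\<close>; both are weak equivalences, so they can be cancelled.\<close>

lemma lift_rel_comp:
  assumes \<phi>: "funrel X Y \<phi>" and \<gamma>: "funrel Y Z \<gamma>"
  shows "lift_rel X Z (comp_rel X Y Z \<gamma> \<phi>) = lift_rel Y Z \<gamma> \<cdot>\<^bsub>D\<^esub> lift_rel X Y \<phi>"
proof -
  note X = funrelD(1)[OF \<phi>] and Y = funrelD(1)[OF \<gamma>] and Z = funrelD(2)[OF \<gamma>]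
  note \<gamma>\<phi> = funrel_comp[OF \<phi> \<gamma>]
  obtain G p q where G: "is_span X Y \<phi> G p q" and p_weq: "is_weak_equivalence C P (G, X, p)"
    by (rule ex_graph_span[OF \<phi>], rule that)
  have per: "is_per C P G" and p: "is_tracked_map C P G X p" and q: "is_tracked_map C P G Y q"
    using G unfolding is_span_def by auto
  have \<theta>: "funrel G Z (comp_rel G Y Z \<gamma> (graph C P G Y q))"
    using funrel_comp[OF funrel_graph[OF per Y q] \<gamma>] .
  obtain H p' q' where H: "is_span G Z (comp_rel G Y Z \<gamma> (graph C P G Y q)) H p' q'"
    and p'_weq: "is_weak_equivalence C P (H, G, p')"
    by (rule ex_graph_span[OF \<theta>], rule that)
  have per': "is_per C P H" and p': "is_tracked_map C P H G p'" and q': "is_tracked_map C P H Z q'"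
    using H unfolding is_span_def by auto
  note span = span_comp[OF \<phi> \<gamma> G H]
  note Fp = F_map_Hom[OF per X p] and Fp' = F_map_Hom[OF per' per p'] and Fq = F_map_Hom[OF per Y q]
    and Fq' = F_map_Hom[OF per' Z q']
  have iso: "is_iso D (F_map G X p)" "is_iso D (F_map H G p')"
    by (rule inverts[OF _ p_weq] inverts[OF _ p'_weq]; simp add: cat_simps X per per' p p')+
  note L\<phi> = lift_rel_Hom[OF \<phi>] and L\<gamma> = lift_rel_Hom[OF \<gamma>] and L\<gamma>\<phi> = lift_rel_Hom[OF \<gamma>\<phi>]
  let ?m = "lift_rel Y Z \<gamma> \<cdot>\<^bsub>D\<^esub> lift_rel X Y \<phi>"
  note m = F.target.Cmp_in[OF L\<phi> L\<gamma>]
  have "?m \<cdot>\<^bsub>D\<^esub> F_map G X p \<cdot>\<^bsub>D\<^esub> F_map H G p' =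
      lift_rel Y Z \<gamma> \<cdot>\<^bsub>D\<^esub> F_map G Y q \<cdot>\<^bsub>D\<^esub> F_map H G p'"
    unfolding F.target.Cmp_assoc[OF Fp L\<phi> L\<gamma>, symmetric] lift_rel_span[OF \<phi> G] ..
  also have "\<dots> = lift_rel Y Z \<gamma> \<cdot>\<^bsub>D\<^esub> F_map H Y (q \<cdot>\<^bsub>C\<^esub> p')"
    unfolding F_map_Cmp[OF per' per Y p' q] by (rule F.target.Cmp_assoc[OF Fp' Fq L\<gamma>, symmetric])
  also have "\<dots> = F_map H Z q'"
    using lift_rel_span[OF \<gamma> span(1)] .
  also have "\<dots> = lift_rel X Z (comp_rel X Y Z \<gamma> \<phi>) \<cdot>\<^bsub>D\<^esub> F_map H X (p \<cdot>\<^bsub>C\<^esub> p')"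
    by (rule lift_rel_span[OF \<gamma>\<phi> span(2), symmetric])
  also have "\<dots> = lift_rel X Z (comp_rel X Y Z \<gamma> \<phi>) \<cdot>\<^bsub>D\<^esub> F_map G X p \<cdot>\<^bsub>D\<^esub> F_map H G p'"
    unfolding F_map_Cmp[OF per' per X p' p] by (rule F.target.Cmp_assoc[OF Fp' Fp L\<gamma>\<phi>])
  finally have "?m \<cdot>\<^bsub>D\<^esub> F_map G X p = lift_rel X Z (comp_rel X Y Z \<gamma> \<phi>) \<cdot>\<^bsub>D\<^esub> F_map G X p"
    by (rule F.target.iso_cancel[OF iso(2) Fp' F.target.Cmp_in[OF Fp m] F.target.Cmp_in[OF Fp L\<gamma>\<phi>]])
  from F.target.iso_cancel[OF iso(1) Fp m L\<gamma>\<phi> this] show ?thesis by (rule sym)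
qed

lemma category_functor_lift: "category_functor C\<lblot>P\<rblot> D lift_functor"
proof (intro category_functor.intro category_rel_cat F.target.category_axioms
    category_functor_axioms.intro)
  have lift: "FAr lift_functor (X, Y, \<phi>) = lift_rel X Y \<phi>" if "funrel X Y \<phi>" for X Y \<phi>
    using that by (simp add: lift_functor_def cat_simps)
  show "FOb lift_functor \<in> Ob C\<lblot>P\<rblot> \<rightarrow>\<^sub>E Ob D"
    using F.FOb_in by (simp add: lift_functor_def cat_simps)
  show "FAr lift_functor \<in> Ar C\<lblot>P\<rblot> \<rightarrow>\<^sub>E Ar D"
  proof (rule PiE_I)
    fix m assume "m \<in> Ar C\<lblot>P\<rblot>"
    then obtain X Y \<phi> where "m = (X, Y, \<phi>)" "funrel X Y \<phi>"
      by (auto simp: rel_cat_def funrel_def)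
    then show "FAr lift_functor m \<in> Ar D"
      using lift HomD(1)[OF lift_rel_Hom] by simp
  qed (simp add: lift_functor_def)
  show "FAr lift_functor (Ident C\<lblot>P\<rblot> X) = Ident D (FOb lift_functor X)" if "X \<in> Ob C\<lblot>P\<rblot>" for X
  proof -
    have X: "is_per C P X" using that by (simp add: cat_simps)
    show ?thesis
      using lift[OF funrel_Ident[OF X]] lift_rel_graph[OF X X tracked_Ident[OF X]]
        graph_Ident[OF X] F_map_Ident[OF X] by (simp add: cat_simps lift_functor_def)
  qed
  fix m X Y assume "m \<in> Hom C\<lblot>P\<rblot> X Y"
  then obtain \<phi> where \<phi>: "m = (X, Y, \<phi>)" "funrel X Y \<phi>" by (auto simp: rel_cat_Hom)
  show "FAr lift_functor m \<in> Hom D (FOb lift_functor X) (FOb lift_functor Y)"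
    using \<phi> lift lift_rel_Hom[OF \<phi>(2)] by (simp add: lift_functor_def)
  fix n Z assume "n \<in> Hom C\<lblot>P\<rblot> Y Z"
  then obtain \<gamma> where \<gamma>: "n = (Y, Z, \<gamma>)" "funrel Y Z \<gamma>" by (auto simp: rel_cat_Hom)
  show "FAr lift_functor (n \<cdot>\<^bsub>C\<lblot>P\<rblot>\<^esub> m) = FAr lift_functor n \<cdot>\<^bsub>D\<^esub> FAr lift_functor m"
    using \<phi> \<gamma> lift[OF \<phi>(2)] lift[OF \<gamma>(2)] lift[OF funrel_comp[OF \<phi>(2) \<gamma>(2)]]
      lift_rel_comp[OF \<phi>(2) \<gamma>(2)] by (simp add: cat_simps)
qed

lemma lift_functor_comp_E: "ftor_comp C\<langle>P\<rangle> lift_functor (E_functor C P) = F"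
proof (rule ftor.equality)
  show "FOb (ftor_comp C\<langle>P\<rangle> lift_functor (E_functor C P)) = FOb F"
  proof (rule extensionalityI[of _ "Ob C\<langle>P\<rangle>"])
    show "FOb F \<in> extensional (Ob C\<langle>P\<rangle>)" using F.FOb_in by (simp add: PiE_def)
    show "FOb (ftor_comp C\<langle>P\<rangle> lift_functor (E_functor C P)) X = FOb F X" if "X \<in> Ob C\<langle>P\<rangle>" for X
      using that by (simp add: ftor_comp_def compose_eq E_functor_simps lift_functor_def cat_simps)
  qed (simp add: ftor_comp_def)
  show "FAr (ftor_comp C\<langle>P\<rangle> lift_functor (E_functor C P)) = FAr F"
  proof (rule extensionalityI[of _ "Ar C\<langle>P\<rangle>"])
    show "FAr F \<in> extensional (Ar C\<langle>P\<rangle>)" using F.FAr_in by (simp add: PiE_def)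
    fix m assume m: "m \<in> Ar C\<langle>P\<rangle>"
    then obtain X Y f where f: "m = (X, Y, f)" "is_per C P X" "is_per C P Y" "is_tracked_map C P X Y f"
      by (auto simp: per_cat_def)
    show "FAr (ftor_comp C\<langle>P\<rangle> lift_functor (E_functor C P)) m = FAr F m"
      using m f lift_rel_graph[OF f(2-4)] funrel_graph[OF f(2-4)]
      by (simp add: ftor_comp_def compose_eq E_functor_simps lift_functor_def cat_simps)
  qed (simp add: ftor_comp_def)
qed simp

lemma lift_functor_unique:
  assumes F': "category_functor C\<lblot>P\<rblot> D F'" and eq: "ftor_comp C\<langle>P\<rangle> F' (E_functor C P) = F"
  shows "F' = lift_functor"
proof (rule ftor.equality)
  interpret F': category_functor "C\<lblot>P\<rblot>" D F' using F' .
  have ob: "FOb F' X = FOb F X" if "is_per C P X" for X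
    using that by (simp add: eq[symmetric] ftor_comp_def compose_eq E_functor_simps cat_simps)
  have map: "FAr F' (X, Y, graph C P X Y f) = F_map X Y f"
    if "is_per C P X" "is_per C P Y" "is_tracked_map C P X Y f" for X Y f
    using that by (simp add: eq[symmetric] ftor_comp_def compose_eq E_functor_simps cat_simps)
  show "FOb F' = FOb lift_functor"
  proof (rule extensionalityI[of _ "Ob C\<lblot>P\<rblot>"])
    show "FOb F' \<in> extensional (Ob C\<lblot>P\<rblot>)" using F'.FOb_in by (simp add: PiE_def)
    show "FOb lift_functor \<in> extensional (Ob C\<lblot>P\<rblot>)"
      using F.FOb_in by (simp add: PiE_def lift_functor_def cat_simps)
  qed (simp add: cat_simps lift_functor_def ob)
  show "FAr F' = FAr lift_functor"
  proof (rule extensionalityI[of _ "Ar C\<lblot>P\<rblot>"])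
    show "FAr F' \<in> extensional (Ar C\<lblot>P\<rblot>)" using F'.FAr_in by (simp add: PiE_def)
    show "FAr lift_functor \<in> extensional (Ar C\<lblot>P\<rblot>)" by (simp add: lift_functor_def)
    fix m assume m: "m \<in> Ar C\<lblot>P\<rblot>"
    then obtain X Y \<phi> where \<phi>: "m = (X, Y, \<phi>)" "funrel X Y \<phi>"
      by (auto simp: rel_cat_def funrel_def)
    note X = funrelD(1)[OF \<phi>(2)] and Y = funrelD(2)[OF \<phi>(2)]
    have "extends_spans X Y \<phi> (FAr F' (X, Y, \<phi>))"
      unfolding extends_spans_def
    proof (intro conjI allI impI)
      show "FAr F' (X, Y, \<phi>) \<in> Hom D (FOb F X) (FOb F Y)"
        using F'.FAr_Hom[of "(X, Y, \<phi>)" X Y] \<phi>(2) ob X Y by (simp add: rel_cat_Hom)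
      fix H p q assume H: "is_span X Y \<phi> H p q"
      then have per: "is_per C P H" and p: "is_tracked_map C P H X p" and q: "is_tracked_map C P H Y q"
        unfolding is_span_def by auto
      have "FAr F' ((X, Y, \<phi>) \<cdot>\<^bsub>C\<lblot>P\<rblot>\<^esub> (H, X, graph C P H X p)) =
          FAr F' (X, Y, \<phi>) \<cdot>\<^bsub>D\<^esub> FAr F' (H, X, graph C P H X p)"
        by (rule F'.FAr_Cmp) (use \<phi>(2) funrel_graph[OF per X p] in \<open>simp_all add: rel_cat_Hom\<close>)
      then show "FAr F' (X, Y, \<phi>) \<cdot>\<^bsub>D\<^esub> F_map H X p = F_map H Y q"
        using span_comp_graph[OF \<phi>(2) H] map[OF per X p] map[OF per Y q] by (simp add: cat_simps)
    qed
    from lift_rel_unique[OF \<phi>(2) this] show "FAr F' m = FAr lift_functor m"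
      using \<phi> m by (simp add: lift_functor_def)
  qed
qed simp

end

theorem theorem5p5:
  fixes C :: "('o, 'm) fl_cat" and P :: "('o, 'm, 'p) indexed"
  assumes "indexed_frame C P"
  shows "category_functor C\<langle>P\<rangle> C\<lblot>P\<rblot> (E_functor C P) \<and>
    (\<forall>f \<in> Ar C\<langle>P\<rangle>. is_weak_equivalence C P f \<longleftrightarrow> is_iso C\<lblot>P\<rblot> (FAr (E_functor C P) f)) \<and>
    (\<forall>(D :: ('d, 'e) cat) F.
      category D \<and> category_functor C\<langle>P\<rangle> D F \<and>
      (\<forall>f \<in> Ar C\<langle>P\<rangle>. is_weak_equivalence C P f \<longrightarrow> is_iso D (FAr F f)) \<longrightarrow>
      (\<exists>!F'. category_functor C\<lblot>P\<rblot> D F' \<and> ftor_comp C\<langle>P\<rangle> F' (E_functor C P) = F))"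
proof (intro conjI ballI allI impI)
  interpret indexed_frame C P by fact
  show "category_functor C\<langle>P\<rangle> C\<lblot>P\<rblot> (E_functor C P)" by (rule category_functor_E)
  show "is_weak_equivalence C P f \<longleftrightarrow> is_iso C\<lblot>P\<rblot> (FAr (E_functor C P) f)" if "f \<in> Ar C\<langle>P\<rangle>" for f
    using that by (rule weak_equivalence_iff_iso)
  fix D :: "('d, 'e) cat" and F
  assume F: "category D \<and> category_functor C\<langle>P\<rangle> D F \<and>
    (\<forall>f \<in> Ar C\<langle>P\<rangle>. is_weak_equivalence C P f \<longrightarrow> is_iso D (FAr F f))"
  interpret inverting_functor C P D F
    using F indexed_frame_axioms by (simp add: inverting_functor_def inverting_functor_axioms_def)
  show "\<exists>!F'. category_functor C\<lblot>P\<rblot> D F' \<and> ftor_comp C\<langle>P\<rangle> F' (E_functor C P) = F"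
  proof (rule ex1I)
    show "category_functor C\<lblot>P\<rblot> D lift_functor \<and>
        ftor_comp C\<langle>P\<rangle> lift_functor (E_functor C P) = F"
      using category_functor_lift lift_functor_comp_E ..
  qed (elim conjE, rule lift_functor_unique)
qed

end
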